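(* Let $(\mathcal{E},\mathcal{E}_+,U,H)$ be a regular multiplicity free Hankel positive representation of $(\mathbb{R},\mathbb{R}_+,-\mathrm{id}_{\mathbb{R}})$. Then there exist an invertible bounded operator $g \in \mathrm{GL}(\mathcal{E})$ with $g\mathcal{E}_+ = \mathcal{E}_+$ which commutes with $(U_t)_{t\in\mathbb{R}}$, and a unitary involution $\theta \in \mathrm{GL}(\mathcal{E})$, such that: (a) $\theta U_t\theta = U_{-t}$ for all $t \in \mathbb{R}$. (b) $\theta$ is unitary for the scalar product $\langle \xi,\eta\rangle_g := \langle g\xi, g\eta\rangle$. (c) With respect to $\langle\cdot,\cdot\rangle_g$, the quadruple $(\mathcal{E},\mathcal{E}_+,\theta,U)$ is a reflection positive representation of $(\mathbb{R},\mathbb{R}_+,-\mathrm{id}_{\mathbb{R}})$. (d) $\langle \xi, H\eta\rangle = \langle \xi,\theta\eta\rangle_g = \langle g\xi, g\theta\eta\rangle$ for all $\xi,\eta \in \mathcal{E}_+$.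
   Context: $\mathbb{R}_+ = (0,\infty)$; scalar products are antilinear in the first argument. A representation of the pair $(\mathbb{R},\mathbb{R}_+)$ is a triple $(\mathcal{E},\mathcal{E}_+,U)$, where $U = (U_t)_{t\in\mathbb{R}}$ is a strongly continuous unitary one-parameter group on the complex Hilbert space $\mathcal{E}$ and $\mathcal{E}_+ \subseteq \mathcal{E}$ is a closed subspace with $U_t\mathcal{E}_+ \subseteq \mathcal{E}_+$ for $t > 0$. It is regular if $\bigcap_{t\in\mathbb{R}} U_t\mathcal{E}_+ = \{0\}$ and the closed linear span of $\bigcup_{t\in\mathbb{R}} U_t\mathcal{E}_+$ is $\mathcal{E}$. By the Lax--Phillips theorem, a regular representation is unitarily equivalent to $(L^2(\mathbb{R},\mathcal{K}),L^2(\mathbb{R}_+,\mathcal{K}),S)$ with $(S_tf)(x) = f(x-t)$ for a Hilbert space $\mathcal{K}$ (the multiplicity space); it is multiplicity free if $\mathcal{K} = \mathbb{C}$. Equivalently (by Fourier transform), it is unitarily equivalent to $(L^2(\mathbb{R}),H^2(\mathbb{C}_+),U)$ with $(U_tf)(x) = e^{itx}f(x)$, where the Hardy space $H^2(\mathbb{C}_+)$ of the upper half plane is identified with a subspace of $L^2(\mathbb{R})$ via boundary values. A Hankel positive representation of $(\mathbb{R},\mathbb{R}_+,-\mathrm{id}_{\mathbb{R}})$ is a quadruple $(\mathcal{E},\mathcal{E}_+,U,H)$, where $(\mathcal{E},\mathcal{E}_+,U)$ is a representation of $(\mathbb{R},\mathbb{R}_+)$ and $H \in B(\mathcal{E}_+)$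 is a positive operator satisfying $H\,U_+(t) = U_+(t)^* H$ for all $t > 0$, where $U_+(t) := U_t|_{\mathcal{E}_+} \in B(\mathcal{E}_+)$. It is called regular, resp. multiplicity free, if $(\mathcal{E},\mathcal{E}_+,U)$ is. A reflection positive representation of $(\mathbb{R},\mathbb{R}_+,-\mathrm{id}_{\mathbb{R}})$ is a quadruple $(\mathcal{E},\mathcal{E}_+,\theta,U)$, where $(\mathcal{E},\mathcal{E}_+,U)$ is a representation of the pair $(\mathbb{R},\mathbb{R}_+)$ and $\theta$ is a unitary involution on $\mathcal{E}$ with $\langle\xi,\theta\xi\rangle \geq 0$ for all $\xi\in\mathcal{E}_+$ and $\theta U_t\theta = U_{-t}$ for all $t\in\mathbb{R}$. *)

theory Defs
  imports "HOL-Analysis.Analysis"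
begin

section \<open>Complex Hilbert spaces\<close>

text \<open>
  A Hilbert space is a complex vector space on a whole type together with an explicit scalar
  product. The scalar product is a parameter (not a type class operation) because the same
  vector space has to be considered with two different scalar products.
\<close>

definition ip_dist :: "('a::ab_group_add \<Rightarrow> 'a \<Rightarrow> complex) \<Rightarrow> 'a \<Rightarrow> 'a \<Rightarrow> real" where
  "ip_dist ip x y = sqrt (Re (ip (x - y) (x - y)))"

abbreviation ip_norm :: "('a::ab_group_add \<Rightarrow> 'a \<Rightarrow> complex) \<Rightarrow> 'a \<Rightarrow> real" where
  "ip_norm ip x \<equiv> sqrt (Re (ip x x))"

abbreviation ip_topology :: "('a::ab_group_add \<Rightarrow> 'a \<Rightarrow> complex) \<Rightarrow> 'a topology" where
  "ip_topology ip \<equiv> Metric_space.mtopology UNIV (ip_dist ip)"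

text \<open>Scalar products are antilinear in the first argument.\<close>

locale complex_hilbert_space = vector_space smul
  for smul :: "complex \<Rightarrow> 'a::ab_group_add \<Rightarrow> 'a" +
  fixes ip :: "'a \<Rightarrow> 'a \<Rightarrow> complex"
  assumes ip_add_right: "ip x (y + z) = ip x y + ip x z"
    and ip_scale_right: "ip x (smul c y) = c * ip x y"
    and ip_commute: "ip x y = cnj (ip y x)"
    and ip_nonneg: "ip x x \<in> \<real>\<^sub>\<ge>\<^sub>0"
    and ip_definite: "ip x x = 0 \<Longrightarrow> x = 0"
    and complete: "Metric_space.mcomplete UNIV (ip_dist ip)"


section \<open>Operators\<close>

text \<open>
  Operators on a subspace \<open>W\<close> are functions on the whole type of which only the values on
  \<open>W\<close> matter.
\<close>

definition bounded_operators_on ::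
    "(complex \<Rightarrow> 'a::ab_group_add \<Rightarrow> 'a) \<Rightarrow> ('a \<Rightarrow> 'a \<Rightarrow> complex) \<Rightarrow> 'a set \<Rightarrow> ('a \<Rightarrow> 'a) set" where
  "bounded_operators_on smul ip W = {A.
     A ` W \<subseteq> W \<and>
     (\<forall>x\<in>W. \<forall>y\<in>W. A (x + y) = A x + A y) \<and>
     (\<forall>c. \<forall>x\<in>W. A (smul c x) = smul c (A x)) \<and>
     (\<exists>C. \<forall>x\<in>W. ip_norm ip (A x) \<le> C * ip_norm ip x)}"

definition GL ::
    "(complex \<Rightarrow> 'a::ab_group_add \<Rightarrow> 'a) \<Rightarrow> ('a \<Rightarrow> 'a \<Rightarrow> complex) \<Rightarrow> ('a \<Rightarrow> 'a) set" where
  "GL smul ip = {A. A \<in> bounded_operators_on smul ip UNIV \<and> bij A \<and>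
     inv A \<in> bounded_operators_on smul ip UNIV}"

definition positive_operator_on :: "('a \<Rightarrow> 'a \<Rightarrow> complex) \<Rightarrow> 'a set \<Rightarrow> ('a \<Rightarrow> 'a) \<Rightarrow> bool" where
  "positive_operator_on ip W A \<longleftrightarrow> (\<forall>x\<in>W. ip x (A x) \<in> \<real>\<^sub>\<ge>\<^sub>0)"

text \<open>The adjoint \<open>A\<^sup>* \<in> B(W)\<close> of a bounded operator \<open>A\<close> on the closed subspace \<open>W\<close>.\<close>

definition adjoint_on :: "('a \<Rightarrow> 'a \<Rightarrow> complex) \<Rightarrow> 'a set \<Rightarrow> ('a \<Rightarrow> 'a) \<Rightarrow> 'a \<Rightarrow> 'a" where
  "adjoint_on ip W A y = (THE z. z \<in> W \<and> (\<forall>x\<in>W. ip (A x) y = ip x z))"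

definition unitary_map ::
    "(complex \<Rightarrow> 'a::ab_group_add \<Rightarrow> 'a) \<Rightarrow> ('a \<Rightarrow> 'a \<Rightarrow> complex) \<Rightarrow>
     (complex \<Rightarrow> 'b::ab_group_add \<Rightarrow> 'b) \<Rightarrow> ('b \<Rightarrow> 'b \<Rightarrow> complex) \<Rightarrow> ('a \<Rightarrow> 'b) \<Rightarrow> bool" where
  "unitary_map smul1 ip1 smul2 ip2 V \<longleftrightarrow>
     Vector_Spaces.linear smul1 smul2 V \<and> bij V \<and> (\<forall>x y. ip2 (V x) (V y) = ip1 x y)"

abbreviation unitary_operator ::
    "(complex \<Rightarrow> 'a::ab_group_add \<Rightarrow> 'a) \<Rightarrow> ('a \<Rightarrow> 'a \<Rightarrow> complex) \<Rightarrow> ('a \<Rightarrow> 'a) \<Rightarrow> bool" where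
  "unitary_operator smul ip \<equiv> unitary_map smul ip smul ip"

definition unitary_involution ::
    "(complex \<Rightarrow> 'a::ab_group_add \<Rightarrow> 'a) \<Rightarrow> ('a \<Rightarrow> 'a \<Rightarrow> complex) \<Rightarrow> ('a \<Rightarrow> 'a) \<Rightarrow> bool" where
  "unitary_involution smul ip \<theta> \<longleftrightarrow> unitary_operator smul ip \<theta> \<and> \<theta> \<circ> \<theta> = id"

definition unitary_one_parameter_group ::
    "(complex \<Rightarrow> 'a::ab_group_add \<Rightarrow> 'a) \<Rightarrow> ('a \<Rightarrow> 'a \<Rightarrow> complex) \<Rightarrow> (real \<Rightarrow> 'a \<Rightarrow> 'a) \<Rightarrow> bool" where
  "unitary_one_parameter_group smul ip U \<longleftrightarrow>
     (\<forall>t. unitary_operator smul ip (U t)) \<and>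
     U 0 = id \<and> (\<forall>s t. U (s + t) = U s \<circ> U t) \<and>
     (\<forall>x. continuous_map euclideanreal (ip_topology ip) (\<lambda>t. U t x))"


section \<open>Representations of the pair \<open>(\<real>, \<real>\<^sub>+)\<close>\<close>

definition pair_representation ::
    "(complex \<Rightarrow> 'a::ab_group_add \<Rightarrow> 'a) \<Rightarrow> ('a \<Rightarrow> 'a \<Rightarrow> complex) \<Rightarrow> 'a set \<Rightarrow>
     (real \<Rightarrow> 'a \<Rightarrow> 'a) \<Rightarrow> bool" where
  "pair_representation smul ip Ep U \<longleftrightarrow>
     complex_hilbert_space smul ip \<and>
     unitary_one_parameter_group smul ip U \<and>
     module.subspace smul Ep \<and> closedin (ip_topology ip) Ep \<and>
     (\<forall>t>0. U t ` Ep \<subseteq> Ep)"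

definition regular_representation ::
    "(complex \<Rightarrow> 'a::ab_group_add \<Rightarrow> 'a) \<Rightarrow> ('a \<Rightarrow> 'a \<Rightarrow> complex) \<Rightarrow> 'a set \<Rightarrow>
     (real \<Rightarrow> 'a \<Rightarrow> 'a) \<Rightarrow> bool" where
  "regular_representation smul ip Ep U \<longleftrightarrow>
     pair_representation smul ip Ep U \<and>
     (\<Inter>t. U t ` Ep) = {0} \<and>
     (ip_topology ip) closure_of (module.span smul (\<Union>t. U t ` Ep)) = UNIV"

definition unitarily_equivalent ::
    "(complex \<Rightarrow> 'a::ab_group_add \<Rightarrow> 'a) \<Rightarrow> ('a \<Rightarrow> 'a \<Rightarrow> complex) \<Rightarrow> 'a set \<Rightarrow>
     (real \<Rightarrow> 'a \<Rightarrow> 'a) \<Rightarrow>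
     (complex \<Rightarrow> 'b::ab_group_add \<Rightarrow> 'b) \<Rightarrow> ('b \<Rightarrow> 'b \<Rightarrow> complex) \<Rightarrow> 'b set \<Rightarrow>
     (real \<Rightarrow> 'b \<Rightarrow> 'b) \<Rightarrow> bool" where
  "unitarily_equivalent smul1 ip1 Ep1 U1 smul2 ip2 Ep2 U2 \<longleftrightarrow>
     (\<exists>V. unitary_map smul1 ip1 smul2 ip2 V \<and> V ` Ep1 = Ep2 \<and>
          (\<forall>t. V \<circ> U1 t = U2 t \<circ> V))"


section \<open>The Hilbert space \<open>L\<^sup>2(\<real>)\<close> and translations\<close>

definition square_integrable :: "(real \<Rightarrow> complex) \<Rightarrow> bool" where
  "square_integrable f \<longleftrightarrow>
     f \<in> borel_measurable lborel \<and> integrable lborel (\<lambda>x. (cmod (f x))\<^sup>2)"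

lemma square_integrable_zero: "square_integrable (\<lambda>x. 0)"
  by (simp add: square_integrable_def)

lemma square_integrable_scale: "square_integrable f \<Longrightarrow> square_integrable (\<lambda>x. c * f x)"
  by (auto simp: square_integrable_def norm_mult power_mult_distrib)

lemma square_integrable_add:
  assumes f: "square_integrable f" and g: "square_integrable g"
  shows "square_integrable (\<lambda>x. f x + g x)"
proof -
  have [measurable]: "f \<in> borel_measurable lborel" "g \<in> borel_measurable lborel"
    using f g by (auto simp: square_integrable_def)
  have "integrable lborel (\<lambda>x. 2 * (cmod (f x))\<^sup>2 + 2 * (cmod (g x))\<^sup>2)"
    using f g by (auto simp: square_integrable_def)
  then have "integrable lborel (\<lambda>x. (cmod (f x + g x))\<^sup>2)"
  proof (rule Bochner_Integration.integrable_bound)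
    show "AE x in lborel. norm ((cmod (f x + g x))\<^sup>2) \<le> norm (2 * (cmod (f x))\<^sup>2 + 2 * (cmod (g x))\<^sup>2)"
    proof (rule AE_I2)
      fix x
      have "(cmod (f x + g x))\<^sup>2 \<le> (cmod (f x) + cmod (g x))\<^sup>2"
        by (intro power_mono norm_triangle_ineq) auto
      also have "\<dots> \<le> 2 * (cmod (f x))\<^sup>2 + 2 * (cmod (g x))\<^sup>2"
        using sum_squares_bound[of "cmod (f x)" "cmod (g x)"] by (simp add: power2_sum)
      finally show "norm ((cmod (f x + g x))\<^sup>2) \<le> norm (2 * (cmod (f x))\<^sup>2 + 2 * (cmod (g x))\<^sup>2)"
        by simp
    qed
  qed measurable
  then show ?thesis by (simp add: square_integrable_def)
qed

lemma square_integrable_shift: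
  assumes "square_integrable f" shows "square_integrable (\<lambda>x. f (x - t))"
proof -
  have [measurable]: "f \<in> borel_measurable lborel"
    using assms by (auto simp: square_integrable_def)
  have "integrable lborel (\<lambda>x. (cmod (f (- t + 1 * x)))\<^sup>2)"
    using assms lborel_integrable_real_affine[of "\<lambda>x. (cmod (f x))\<^sup>2" 1 "- t"]
    by (simp add: square_integrable_def)
  then show ?thesis by (simp add: square_integrable_def)
qed

lemma AE_lborel_shift:
  assumes "AE x::real in lborel. P x" shows "AE x in lborel. P (x - t)"
proof -
  obtain N where N: "N \<in> null_sets lborel" "{x. \<not> P x} \<subseteq> N"
  proof -
    obtain N where "\<And>x. x \<in> space lborel - N \<Longrightarrow> P x" "N \<in> null_sets lborel"
      using AE_E3[OF assms] by metis
    then show ?thesis using that[of N] by auto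
  qed
  have "AE x in distr lborel borel ((+) (- t)). x \<notin> N"
    using AE_not_in[OF N(1)] by (simp only: lborel_distr_plus)
  then have "AE x in lborel. - t + x \<notin> N"
    by (rule AE_distrD[rotated]) simp
  then show ?thesis
    using N(2) by (auto elim!: eventually_mono)
qed

quotient_type L2 = "real \<Rightarrow> complex" / partial:
    "\<lambda>f g. square_integrable f \<and> square_integrable g \<and> (AE x in lborel. f x = g x)"
proof (rule part_equivpI)
  show "\<exists>f. square_integrable f \<and> square_integrable f \<and> (AE x in lborel. f x = f x)"
    using square_integrable_zero by auto
  show "symp (\<lambda>f g. square_integrable f \<and> square_integrable g \<and> (AE x in lborel. f x = g x))"
    by (auto intro!: sympI elim: eventually_mono)
  show "transp (\<lambda>f g. square_integrable f \<and> square_integrable g \<and> (AE x in lborel. f x = g x))"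
    by (auto intro!: transpI elim: AE_mp)
qed

instantiation L2 :: ab_group_add
begin

lift_definition zero_L2 :: L2 is "\<lambda>x. 0"
  by (simp add: square_integrable_zero)

lift_definition plus_L2 :: "L2 \<Rightarrow> L2 \<Rightarrow> L2" is "\<lambda>f g x. f x + g x"
  by (auto simp: square_integrable_add)

lift_definition uminus_L2 :: "L2 \<Rightarrow> L2" is "\<lambda>f x. - f x"
  using square_integrable_scale[where c = "-1"] by auto

definition minus_L2 :: "L2 \<Rightarrow> L2 \<Rightarrow> L2" where
  "minus_L2 f g = f + - g"

instance
proof
  fix a b c :: L2
  show "a + b + c = a + (b + c)"
    by transfer (auto simp: add.assoc intro!: square_integrable_add)
  show "a + b = b + a"
    by transfer (auto simp: add.commute intro!: square_integrable_add)
  show "0 + a = a"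
    by transfer auto
  show "- a + a = 0"
    by transfer (auto simp: square_integrable_zero)
  show "a - b = a + - b"
    by (simp add: minus_L2_def)
qed

end

lift_definition L2_scale :: "complex \<Rightarrow> L2 \<Rightarrow> L2" is "\<lambda>c f x. c * f x"
  by (auto simp: square_integrable_scale)

lift_definition L2_ip :: "L2 \<Rightarrow> L2 \<Rightarrow> complex" is "\<lambda>f g. LINT x|lborel. cnj (f x) * g x"
proof -
  fix f f' g g' :: "real \<Rightarrow> complex"
  assume f: "square_integrable f \<and> square_integrable f' \<and> (AE x in lborel. f x = f' x)"
    and g: "square_integrable g \<and> square_integrable g' \<and> (AE x in lborel. g x = g' x)"
  then have [measurable]: "f \<in> borel_measurable lborel" "f' \<in> borel_measurable lborel"
      "g \<in> borel_measurable lborel" "g' \<in> borel_measurable lborel"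
    by (auto simp: square_integrable_def)
  have [measurable]: "cnj \<in> borel_measurable borel"
    by (intro borel_measurable_continuous_onI continuous_intros)
  show "(LINT x|lborel. cnj (f x) * g x) = (LINT x|lborel. cnj (f' x) * g' x)"
  proof (rule integral_cong_AE)
    show "AE x in lborel. cnj (f x) * g x = cnj (f' x) * g' x"
      using f g by auto
  qed measurable
qed

lift_definition L2_shift :: "real \<Rightarrow> L2 \<Rightarrow> L2" is "\<lambda>t f x. f (x - t)"
proof -
  fix t :: real and f g :: "real \<Rightarrow> complex"
  assume fg: "square_integrable f \<and> square_integrable g \<and> (AE x in lborel. f x = g x)"
  then have "AE x in lborel. f (x - t) = g (x - t)"
    using AE_lborel_shift[of "\<lambda>x. f x = g x" t] by simp
  then show "square_integrable (\<lambda>x. f (x - t)) \<and> square_integrable (\<lambda>x. g (x - t)) \<and>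
      (AE x in lborel. f (x - t) = g (x - t))"
    using fg square_integrable_shift by simp
qed

text \<open>\<open>L\<^sup>2(\<real>\<^sub>+)\<close> is identified with the functions in \<open>L\<^sup>2(\<real>)\<close> vanishing outside \<open>\<real>\<^sub>+ = (0,\<infinity>)\<close>.\<close>

lift_definition vanishes_off_pos :: "L2 \<Rightarrow> bool" is "\<lambda>f. AE x in lborel. x \<notin> {0<..} \<longrightarrow> f x = 0"
proof -
  fix f g :: "real \<Rightarrow> complex"
  assume "square_integrable f \<and> square_integrable g \<and> (AE x in lborel. f x = g x)"
  then have "AE x in lborel. f x = g x" by simp
  then show "(AE x in lborel. x \<notin> {0<..} \<longrightarrow> f x = 0) = (AE x in lborel. x \<notin> {0<..} \<longrightarrow> g x = 0)"
    by (auto elim: AE_mp)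
qed

definition L2_plus :: "L2 set" where
  "L2_plus = {f. vanishes_off_pos f}"

lemma vector_space_L2: "vector_space L2_scale"
proof
  fix a b :: complex and x y :: L2
  show "L2_scale a (x + y) = L2_scale a x + L2_scale a y"
    by transfer (auto simp: algebra_simps intro!: square_integrable_add square_integrable_scale)
  show "L2_scale (a + b) x = L2_scale a x + L2_scale b x"
    by transfer (auto simp: algebra_simps intro!: square_integrable_add square_integrable_scale)
  show "L2_scale a (L2_scale b x) = L2_scale (a * b) x"
    by transfer (auto simp: mult.assoc intro!: square_integrable_scale)
  show "L2_scale 1 x = x"
    by transfer auto
qed

text \<open>Multiplicity space \<open>\<complex>\<close> in the Lax--Phillips normal form.\<close>

definition multiplicity_free ::
    "(complex \<Rightarrow> 'a::ab_group_add \<Rightarrow> 'a) \<Rightarrow> ('a \<Rightarrow> 'a \<Rightarrow> complex) \<Rightarrow> 'a set \<Rightarrow>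
     (real \<Rightarrow> 'a \<Rightarrow> 'a) \<Rightarrow> bool" where
  "multiplicity_free smul ip Ep U \<longleftrightarrow>
     regular_representation smul ip Ep U \<and>
     unitarily_equivalent smul ip Ep U L2_scale L2_ip L2_plus L2_shift"


section \<open>Hankel positive and reflection positive representations\<close>

definition hankel_positive_representation ::
    "(complex \<Rightarrow> 'a::ab_group_add \<Rightarrow> 'a) \<Rightarrow> ('a \<Rightarrow> 'a \<Rightarrow> complex) \<Rightarrow> 'a set \<Rightarrow>
     (real \<Rightarrow> 'a \<Rightarrow> 'a) \<Rightarrow> ('a \<Rightarrow> 'a) \<Rightarrow> bool" where
  "hankel_positive_representation smul ip Ep U H \<longleftrightarrow>
     pair_representation smul ip Ep U \<and>
     H \<in> bounded_operators_on smul ip Ep \<and> positive_operator_on ip Ep H \<and>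
     (\<forall>t>0. \<forall>x\<in>Ep. H (U t x) = adjoint_on ip Ep (U t) (H x))"

definition reflection_positive_representation ::
    "(complex \<Rightarrow> 'a::ab_group_add \<Rightarrow> 'a) \<Rightarrow> ('a \<Rightarrow> 'a \<Rightarrow> complex) \<Rightarrow> 'a set \<Rightarrow>
     ('a \<Rightarrow> 'a) \<Rightarrow> (real \<Rightarrow> 'a \<Rightarrow> 'a) \<Rightarrow> bool" where
  "reflection_positive_representation smul ip Ep \<theta> U \<longleftrightarrow>
     pair_representation smul ip Ep U \<and>
     unitary_involution smul ip \<theta> \<and>
     (\<forall>x\<in>Ep. ip x (\<theta> x) \<in> \<real>\<^sub>\<ge>\<^sub>0) \<and>
     (\<forall>t. \<theta> \<circ> U t \<circ> \<theta> = U (- t))"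

definition twisted_ip :: "('a \<Rightarrow> 'a \<Rightarrow> complex) \<Rightarrow> ('a \<Rightarrow> 'a) \<Rightarrow> 'a \<Rightarrow> 'a \<Rightarrow> complex" where
  "twisted_ip ip g x y = ip (g x) (g y)"

end

theory Submission
  imports Defs
begin

text \<open>
  Write \<open>I\<close> for multiplication by \<open>\<i>\<close> and work in a real Hilbert space, with real
  scalar product \<open>Re \<langle>x, y\<rangle>\<close>. As in Nehari's theorem, the Hankel form of \<open>H\<close> on \<open>E\<^sub>+\<close> extends to
  the form of a bounded self-adjoint operator \<open>T\<close> on \<open>E\<close> with \<open>T U\<^sub>t = U\<^bsub>-t\<^esub> T\<close>: for a fixed time
  step the extension is constructed by successive positive completions, and Tychonoff's theorem
  allows the step to shrink to zero. The reflection \<open>R f(x) = f(-x)\<close> of \<open>L\<^sup>2(\<real>)\<close> has vanishing Hankel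
  form, so \<open>T\<close> may be replaced by \<open>D = T + c R\<close>, which is invertible for large \<open>c\<close>. In the polar
  decomposition \<open>D = \<theta> P\<close> the unitary involution \<open>\<theta>\<close> satisfies \<open>\<theta> U\<^sub>t \<theta> = U\<^bsub>-t\<^esub>\<close> and commutes with \<open>P\<close>, and \<open>P\<close>
  commutes with \<open>U\<close>. It remains to factor \<open>P = g\<^sup>* g\<close> with \<open>g E\<^sub>+ = E\<^sub>+\<close>. The vector \<open>e(x) = \<surd>2 exp (-x)\<close> on \<open>\<real>\<^sub>+\<close>
  is a joint eigenvector of the adjoints of the \<open>U\<^sub>+(t)\<close>, with eigenvalues \<open>exp (-t)\<close>. For the scalar
  product \<open>\<langle>x, P y\<rangle>\<close> the same role is played by some \<open>v \<in> E\<^sub>+\<close>, and \<open>g\<close> maps \<open>U\<^sub>t v\<close> to a multiple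
  of \<open>U\<^sub>t e\<close>. That \<open>v\<close> is cyclic for \<open>U\<close>, so that \<open>g\<close> is defined everywhere, holds since the commutant
  of \<open>U\<close> is commutative.
\<close>

section \<open>Coercive forms and operators on Hilbert spaces\<close>

text \<open>Why \<open>R\<close> is added: \<open>T\<close> may have a kernel (for
  \<open>H = 0\<close> it can be zero), and then \<open>T = \<theta> P\<close> determines no unitary
  \<theta>. As \<open>R\<close> squares to the identity, \<open>D\<close> squares to c^2 (1 + X)
  with a small X, so the positive square root P of this operator is accessible by a contraction and
  is invertible.

  Where \<open>v\<close> comes from: spectrally P is multiplication by a positive function, and g
  has to be an outer function with |g|^2 = P. The compression to E_+ of the adjoint of g commutes
  with the adjoints of the U_+(t), hence preserves the line of their joint eigenvector e, and <x, P
  g^-1 e> = <g x, e> is a multiple of <x, e> on E_+. So g^-1 e must be, up to a factor, the vector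
  that represents <x, e> in the P-product, and this vector is available before g is.

  The isometry that sends e to the normalised v respects E_+, but it might fail to be onto;
  commutativity of the commutant turns its one-sided inverse into a two-sided one.

  A one-step completion needs strict room between the old and the new bound. The bounds therefore
  grow along the extension, but below a ceiling independent of the time step, as compactness
  requires.\<close>

lemma bounded_bilinear_add_form:
  fixes F G :: "'a::real_normed_vector \<Rightarrow> 'b::real_normed_vector \<Rightarrow> 'c::real_normed_vector"
  assumes "bounded_bilinear F" "bounded_bilinear G"
  shows "bounded_bilinear (\<lambda>x y. F x y + G x y)"
proof -
  interpret F: bounded_bilinear F by fact
  interpret G: bounded_bilinear G by fact
  obtain K L where "\<And>x y. norm (F x y) \<le> norm x * norm y * K" "\<And>x y. norm (G x y) \<le> norm x * norm y * L"
    using F.bounded G.bounded by metis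
  then have "norm (F x y + G x y) \<le> norm x * norm y * (K + L)" for x y
    by (smt (verit) distrib_left norm_triangle_ineq)
  then have "\<exists>K. \<forall>x y. norm (F x y + G x y) \<le> norm x * norm y * K" by blast
  then show ?thesis
    by (intro bounded_bilinear.intro)
      (simp_all add: F.add_left F.add_right G.add_left G.add_right F.scaleR_left F.scaleR_right
        G.scaleR_left G.scaleR_right algebra_simps)
qed

lemma bounded_bilinear_scale_form:
  fixes F :: "'a::real_normed_vector \<Rightarrow> 'b::real_normed_vector \<Rightarrow> real"
  assumes "bounded_bilinear F"
  shows "bounded_bilinear (\<lambda>x y. c * F x y)"
proof -
  interpret F: bounded_bilinear F by fact
  obtain K where "\<And>x y. norm (F x y) \<le> norm x * norm y * K"
    using F.bounded by metis
  then have "norm (c * F x y) \<le> norm x * norm y * (\<bar>c\<bar> * K)" for x y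
    by (simp add: abs_mult) (metis abs_ge_zero mult.left_commute mult_left_mono)
  then have "\<exists>K. \<forall>x y. norm (c * F x y) \<le> norm x * norm y * K" by blast
  then show ?thesis
    by (intro bounded_bilinear.intro)
      (simp_all add: F.add_left F.add_right F.scaleR_left F.scaleR_right algebra_simps)
qed

text \<open>The solution minimises \<open>q x = G x x - 2 * f x\<close> over \<open>S\<close>.
  Coercivity bounds \<open>q\<close> from below and, through the parallelogram identity, makes
  minimising sequences Cauchy; the vanishing first variation is the equation. This is Riesz
  representation for \<open>G\<close> as a scalar product on \<open>S\<close>.\<close>

lemma lax_milgram_symmetric:
  fixes G :: "'h::{real_inner,banach} \<Rightarrow> 'h \<Rightarrow> real"
  assumes S: "closed S" "subspace S"
    and G: "bounded_bilinear G" "\<And>x y. x \<in> S \<Longrightarrow> y \<in> S \<Longrightarrow> G x y = G y x"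
    and c: "c > 0" "\<And>x. x \<in> S \<Longrightarrow> c * (norm x)\<^sup>2 \<le> G x x"
    and f: "bounded_linear f"
  shows "\<exists>z\<in>S. \<forall>x\<in>S. G z x = f x"
proof -
  interpret G: bounded_bilinear G by fact
  interpret f: bounded_linear f by fact
  define q where "q = (\<lambda>x. G x x - 2 * f x)"
  obtain K where K: "\<And>x. norm (f x) \<le> norm x * K"
    using f.bounded by blast
  \<comment> \<open>What remains after completing the square in \<open>norm x\<close>.\<close>
  have lower: "- (K\<^sup>2 / c) \<le> q x" if "x \<in> S" for x
  proof -
    have "f x \<le> norm x * K" using K[of x] by simp
    then have "c * (norm x)\<^sup>2 - 2 * (norm x * K) \<le> q x"
      using c(2)[OF that] by (simp add: q_def)
    moreover have "0 \<le> c * (norm x - K / c)\<^sup>2" using c by simp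
    moreover have "c * (norm x - K / c)\<^sup>2 = c * (norm x)\<^sup>2 - 2 * (norm x * K) + K\<^sup>2 / c"
      using c by (simp add: power2_eq_square field_simps)
    ultimately show ?thesis by linarith
  qed
  define m where "m = Inf (q ` S)"
  have bdd: "bdd_below (q ` S)" using lower by (auto intro!: bdd_belowI)
  have S0: "0 \<in> S" using S(2) by (rule subspace_0)
  have m_le: "m \<le> q x" if "x \<in> S" for x
    unfolding m_def using bdd that by (auto intro: cInf_lower)
  have "\<exists>x\<in>S. q x < m + 1 / (real n + 1)" for n
    using cInf_lessD[of "q ` S" "m + 1 / (real n + 1)"] S0 by (auto simp: m_def)
  then obtain X where X: "\<And>n. X n \<in> S" "\<And>n. q (X n) < m + 1 / (real n + 1)"
    by metis
  \<comment> \<open>Parallelogram identity for \<open>G\<close>; the midpoint stays in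
    \<open>S\<close>, so \<open>q\<close> is at least \<open>m\<close> there.\<close>
  have par: "c * (norm (x - y))\<^sup>2 \<le> 2 * (q x - m) + 2 * (q y - m)" if "x \<in> S" "y \<in> S" for x y
  proof -
    have "(1/2) *\<^sub>R (x + y) \<in> S" and D: "x - y \<in> S"
      using that S(2) by (simp_all add: subspace_add subspace_scale subspace_diff)
    then have "4 * m \<le> 4 * q ((1/2) *\<^sub>R (x + y))" using m_le by fastforce
    moreover have "G (x - y) (x - y) = 2 * q x + 2 * q y - 4 * q ((1/2) *\<^sub>R (x + y))"
      by (simp add: q_def G.add_left G.add_right G.diff_left G.diff_right G.scaleR_left
          G.scaleR_right f.add f.scale algebra_simps)
    ultimately have "G (x - y) (x - y) \<le> 2 * (q x - m) + 2 * (q y - m)" by (simp add: algebra_simps)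
    then show ?thesis using c(2)[OF D] by (rule order_trans[rotated])
  qed
  have "Cauchy X"
  proof (rule metric_CauchyI)
    fix \<epsilon> :: real assume e: "\<epsilon> > 0"
    define \<eta> where "\<eta> = c * \<epsilon>\<^sup>2"
    have "\<eta> / 4 > 0" using c e by (simp add: \<eta>_def)
    then obtain N where N: "inverse (real (Suc N)) < \<eta> / 4"
      using reals_Archimedean by blast
    have "dist (X i) (X j) < \<epsilon>" if ij: "i \<ge> N" "j \<ge> N" for i j
    proof -
      have "1 / (real k + 1) < \<eta> / 4" if "k \<ge> N" for k
      proof -
        have "1 / (real k + 1) \<le> inverse (real (Suc N))"
          using that by (auto simp: field_simps)
        then show ?thesis using N by linarith
      qed
      then have "q (X i) - m < \<eta> / 4" "q (X j) - m < \<eta> / 4"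
        using X(2)[of i] X(2)[of j] ij by force+
      then have "2 * (q (X i) - m) + 2 * (q (X j) - m) < \<eta>" by (simp add: field_simps)
      then have "c * (norm (X i - X j))\<^sup>2 < \<eta>"
        by (rule le_less_trans[OF par[OF X(1) X(1)]])
      then have "(norm (X i - X j))\<^sup>2 < \<epsilon>\<^sup>2" using c by (simp add: \<eta>_def)
      then show ?thesis using e by (simp add: dist_norm power_less_imp_less_base)
    qed
    then show "\<exists>M. \<forall>i\<ge>M. \<forall>j\<ge>M. dist (X i) (X j) < \<epsilon>" by blast
  qed
  then obtain z where z: "X \<longlonglongrightarrow> z" using Cauchy_convergent convergent_def by blast
  have zS: "z \<in> S" using S(1) X(1) z closed_sequentially by blast
  have "(\<lambda>n. q (X n)) \<longlonglongrightarrow> q z"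
    unfolding q_def by (intro tendsto_intros G.tendsto f.tendsto z)
  moreover have "(\<lambda>n. m + 1 / (real n + 1)) \<longlonglongrightarrow> m + 0"
    by (intro tendsto_intros LIMSEQ_inverse_real_of_nat[unfolded inverse_eq_divide of_nat_Suc add.commute[of 1]])
  ultimately have "q z \<le> m + 0"
    by (rule LIMSEQ_le) (use X(2) less_imp_le in blast)
  then have qz: "q z \<le> q x" if "x \<in> S" for x using m_le[OF that] by simp
  have "G z x = f x" if x: "x \<in> S" for x
  proof -
    define d where "d = G z x - f x"
    define b where "b = G x x"
    have b: "b \<ge> 0" using c(2)[OF x] c(1) by (auto simp: b_def intro: order_trans[rotated])
    have *: "0 \<le> 2 * t * d + t\<^sup>2 * b" for t
    proof -
      have "z + t *\<^sub>R x \<in> S" using zS x S(2) by (simp add: subspace_add subspace_scale)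
      then have "q z \<le> q (z + t *\<^sub>R x)" by (rule qz)
      then show ?thesis
        by (simp add: q_def d_def b_def G.add_left G.add_right G.scaleR_left G(2)[OF x zS]
            G.scaleR_right f.add f.scale power2_eq_square algebra_simps)
    qed
    have "d = 0"
    proof (rule ccontr)
      assume "d \<noteq> 0"
      \<comment> \<open>The quadratic in the step size is smallest at \<open>- d / b\<close>; the
        denominator \<open>b + 1\<close> still gives a negative value and covers
        \<open>b = 0\<close>.\<close>
      have "0 \<le> 2 * (- d / (b + 1)) * d + (- d / (b + 1))\<^sup>2 * b" by (rule *)
      also have "\<dots> = - (d\<^sup>2 * (b + 2)) / (b + 1)\<^sup>2"
        using b by (simp add: power2_eq_square divide_simps) (simp add: algebra_simps)
      also have "\<dots> < 0" using b \<open>d \<noteq> 0\<close> by (simp add: divide_less_0_iff)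
      finally show False by simp
    qed
    then show ?thesis by (simp add: d_def)
  qed
  with zS show ?thesis by blast
qed

lemma coercive_form_eqI:
  fixes G :: "'h::real_inner \<Rightarrow> 'h \<Rightarrow> real"
  assumes "subspace S" "bounded_bilinear G"
    and "c > 0" "\<And>x. x \<in> S \<Longrightarrow> c * (norm x)\<^sup>2 \<le> G x x"
    and "a \<in> S" "b \<in> S" "\<And>w. w \<in> S \<Longrightarrow> G a w = G b w"
  shows "a = b"
proof -
  interpret G: bounded_bilinear G by fact
  have D: "a - b \<in> S" using assms by (simp add: subspace_diff)
  then have "G (a - b) (a - b) = 0" using assms(7) by (simp add: G.diff_left)
  then have "c * (norm (a - b))\<^sup>2 \<le> 0" using assms(4)[OF D] by simp
  then have "(norm (a - b))\<^sup>2 \<le> 0" using assms(3) by (simp add: mult_le_0_iff)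
  then show ?thesis by simp
qed

text \<open>Uniqueness makes the representing vector linear in the parameter, and testing with
  \<open>w = a x\<close> bounds it by \<open>K / c\<close>. Projections, adjoints and inverses are
  all obtained from this lemma.\<close>

lemma lax_milgram_operator:
  fixes G :: "'h::{real_inner,banach} \<Rightarrow> 'h \<Rightarrow> real"
    and \<Phi> :: "'k::real_normed_vector \<Rightarrow> 'h \<Rightarrow> real"
  assumes S: "closed S" "subspace S"
    and G: "bounded_bilinear G" "\<And>x y. x \<in> S \<Longrightarrow> y \<in> S \<Longrightarrow> G x y = G y x"
    and c: "c > 0" "\<And>x. x \<in> S \<Longrightarrow> c * (norm x)\<^sup>2 \<le> G x x"
    and P: "bounded_bilinear \<Phi>"
  shows "\<exists>a. bounded_linear a \<and> range a \<subseteq> S \<and> (\<forall>x. \<forall>w\<in>S. G (a x) w = \<Phi> x w)"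
proof -
  interpret G: bounded_bilinear G by fact
  interpret P: bounded_bilinear \<Phi> by fact
  have "\<exists>z\<in>S. \<forall>w\<in>S. G z w = \<Phi> x w" for x
    using S G c P.bounded_linear_right by (rule lax_milgram_symmetric)
  then obtain a where a: "\<And>x. a x \<in> S" "\<And>x w. w \<in> S \<Longrightarrow> G (a x) w = \<Phi> x w" by metis
  note eqI = coercive_form_eqI[OF S(2) G(1) c]
  obtain K where K: "K \<ge> 0" "\<And>x w. norm (\<Phi> x w) \<le> norm x * norm w * K"
    using P.nonneg_bounded by blast
  have "bounded_linear a"
  proof (rule bounded_linear_intro)
    show "a (x + y) = a x + a y" for x y
      by (rule eqI) (use a S(2) in \<open>auto simp: subspace_add G.add_left P.add_left\<close>)
    show "a (r *\<^sub>R x) = r *\<^sub>R a x" for r x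
      by (rule eqI) (use a S(2) in \<open>auto simp: subspace_scale G.scaleR_left P.scaleR_left\<close>)
    show "norm (a x) \<le> norm x * (K / c)" for x
    proof (cases "a x = 0")
      case True
      then show ?thesis using K(1) c by simp
    next
      case False
      have "c * (norm (a x))\<^sup>2 \<le> norm x * norm (a x) * K"
        using c(2)[OF a(1)[of x]] a(2)[OF a(1)[of x], of x] K(2)[of x "a x"] by simp
      then have "norm (a x) * (c * norm (a x)) \<le> norm (a x) * (norm x * K)"
        by (simp add: power2_eq_square mult_ac)
      then have "c * norm (a x) \<le> norm x * K" using False by simp
      then show ?thesis using c by (simp add: field_simps)
    qed
  qed
  with a show ?thesis by blast
qed

section \<open>Extension of Hankel forms\<close>

lemma quadratic_form_nonneg:
  fixes b m M s t :: real
  assumes "\<bar>b\<bar> \<le> m * s * t" "m \<le> M" "0 \<le> s" "0 \<le> t" "0 \<le> m"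
  shows "0 \<le> M * s\<^sup>2 + M * t\<^sup>2 + 2 * b"
proof -
  have "m * (s * t) \<le> M * (s * t)" using assms by (intro mult_right_mono) auto
  then have "- (2 * b) \<le> M * (2 * s * t)" using assms(1) by (simp add: mult_ac abs_le_iff)
  also have "\<dots> \<le> M * (s\<^sup>2 + t\<^sup>2)"
    using assms sum_squares_bound[of s t] by (intro mult_left_mono) auto
  finally show ?thesis by (simp add: distrib_left)
qed

text \<open>
  Extending a Hankel form by one step is a positive completion problem for the form
  \<open>M \<bar>x\<bar>\<^sup>2 + M \<bar>y\<bar>\<^sup>2 + 2 B' x y\<close> on \<open>S \<times> S\<close>: only the values of \<open>B'\<close> outside
  \<open>W S \<times> S \<union> S \<times> W S\<close> are free. They are chosen such that the two copies of \<open>S\<close> become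
  orthogonal relative to \<open>W S \<times> W S\<close>: in the proof below \<open>a x\<close> and \<open>b y\<close> are the (pulled back)
  projections of \<open>(x, 0)\<close> and \<open>(0, y)\<close> to that subspace.
\<close>

lemma hankel_step:
  fixes B :: "'h::{real_inner,banach} \<Rightarrow> 'h \<Rightarrow> real"
  assumes S: "closed S" "subspace S"
    and W: "bounded_linear W" "\<And>x y. W x \<bullet> W y = x \<bullet> y" "\<And>x. x \<in> S \<Longrightarrow> W x \<in> S"
    and I: "bounded_linear I" "\<And>x y. I x \<bullet> I y = x \<bullet> y" "\<And>x. x \<in> S \<Longrightarrow> I x \<in> S"
      "\<And>x. I (I x) = - x" "\<And>x. W (I x) = I (W x)"
    and B: "bounded_bilinear B" "\<And>x y. x \<in> S \<Longrightarrow> y \<in> S \<Longrightarrow> \<bar>B x y\<bar> \<le> m * norm x * norm y"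
      "\<And>x y. x \<in> S \<Longrightarrow> y \<in> S \<Longrightarrow> B (W x) y = B x (W y)"
      "\<And>x y. x \<in> S \<Longrightarrow> y \<in> S \<Longrightarrow> B (I x) (I y) = B x y"
    and m: "0 \<le> m" "m < M"
  shows "\<exists>B'. bounded_bilinear B' \<and> (\<forall>x\<in>S. \<forall>y\<in>S. \<bar>B' x y\<bar> \<le> M * norm x * norm y \<and>
      B' (W x) y = B x y \<and> B' x (W y) = B x y \<and> B' (I x) (I y) = B' x y)"
proof -
  interpret B: bounded_bilinear B by fact
  interpret W: bounded_linear W by fact
  interpret I: bounded_linear I by fact
  define Z where "Z = S \<times> S"
  have Z: "closed Z" "subspace Z"
    using S by (simp_all add: Z_def closed_Times subspace_Times)
  have ZI: "p \<in> Z \<longleftrightarrow> fst p \<in> S \<and> snd p \<in> S" for p by (cases p) (simp add: Z_def)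
  \<comment> \<open>The polarised form at pairs (W u, W v), written in terms of (u, v): there the
    value \<open>B' (W u) (W v) = B u (W v)\<close> is forced.\<close>
  define G :: "'h \<times> 'h \<Rightarrow> 'h \<times> 'h \<Rightarrow> real" where
    "G = (\<lambda>p q. M * (fst p \<bullet> fst q) + M * (snd p \<bullet> snd q) + B (fst p) (W (snd q)) + B (fst q) (W (snd p)))"
  note lin = bounded_linear_fst bounded_linear_snd bounded_linear_ident
    bounded_linear_compose[OF W(1) bounded_linear_snd] bounded_linear_compose[OF W(1) bounded_linear_fst]
  note bil = bounded_bilinear_add_form bounded_bilinear_scale_form lin
    bounded_bilinear.comp[OF bounded_bilinear_inner] bounded_bilinear.comp[OF B(1)]
    bounded_bilinear.comp[OF B.flip]
  have G: "bounded_bilinear G"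
    unfolding G_def by (intro bil)
  have Gsym: "G p q = G q p" for p q
    by (simp add: G_def inner_commute)
  \<comment> \<open>Coercivity holds with constant \<open>M - m\<close>; this is why the bound has
    to increase strictly.\<close>
  have Gpos: "(M - m) * (norm p)\<^sup>2 \<le> G p p" if p: "p \<in> Z" for p
  proof -
    have n: "norm (W x) = norm x" for x by (simp add: norm_eq_sqrt_inner W)
    have "\<bar>B (fst p) (W (snd p))\<bar> \<le> m * norm (fst p) * norm (snd p)"
      using B(2)[of "fst p" "W (snd p)"] p W(3) by (simp add: ZI n)
    moreover have "m * (2 * norm (fst p) * norm (snd p)) \<le> m * ((norm (fst p))\<^sup>2 + (norm (snd p))\<^sup>2)"
      using sum_squares_bound m(1) by (intro mult_left_mono)
    moreover have "(norm p)\<^sup>2 = (norm (fst p))\<^sup>2 + (norm (snd p))\<^sup>2"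
      by (simp add: norm_prod_def)
    ultimately show ?thesis
      by (simp add: G_def power2_norm_eq_inner algebra_simps)
  qed
  have c: "0 < M - m" using m by simp
  note eqI = coercive_form_eqI[OF Z(2) G c Gpos]
  \<comment> \<open>The product of (x, 0) with (W u, W v) in the form to be completed, where
    \<open>B' x (W v) = B x v\<close> is forced. The functional for \<open>b\<close> is the same for
    (0, y).\<close>
  have "bounded_bilinear (\<lambda>x w. M * (x \<bullet> W (fst w)) + B x (snd w))"
    by (intro bil)
  from lax_milgram_operator[OF Z G Gsym c Gpos this] obtain a where a: "bounded_linear a" "range a \<subseteq> Z"
      "\<And>x w. w \<in> Z \<Longrightarrow> G (a x) w = M * (x \<bullet> W (fst w)) + B x (snd w)"
    by auto
  have "bounded_bilinear (\<lambda>x w. M * (x \<bullet> W (snd w)) + B (fst w) x)"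
    by (intro bil)
  from lax_milgram_operator[OF Z G Gsym c Gpos this] obtain b where b: "bounded_linear b" "range b \<subseteq> Z"
      "\<And>x w. w \<in> Z \<Longrightarrow> G (b x) w = M * (x \<bullet> W (snd w)) + B (fst w) x"
    by auto
  have aZ: "a x \<in> Z" and bZ: "b x \<in> Z" for x using a(2) b(2) by auto
  define B' where "B' = (\<lambda>x y. G (a x) (b y))"
  have "bounded_bilinear B'"
    unfolding B'_def by (rule bounded_bilinear.comp[OF G a(1) b(1)])
  then interpret B': bounded_bilinear B' .
  have G0: "G (x, 0) q = M * (x \<bullet> fst q) + B x (W (snd q))"
    "G (0, x) q = M * (x \<bullet> snd q) + B (fst q) (W x)" for x q
    by (simp_all add: G_def B.zero_left B.zero_right W.zero)
  have aW: "a (W x) = (x, 0)" if "x \<in> S" for x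
  proof (rule eqI)
    show "(x, 0) \<in> Z" using that S(2) by (simp add: ZI subspace_0)
    show "G (a (W x)) w = G (x, 0) w" if "w \<in> Z" for w
      using that \<open>x \<in> S\<close> a(3)[OF that, of "W x"] by (simp add: G0 ZI W(2) B(3))
  qed (simp_all add: aZ)
  have bW: "b (W x) = (0, x)" if "x \<in> S" for x
  proof (rule eqI)
    show "(0, x) \<in> Z" using that S(2) by (simp add: ZI subspace_0)
    show "G (b (W x)) w = G (0, x) w" if "w \<in> Z" for w
      using that \<open>x \<in> S\<close> b(3)[OF that, of "W x"] by (simp add: G0 ZI W(2) B(3))
  qed (simp_all add: bZ)
  have 1: "B' (W x) y = B x y" if "x \<in> S" "y \<in> S" for x y
    using that S(2) b(3)[of "(x, 0)" y] by (simp add: B'_def aW Gsym ZI subspace_0 W.zero)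
  have 2: "B' x (W y) = B x y" if "x \<in> S" "y \<in> S" for x y
    using that S(2) a(3)[of "(0, y)" x] by (simp add: B'_def bW ZI subspace_0 W.zero)
  have dual: "\<exists>v. v \<in> Z \<and> w = (I (fst v), I (snd v))" if "w \<in> Z" for w
    using that S(2) by (intro exI[of _ "(- I (fst w), - I (snd w))"])
      (auto simp: ZI I subspace_neg I.neg)
  have GI: "G (I (fst p), I (snd p)) (I (fst q), I (snd q)) = G p q" if "p \<in> Z" "q \<in> Z" for p q
    using that by (simp add: G_def I W B ZI)
  have aI: "a (I x) = (I (fst (a x)), I (snd (a x)))" if "x \<in> S" for x
  proof (rule eqI)
    fix w assume "w \<in> Z"
    then obtain v where v: "v \<in> Z" "w = (I (fst v), I (snd v))" using dual by blast
    show "G (a (I x)) w = G (I (fst (a x)), I (snd (a x))) w"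
      using v that aZ[of x] \<open>w \<in> Z\<close> by (simp add: a(3) GI) (simp add: ZI I W B)
  qed (use aZ[of x] aZ[of "I x"] in \<open>simp_all add: ZI I\<close>)
  have bI: "b (I x) = (I (fst (b x)), I (snd (b x)))" if "x \<in> S" for x
  proof (rule eqI)
    fix w assume "w \<in> Z"
    then obtain v where v: "v \<in> Z" "w = (I (fst v), I (snd v))" using dual by blast
    show "G (b (I x)) w = G (I (fst (b x)), I (snd (b x))) w"
      using v that bZ[of x] \<open>w \<in> Z\<close> by (simp add: b(3) GI) (simp add: ZI I W B)
  qed (use bZ[of x] bZ[of "I x"] in \<open>simp_all add: ZI I\<close>)
  have 3: "B' (I x) (I y) = B' x y" if "x \<in> S" "y \<in> S" for x y
    using that by (simp add: B'_def aI bI GI aZ bZ)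
  have Q0: "0 \<le> G p p" if "p \<in> Z" for p
    using Gpos[OF that] c by (meson mult_nonneg_nonneg order_trans less_imp_le zero_le_power2)
  interpret G: bounded_bilinear G by fact
  \<comment> \<open>A projection does not increase length. The difference of (x, 0) and its
    projection is (x + W w1, W w2); its second entry lies in W S, so the form there is given by
    \<open>B\<close> and nonnegative by the bound on \<open>B\<close>.\<close>
  have na: "G (a x) (a x) \<le> M * (norm x)\<^sup>2" if x: "x \<in> S" for x
  proof -
    define w1 where "w1 = - fst (a x)"
    define w2 where "w2 = - snd (a x)"
    have w: "w1 \<in> S" "w2 \<in> S" using aZ[of x] S(2) by (auto simp: w1_def w2_def ZI subspace_neg)
    have ax: "a x = (- w1, - w2)" by (simp add: w1_def w2_def)
    have u: "x + W w1 \<in> S" using x w S(2) W by (simp add: subspace_add)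
    have "0 \<le> M * ((x + W w1) \<bullet> (x + W w1)) + M * (w2 \<bullet> w2) + 2 * B (x + W w1) w2"
      using quadratic_form_nonneg[OF B(2)[OF u w(2)], of M] m by (simp add: power2_norm_eq_inner)
    moreover have "G (a x) (a x) = M * (x \<bullet> W (- w1)) + B x (- w2)"
      using a(3)[OF aZ, of x x] by (simp add: ax)
    moreover have "G (a x) (a x) = M * (w1 \<bullet> w1) + M * (w2 \<bullet> w2) + 2 * B w1 (W w2)"
      by (simp add: ax G_def B.minus_left B.minus_right W.neg)
    ultimately show ?thesis
      using w B(3) by (simp add: power2_norm_eq_inner W W.neg B.minus_right B.add_left inner_add inner_commute algebra_simps)
  qed
  have nb: "G (b y) (b y) \<le> M * (norm y)\<^sup>2" if y: "y \<in> S" for y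
  proof -
    define w1 where "w1 = - fst (b y)"
    define w2 where "w2 = - snd (b y)"
    have w: "w1 \<in> S" "w2 \<in> S" using bZ[of y] S(2) by (auto simp: w1_def w2_def ZI subspace_neg)
    have bx: "b y = (- w1, - w2)" by (simp add: w1_def w2_def)
    have u: "y + W w2 \<in> S" using y w S(2) W by (simp add: subspace_add)
    have "0 \<le> M * ((y + W w2) \<bullet> (y + W w2)) + M * (w1 \<bullet> w1) + 2 * B w1 (y + W w2)"
      using quadratic_form_nonneg[OF B(2)[OF w(1) u], of M] m by (simp add: power2_norm_eq_inner add_ac)
    moreover have "G (b y) (b y) = M * (y \<bullet> W (- w2)) + B (- w1) y"
      using b(3)[OF bZ, of y y] by (simp add: bx)
    moreover have "G (b y) (b y) = M * (w1 \<bullet> w1) + M * (w2 \<bullet> w2) + 2 * B w1 (W w2)"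
      by (simp add: bx G_def B.minus_left B.minus_right W.neg)
    ultimately show ?thesis
      using w B(3) by (simp add: power2_norm_eq_inner W W.neg B.minus_left B.add_right inner_add inner_commute algebra_simps)
  qed
  have two: "- 2 * B' x y \<le> M * (norm x)\<^sup>2 + M * (norm y)\<^sup>2" if "x \<in> S" "y \<in> S" for x y
  proof -
    have "0 \<le> G (a x + b y) (a x + b y)"
      using aZ bZ Z(2) by (intro Q0) (simp add: subspace_add)
    then have "0 \<le> G (a x) (a x) + G (b y) (b y) + 2 * B' x y"
      by (simp add: G.add_left G.add_right B'_def Gsym)
    then show ?thesis using na[OF that(1)] nb[OF that(2)] by linarith
  qed
  have le: "- B' x y \<le> M * norm x * norm y" if xy: "x \<in> S" "y \<in> S" for x y
  proof (cases "x = 0 \<or> y = 0")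
    case True
    then show ?thesis by (auto simp: B'.zero_left B'.zero_right)
  next
    case False
    \<comment> \<open>Rescaling the two vectors inversely gives them equal norms, which turns the
      additive bound \<open>two\<close> into a product bound.\<close>
    define s where "s = norm y / norm x"
    have s: "s > 0" using False by (simp add: s_def)
    define r where "r = sqrt s"
    have r: "r > 0" "r\<^sup>2 = s" using s by (auto simp: r_def)
    have "- 2 * B' (r *\<^sub>R x) ((1 / r) *\<^sub>R y) \<le> M * (norm (r *\<^sub>R x))\<^sup>2 + M * (norm ((1 / r) *\<^sub>R y))\<^sup>2"
      using xy S(2) by (intro two) (auto simp: subspace_scale)
    moreover have *: "r\<^sup>2 * norm x = norm y" using False r by (simp add: s_def)
    then have "(norm (r *\<^sub>R x))\<^sup>2 = norm x * norm y"
      using r(1) by (simp add: power_mult_distrib power2_eq_square mult_ac)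
    moreover have "(norm ((1 / r) *\<^sub>R y))\<^sup>2 = norm x * norm y"
    proof -
      have "(norm ((1 / r) *\<^sub>R y))\<^sup>2 = norm y * norm y / r\<^sup>2"
        by (simp add: power_mult_distrib power_divide power2_eq_square)
      also have "\<dots> = norm x * norm y"
        using r(1) by (simp add: *[symmetric] power2_eq_square)
      finally show ?thesis .
    qed
    ultimately show ?thesis
      using r by (simp add: B'.scaleR_left B'.scaleR_right)
  qed
  have 4: "\<bar>B' x y\<bar> \<le> M * norm x * norm y" if "x \<in> S" "y \<in> S" for x y
    using le[OF that] le[of "- x" y] that S(2) by (simp add: subspace_neg B'.minus_left abs_le_iff)
  show ?thesis using \<open>bounded_bilinear B'\<close> 1 2 3 4 by blast
qed

lemma closed_Collect_ball:
  "(\<And>x. x \<in> A \<Longrightarrow> closed {y. P y x}) \<Longrightarrow> closed {y. \<forall>x\<in>A. P y x}"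
  by (simp add: Collect_ball_eq closed_INT)

text \<open>A complex Hilbert space seen as a real one with complex structure \<open>I\<close>:
  complex linear means commuting with \<open>I\<close>, and a real form invariant under
  \<open>I\<close> is the real part of a sesquilinear one. \<open>S\<close> stands for E_+, and
  \<open>U_dense\<close> is the density half of regularity.\<close>

locale complex_shift =
  fixes I :: "'h::{real_inner,banach} \<Rightarrow> 'h" and U :: "real \<Rightarrow> 'h \<Rightarrow> 'h" and S :: "'h set"
  assumes I_linear: "bounded_linear I" and I_inner: "I x \<bullet> I y = x \<bullet> y" and I_I: "I (I x) = - x"
    and U_linear: "bounded_linear (U t)" and U_inner: "U t x \<bullet> U t y = x \<bullet> y"
    and U_0: "U 0 x = x" and U_add: "U (s + t) x = U s (U t x)"
    and U_cont: "continuous_on UNIV (\<lambda>t. U t x)" and U_I: "U t (I x) = I (U t x)"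
    and S_closed: "closed S" and S_subspace: "subspace S"
    and I_S: "x \<in> S \<Longrightarrow> I x \<in> S" and U_S: "0 \<le> t \<Longrightarrow> x \<in> S \<Longrightarrow> U t x \<in> S"
    and U_dense: "closure (\<Union>t. U t ` S) = UNIV"
begin

lemma U_minus: "U (- t) (U t x) = x" "U t (U (- t) x) = x"
  using U_add[of "- t" t x] U_add[of t "- t" x] by (simp_all add: U_0)

lemma U_commute: "U s (U t x) = U t (U s x)"
  by (metis U_add add.commute)

lemma U_adjoint: "U t x \<bullet> y = x \<bullet> U (- t) y"
  using U_inner[of "- t" "U t x" y] by (simp add: U_minus)

lemma I_adjoint: "I x \<bullet> y = - (x \<bullet> I y)"
  using I_inner[of x "I y"] by (simp add: I_I)

lemma orthogonal_projection:
  "\<exists>p. bounded_linear p \<and> range p \<subseteq> S \<and> (\<forall>x\<in>S. p x = x) \<and> (\<forall>x. \<forall>w\<in>S. p x \<bullet> w = x \<bullet> w) \<and>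
    (\<forall>x. p (I x) = I (p x)) \<and> (\<forall>x. norm (p x) \<le> norm x)"
proof -
  have pos: "1 * (norm x)\<^sup>2 \<le> x \<bullet> x" for x :: 'h by (simp add: power2_norm_eq_inner)
  note eqI = coercive_form_eqI[OF S_subspace bounded_bilinear_inner zero_less_one pos]
  obtain p :: "'h \<Rightarrow> 'h" where p: "bounded_linear p" "range p \<subseteq> S" "\<And>x w. w \<in> S \<Longrightarrow> p x \<bullet> w = x \<bullet> w"
    using lax_milgram_operator[OF S_closed S_subspace bounded_bilinear_inner inner_commute zero_less_one pos
        bounded_bilinear_inner] by auto
  have "norm (p x) \<le> norm x" for x
  proof -
    have "(norm (p x))\<^sup>2 = x \<bullet> p x"
      using p(2) p(3)[of "p x" x] by (auto simp: power2_norm_eq_inner)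
    also have "\<dots> \<le> norm x * norm (p x)" by (rule norm_cauchy_schwarz)
    finally show ?thesis
      by (cases "norm (p x) = 0") (simp_all add: power2_eq_square)
  qed
  moreover have "p x = x" if "x \<in> S" for x
    by (rule eqI) (use that p in auto)
  moreover have "p (I x) = I (p x)" for x
  proof (rule eqI)
    show "p (I x) \<bullet> w = I (p x) \<bullet> w" if "w \<in> S" for w
      using that by (simp add: p I_adjoint I_S)
  qed (use p I_S in auto)
  ultimately show ?thesis using p by blast
qed

text \<open>Undoes \<open>n\<close> time steps of length \<open>d\<close>: the new form reproduces
  \<open>B\<close> once either argument has been moved forward by the total time. One completion
  makes the form Hankel for \<open>d\<close> again, so it can be repeated.\<close>

lemma hankel_iterate:
  assumes "0 \<le> d" "0 \<le> m" "m < M" "bounded_bilinear B"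
    and "\<And>x y. x \<in> S \<Longrightarrow> y \<in> S \<Longrightarrow> \<bar>B x y\<bar> \<le> m * norm x * norm y"
    and "\<And>x y. x \<in> S \<Longrightarrow> y \<in> S \<Longrightarrow> B (U d x) y = B x (U d y)"
    and "\<And>x y. x \<in> S \<Longrightarrow> y \<in> S \<Longrightarrow> B (I x) (I y) = B x y"
  shows "\<exists>B'. bounded_bilinear B' \<and> (\<forall>x\<in>S. \<forall>y\<in>S. \<bar>B' x y\<bar> \<le> M * norm x * norm y \<and>
      B' (U d x) y = B' x (U d y) \<and> B' (I x) (I y) = B' x y \<and>
      B' (U (real n * d) x) y = B x y \<and> B' x (U (real n * d) y) = B x y)"
  using assms
proof (induction n arbitrary: B m)
  case 0
  have "m * norm x * norm y \<le> M * norm x * norm y" for x y :: 'h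
    using 0 by (intro mult_right_mono) auto
  then have "\<bar>B x y\<bar> \<le> M * norm x * norm y" if "x \<in> S" "y \<in> S" for x y
    using 0(5)[OF that] order_trans by blast
  then show ?case using 0
    by (intro exI[of _ B]) (simp add: U_0)
next
  case (Suc n)
  \<comment> \<open>Only part of the room between \<open>m\<close> and \<open>M\<close> is spent, so
    that the remaining steps still find a strict inequality.\<close>
  obtain m' where m': "m < m'" "m' < M" using dense Suc.prems(3) by blast
  obtain C where C: "bounded_bilinear C" "\<And>x y. x \<in> S \<Longrightarrow> y \<in> S \<Longrightarrow> \<bar>C x y\<bar> \<le> m' * norm x * norm y \<and>
      C (U d x) y = B x y \<and> C x (U d y) = B x y \<and> C (I x) (I y) = C x y"
    using hankel_step[OF S_closed S_subspace U_linear U_inner U_S[OF Suc.prems(1)] I_linear I_inner I_S I_I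
        U_I Suc.prems(4,5,6,7,2) m'(1)] by metis
  have "0 \<le> m'" using m' Suc.prems by simp
  then obtain D where D: "bounded_bilinear D" "\<And>x y. x \<in> S \<Longrightarrow> y \<in> S \<Longrightarrow> \<bar>D x y\<bar> \<le> M * norm x * norm y \<and>
      D (U d x) y = D x (U d y) \<and> D (I x) (I y) = D x y \<and>
      D (U (real n * d) x) y = C x y \<and> D x (U (real n * d) y) = C x y"
    using Suc.IH[of m' C] Suc.prems(1) m'(2) C by auto
  have "U (real (Suc n) * d) x = U (real n * d) (U d x)" for x
    by (simp add: U_add[symmetric] distrib_right add.commute)
  then have "D (U (real (Suc n) * d) x) y = B x y" "D x (U (real (Suc n) * d) y) = B x y"
    if "x \<in> S" "y \<in> S" for x y
    using that C D U_S[OF Suc.prems(1)] by simp_all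
  then show ?case using D by blast
qed

lemma U_pred_mono: "s \<le> t \<Longrightarrow> U (- s) ` S \<subseteq> U (- t) ` S"
proof safe
  fix x assume "s \<le> t" "x \<in> S"
  then have "U (t - s) x \<in> S" by (intro U_S) auto
  moreover have "U (- s) x = U (- t) (U (t - s) x)" by (simp add: U_add[symmetric])
  ultimately show "U (- s) x \<in> U (- t) ` S" by blast
qed

lemma dense_pred: "closure (\<Union>k::nat. U (- real k) ` S) = UNIV"
proof -
  have "(\<Union>t. U t ` S) \<subseteq> (\<Union>k::nat. U (- real k) ` S)"
  proof safe
    fix t x assume "x \<in> S"
    obtain k :: nat where "- t \<le> real k" using real_arch_simple by blast
    then show "U t x \<in> (\<Union>k::nat. U (- real k) ` S)"
      using U_pred_mono[of "- t" "real k"] \<open>x \<in> S\<close> by fastforce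
  qed
  then show ?thesis using U_dense closure_mono by (metis top.extremum_uniqueI)
qed

text \<open>Forms with a common bound are points of a compact product of intervals. Extending
  \<open>B\<close> and being Hankel for dyadic times of level \<open>k\<close> on U_(-k) S are
  closed conditions, the latter decreasing in \<open>k\<close>. Each level is attained by
  \<open>hankel_iterate\<close>, and a form satisfying all of them is Hankel for all times by
  continuity and density.\<close>

theorem hankel_extension:
  fixes B :: "'h \<Rightarrow> 'h \<Rightarrow> real"
  assumes B: "bounded_bilinear B"
    and "\<And>t x y. 0 \<le> t \<Longrightarrow> x \<in> S \<Longrightarrow> y \<in> S \<Longrightarrow> B (U t x) y = B x (U t y)"
    and "\<And>x y. x \<in> S \<Longrightarrow> y \<in> S \<Longrightarrow> B (I x) (I y) = B x y"
  obtains F where "bounded_bilinear F" "\<And>x y. x \<in> S \<Longrightarrow> y \<in> S \<Longrightarrow> F x y = B x y"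
    "\<And>t x y. F (U t x) y = F x (U t y)" "\<And>x y. F (I x) (I y) = F x y"
proof -
  obtain m where m: "m \<ge> 0" "\<And>x y. \<bar>B x y\<bar> \<le> m * norm x * norm y"
    using bounded_bilinear.nonneg_bounded[OF B] by (auto simp: mult_ac)
  \<comment> \<open>Two increases of the bound: one for pulling back the first argument, one for the
    second.\<close>
  obtain M1 where M1: "m < M1" using gt_ex by blast
  obtain M where M: "M1 < M" using gt_ex by blast
  have M0: "0 \<le> M" using m M1 M by simp
  obtain p where p: "bounded_linear p" "range p \<subseteq> S" "\<And>x. x \<in> S \<Longrightarrow> p x = x"
    "\<And>x w. w \<in> S \<Longrightarrow> p x \<bullet> w = x \<bullet> w" "\<And>x. p (I x) = I (p x)" "\<And>x. norm (p x) \<le> norm x"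
    using orthogonal_projection by auto
  interpret I: bounded_linear I by (rule I_linear)
  define K where "K = {F :: 'h \<times> 'h \<Rightarrow> real. \<forall>z. F z \<in> {- (M * norm (fst z) * norm (snd z))..M * norm (fst z) * norm (snd z)}}"
  define N where "N = {F :: 'h \<times> 'h \<Rightarrow> real. 
     (\<forall>x y z. F (x + y, z) = F (x, z) + F (y, z)) \<and> (\<forall>x y z. F (z, x + y) = F (z, x) + F (z, y)) \<and>
     (\<forall>r x y. F (r *\<^sub>R x, y) = r * F (x, y)) \<and> (\<forall>r x y. F (x, r *\<^sub>R y) = r * F (x, y)) \<and>
     (\<forall>x y. F (I x, I y) = F (x, y)) \<and> (\<forall>x\<in>S. \<forall>y\<in>S. F (x, y) = B x y)}"
  \<comment> \<open>A form extended over finite time \<open>k\<close> is Hankel only on vectors that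
    enter \<open>S\<close> after time \<open>k\<close>.\<close>
  define C where "C = (\<lambda>k::nat. {F :: 'h \<times> 'h \<Rightarrow> real. \<forall>n::nat. \<forall>x\<in>U (- real k) ` S. \<forall>y\<in>U (- real k) ` S.
     F (U (real n / 2 ^ k) x, y) = F (x, U (real n / 2 ^ k) y)})"
  have "compact K"
  proof -
    have "compactin (product_topology (\<lambda>_::'h\<times>'h. euclideanreal) UNIV)
        (\<Pi>\<^sub>E z\<in>UNIV. {- (M * norm (fst z) * norm (snd z))..M * norm (fst z) * norm (snd z)})"
      by (subst compactin_PiE) auto
    then show ?thesis
      by (simp add: euclidean_product_topology K_def PiE_UNIV_domain Pi_def)
  qed
  have "closed N"
    unfolding N_def
    by (intro closed_Collect_conj closed_Collect_all closed_Collect_ball closed_Collect_eq continuous_intros continuous_on_product_coordinates)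
  have closedC: "closed (C k)" for k
    unfolding C_def
    by (intro closed_Collect_all closed_Collect_ball closed_Collect_eq continuous_intros continuous_on_product_coordinates)
  have C_mono: "C l \<subseteq> C k" if "k \<le> l" for k l
  proof -
    have "real n / 2 ^ k = real (n * 2 ^ (l - k)) / 2 ^ l" for n
      using that power_add[of "2::real" k "l - k"] by (simp add: field_simps)
    moreover have "U (- real k) ` S \<subseteq> U (- real l) ` S"
      using that by (intro U_pred_mono) auto
    ultimately show ?thesis unfolding C_def by (smt (verit, best) Collect_mono subsetD)
  qed
  have nonempty: "K \<inter> N \<inter> C k \<noteq> {}" for k
  proof -
    define d :: real where "d = 1 / 2 ^ k"
    have d: "0 \<le> d" by (simp add: d_def)
    \<comment> \<open>This many steps of length 2^-k make up the total time
      \<open>k\<close>.\<close>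
    define n where "n = k * 2 ^ k"
    have n: "real n * d = real k" by (simp add: n_def d_def)
    obtain B1 where B1: "bounded_bilinear B1" "\<And>x y. x \<in> S \<Longrightarrow> y \<in> S \<Longrightarrow> \<bar>B1 x y\<bar> \<le> M1 * norm x * norm y \<and>
        B1 (U d x) y = B1 x (U d y) \<and> B1 (I x) (I y) = B1 x y \<and> B1 (U (real k) x) y = B x y"
      using hankel_iterate[OF d m(1) M1 B m(2) assms(2)[OF d] assms(3), of n] unfolding n by blast
    have "0 \<le> M1" using m M1 by simp
    then obtain B2 where B2: "bounded_bilinear B2" "\<And>x y. x \<in> S \<Longrightarrow> y \<in> S \<Longrightarrow> \<bar>B2 x y\<bar> \<le> M * norm x * norm y \<and>
        B2 (U d x) y = B2 x (U d y) \<and> B2 (I x) (I y) = B2 x y \<and> B2 x (U (real k) y) = B1 x y"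
      using hankel_iterate[OF d _ M, of B1 n] B1 unfolding n by blast
    \<comment> \<open>Moving forward by \<open>k\<close> leads from U_(-k) S into \<open>S\<close>,
      where \<open>B2\<close> is controlled; the projection only serves to have a bounded form on
      the whole space. On \<open>S\<close> the two pull-backs cancel the two shifts:
      \<open>B2 (U k x) (U k y) = B1 (U k x) y = B x y\<close>.\<close>
    define F where "F = (\<lambda>z. B2 (p (U (real k) (fst z))) (p (U (real k) (snd z))))"
    have pS: "p x \<in> S" for x using p(2) by auto
    interpret B2: bounded_bilinear B2 by fact
    interpret p: bounded_linear p by fact
    interpret Uk: bounded_linear "U (real k)" by (rule U_linear)
    have nU: "norm (U t x) = norm x" for t x by (simp add: norm_eq_sqrt_inner U_inner)
    have "F \<in> K"
    proof -
      have "\<bar>F z\<bar> \<le> M * norm (fst z) * norm (snd z)" for z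
      proof -
        have "\<bar>F z\<bar> \<le> M * norm (p (U (real k) (fst z))) * norm (p (U (real k) (snd z)))"
          using B2(2)[OF pS pS] by (simp add: F_def)
        also have "\<dots> \<le> M * norm (fst z) * norm (snd z)"
          using M0 p(6)[of "U (real k) (fst z)"] p(6)[of "U (real k) (snd z)"]
          by (intro mult_mono) (simp_all add: nU)
        finally show ?thesis .
      qed
      then show ?thesis unfolding K_def by (auto simp: abs_le_iff) (metis minus_le_iff fst_conv snd_conv)
    qed
    moreover have "F \<in> N"
      by (auto simp: N_def F_def Uk.add p.add B2.add_left B2.add_right Uk.scaleR p.scaleR B2.scaleR_left
          B2.scaleR_right U_I p(3,5) B2(2) pS U_S B1)
    moreover have "F \<in> C k"
    proof -
      have *: "B2 (U (real j / 2 ^ k) x) y = B2 x (U (real j / 2 ^ k) y)" if "x \<in> S" "y \<in> S" for j x y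
        using that
      proof (induction j arbitrary: x y)
        case (Suc j)
        have "U (real (Suc j) / 2 ^ k) x = U d (U (real j / 2 ^ k) x)" for x
          by (simp add: U_add[symmetric] d_def add_divide_distrib)
        moreover have "U d x \<in> S" "U d y \<in> S" "U (real j / 2 ^ k) x \<in> S" "U (real j / 2 ^ k) y \<in> S"
          using Suc.prems d by (auto intro!: U_S)
        ultimately show ?case using Suc B2(2)
          by (simp add: U_commute[of d "real j / 2 ^ k" y])
      qed (simp add: U_0)
      show ?thesis
        by (auto simp: C_def F_def U_minus U_commute[of "real k" "real _ / 2 ^ k"] p(3) U_S *)
    qed
    ultimately show ?thesis by blast
  qed
  have "K \<inter> (\<Inter>k. N \<inter> C k) \<noteq> {}"
  proof (rule compact_imp_fip_image[OF \<open>compact K\<close>])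
    show "closed (N \<inter> C k)" for k using \<open>closed N\<close> closedC by blast
    show "K \<inter> (\<Inter>k\<in>J. N \<inter> C k) \<noteq> {}" if "finite J" for J
    proof (cases "J = {}")
      case False
      then have "K \<inter> N \<inter> C (Max J) \<subseteq> K \<inter> (\<Inter>k\<in>J. N \<inter> C k)"
        using C_mono that Max_ge by blast
      then show ?thesis using nonempty by blast
    qed (use nonempty[of 0] in auto)
  qed
  then obtain F where F: "F \<in> K" "F \<in> N" "\<And>k. F \<in> C k" by blast
  define f where "f = (\<lambda>x y. F (x, y))"
  have "\<bar>F z\<bar> \<le> M * norm (fst z) * norm (snd z)" for z
    using F(1) by (cases z) (auto simp: K_def abs_le_iff minus_le_iff)
  then have "norm (f x y) \<le> norm x * norm y * M" for x y
    by (simp add: f_def mult_ac) (metis fst_conv snd_conv)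
  then have "bounded_bilinear f"
    using F(2) by (intro bounded_bilinear.intro) (auto simp: f_def N_def)
  then interpret f: bounded_bilinear f .
  note cont = f.continuous_on[OF continuous_on_const] f.continuous_on[OF _ continuous_on_const]
  have 1: "f (U t x) y = f x (U t y)"
    if t: "0 \<le> t" and x: "x \<in> U (- real k) ` S" and y: "y \<in> U (- real k) ` S" for t x y k
  proof -
    \<comment> \<open>Dyadic approximation of \<open>t\<close> from below; its \<open>l\<close>-th
      term is admissible for \<open>C l\<close>.\<close>
    define r where "r = (\<lambda>l::nat. real (nat \<lfloor>t * 2 ^ l\<rfloor>) / 2 ^ l)"
    have "t - (1 / 2) ^ l \<le> r l" "r l \<le> t" for l
    proof -
      have *: "real (nat \<lfloor>t * 2 ^ l\<rfloor>) = of_int \<lfloor>t * 2 ^ l\<rfloor>" using t by simp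
      have "t * 2 ^ l - 1 \<le> real (nat \<lfloor>t * 2 ^ l\<rfloor>)" "real (nat \<lfloor>t * 2 ^ l\<rfloor>) \<le> t * 2 ^ l"
        unfolding * by linarith+
      then show "t - (1 / 2) ^ l \<le> r l" "r l \<le> t"
        using divide_right_mono[of "t * 2 ^ l - 1" "real (nat \<lfloor>t * 2 ^ l\<rfloor>)" "2 ^ l"]
          divide_right_mono[of "real (nat \<lfloor>t * 2 ^ l\<rfloor>)" "t * 2 ^ l" "2 ^ l"]
        by (simp_all add: r_def diff_divide_distrib power_one_over)
    qed
    moreover have "(\<lambda>l. t - (1 / 2) ^ l) \<longlonglongrightarrow> t - 0"
      by (intro tendsto_intros LIMSEQ_power_zero) auto
    ultimately have "r \<longlonglongrightarrow> t"
      by (intro tendsto_sandwich[of "\<lambda>l. t - (1 / 2) ^ l" r _ "\<lambda>_. t"]) auto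
    then have U_lim: "(\<lambda>l. U (r l) x) \<longlonglongrightarrow> U t x" for x
      by (intro continuous_on_tendsto_compose[OF U_cont]) auto
    have "f (U (r l) x) y = f x (U (r l) y)" if "l \<ge> k" for l
    proof -
      have "x \<in> U (- real l) ` S" "y \<in> U (- real l) ` S"
        using U_pred_mono[of "real k" "real l"] that x y by auto
      then show ?thesis using F(3)[of l] by (simp only: C_def f_def r_def mem_Collect_eq)
    qed
    then have "\<forall>\<^sub>F l in sequentially. f (U (r l) x) y = f x (U (r l) y)"
      by (auto simp: eventually_sequentially)
    moreover have "(\<lambda>l. f (U (r l) x) y) \<longlonglongrightarrow> f (U t x) y"
      by (intro f.tendsto tendsto_const U_lim)
    ultimately have "(\<lambda>l. f x (U (r l) y)) \<longlonglongrightarrow> f (U t x) y"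
      by (rule Lim_transform_eventually[rotated])
    moreover have "(\<lambda>l. f x (U (r l) y)) \<longlonglongrightarrow> f x (U t y)"
      by (intro f.tendsto tendsto_const U_lim)
    ultimately show ?thesis by (rule LIMSEQ_unique)
  qed
  have 2: "f (U t x) y = f x (U t y)" if t: "0 \<le> t" for t x y
  proof -
    let ?D = "\<Union>k::nat. U (- real k) ` S"
    have D: "f (U t x) y = f x (U t y)" if "x \<in> ?D" "y \<in> ?D" for x y
    proof -
      from that(1) obtain i where "x \<in> U (- real i) ` S" by blast
      moreover from that(2) obtain j where "y \<in> U (- real j) ` S" by blast
      ultimately have "x \<in> U (- real (max i j)) ` S" "y \<in> U (- real (max i j)) ` S"
        using U_pred_mono[of "real i" "real (max i j)"] U_pred_mono[of "real j" "real (max i j)"] by auto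
      then show ?thesis by (rule 1[OF t])
    qed
    have U: "continuous_on UNIV (U t)" using U_linear linear_continuous_on by blast
    have "f (U t x) y = f x (U t y)" if "x \<in> ?D" for x y
    proof -
      have "closed {y. f (U t x) y = f x (U t y)}"
        by (intro closed_Collect_eq f.continuous_on continuous_on_const continuous_on_id U)
      then have "closure ?D \<subseteq> {y. f (U t x) y = f x (U t y)}"
        using D[OF that] by (intro closure_minimal) auto
      then show ?thesis by (auto simp: dense_pred)
    qed
    moreover have "closed {x. f (U t x) y = f x (U t y)}"
      by (intro closed_Collect_eq f.continuous_on continuous_on_const continuous_on_id U)
    ultimately have "closure ?D \<subseteq> {x. f (U t x) y = f x (U t y)}"
      by (intro closure_minimal) auto
    then show ?thesis by (auto simp: dense_pred)
  qed
  have "f (U t x) y = f x (U t y)" for t x y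
  proof (cases "0 \<le> t")
    case False
    then show ?thesis
      using 2[of "- t" "U t x" "U t y"] by (simp add: U_minus)
  qed (rule 2)
  then show ?thesis
    using that[of f] \<open>bounded_bilinear f\<close> F(2) by (auto simp: f_def N_def)
qed

end

section \<open>Polar decomposition\<close>

lemma adjoint_exists:
  fixes A :: "'h::{real_inner,banach} \<Rightarrow> 'h"
  assumes "bounded_linear A"
  shows "\<exists>A'. bounded_linear A' \<and> (\<forall>x y. A x \<bullet> y = x \<bullet> A' y)"
proof -
  have pos: "1 * (norm x)\<^sup>2 \<le> x \<bullet> x" for x :: 'h by (simp add: power2_norm_eq_inner)
  obtain A' where A': "bounded_linear A'" "\<And>x w. A' x \<bullet> w = x \<bullet> A w"
    using lax_milgram_operator[OF closed_UNIV subspace_UNIV bounded_bilinear_inner inner_commute zero_less_one pos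
        bounded_bilinear.comp[OF bounded_bilinear_inner bounded_linear_ident assms]] by auto
  have "A x \<bullet> y = x \<bullet> A' y" for x y
    using A'(2)[of y x] by (simp add: inner_commute)
  with A'(1) show ?thesis by blast
qed

lemma inner_left_eqI:
  fixes x y :: "'h::real_inner"
  assumes "\<And>w. x \<bullet> w = y \<bullet> w"
  shows "x = y"
  using assms[of "x - y"] inner_eq_zero_iff[of "x - y"] by (simp add: inner_diff_left)

text \<open>Totality is expressed by a trivial orthogonal complement, so the comparison is made for
  the adjoints: \<open>A' w - B' w\<close> is orthogonal to every \<open>a i\<close>.\<close>

lemma bounded_linear_total_eqI:
  fixes A B :: "'h::{real_inner,banach} \<Rightarrow> 'h"
  assumes "bounded_linear A" "bounded_linear B"
    and eq: "\<And>i. A (a i) = B (a i)"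
    and total: "\<And>f. (\<And>i. f \<bullet> a i = 0) \<Longrightarrow> f = 0"
  shows "A x = B x"
proof -
  obtain A' where A': "\<And>x y. A x \<bullet> y = x \<bullet> A' y" using adjoint_exists[OF assms(1)] by auto
  obtain B' where B': "\<And>x y. B x \<bullet> y = x \<bullet> B' y" using adjoint_exists[OF assms(2)] by auto
  have "A' w - B' w = 0" for w
  proof (rule total)
    fix i
    have "a i \<bullet> A' w = a i \<bullet> B' w" by (metis A' B' eq)
    then show "(A' w - B' w) \<bullet> a i = 0" by (simp add: inner_diff_right inner_commute[of _ "a i"])
  qed
  then have *: "A' w = B' w" for w by simp
  show ?thesis by (rule inner_left_eqI) (simp only: A' B' *)
qed

text \<open>Subtracting from a vector of \<open>S\<close> its projection to \<open>S'\<close> in the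
  P-product leaves a vector of \<open>S\<close> that is P-orthogonal to \<open>S'\<close>.\<close>

lemma closed_subspace_eqI:
  fixes P :: "'h::{real_inner,banach} \<Rightarrow> 'h"
  assumes S: "subspace S" and S': "closed S'" "subspace S'" "S' \<subseteq> S"
    and P: "bounded_linear P" "\<And>x y. P x \<bullet> y = x \<bullet> P y" "0 < c" "\<And>x. c * (norm x)\<^sup>2 \<le> x \<bullet> P x"
    and orth: "\<And>f. f \<in> S \<Longrightarrow> (\<And>w. w \<in> S' \<Longrightarrow> f \<bullet> P w = 0) \<Longrightarrow> f = 0"
  shows "S' = S"
proof -
  have G: "bounded_bilinear (\<lambda>x y. x \<bullet> P y)"
    using bounded_bilinear.comp[OF bounded_bilinear_inner bounded_linear_ident P(1)] .
  have Gsym: "x \<bullet> P y = y \<bullet> P x" for x y by (metis P(2) inner_commute)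
  have "s \<in> S'" if s: "s \<in> S" for s
  proof -
    obtain z where z: "z \<in> S'" "\<And>w. w \<in> S' \<Longrightarrow> z \<bullet> P w = s \<bullet> P w"
      using lax_milgram_symmetric[OF S'(1,2) G Gsym P(3,4) bounded_bilinear.bounded_linear_right[OF G]] by metis
    have "s - z = 0"
    proof (rule orth)
      show "s - z \<in> S" using z(1) S'(3) s S by (auto intro: subspace_diff)
      show "(s - z) \<bullet> P w = 0" if "w \<in> S'" for w using z(2)[OF that] by (simp add: inner_diff_left)
    qed
    then show ?thesis using z(1) by simp
  qed
  then show ?thesis using S'(3) by blast
qed

lemma subspace_closure:
  fixes S :: "'h::real_normed_vector set"
  assumes "subspace S"
  shows "subspace (closure S)"
proof (rule subspaceI)
  show "0 \<in> closure S" using subspace_0[OF assms] closure_subset by blast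
next
  fix x y assume "x \<in> closure S" "y \<in> closure S"
  then obtain f g where "\<And>n. f n \<in> S" "f \<longlonglongrightarrow> x" "\<And>n. g n \<in> S" "g \<longlonglongrightarrow> y"
    by (auto simp: closure_sequential)
  then show "x + y \<in> closure S"
    unfolding closure_sequential using assms
    by (intro exI[of _ "\<lambda>n. f n + g n"]) (auto intro: subspace_add tendsto_add)
next
  fix c x assume "x \<in> closure S"
  then obtain f where "\<And>n. f n \<in> S" "f \<longlonglongrightarrow> x"
    by (auto simp: closure_sequential)
  then show "c *\<^sub>R x \<in> closure S"
    unfolding closure_sequential using assms
    by (intro exI[of _ "\<lambda>n. c *\<^sub>R f n"]) (auto intro: subspace_scale tendsto_scaleR)
qed

text \<open>The operator is found through its closed graph \<Gamma>, which avoids well-definedness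
  on linear combinations. Equality of the Gram matrices extends to \<Gamma> and bounds the second
  component by the first. Hence the product of first components is coercive on \<Gamma>, and
  projecting to \<Gamma> by means of it yields a section of the first coordinate, which is defined
  everywhere by totality.\<close>

lemma isometric_extension:
  fixes a b :: "'i \<Rightarrow> 'h::{real_inner,banach}" and P :: "'h \<Rightarrow> 'h"
  assumes P: "bounded_linear P" "0 < c" "\<And>x. c * (norm x)\<^sup>2 \<le> x \<bullet> P x"
    and ab: "\<And>i j. a i \<bullet> a j = b i \<bullet> P (b j)"
    and total: "\<And>f. (\<And>i. f \<bullet> a i = 0) \<Longrightarrow> f = 0"
  obtains J where "bounded_linear J" "\<And>i. J (a i) = b i" "\<And>x y. x \<bullet> y = J x \<bullet> P (J y)"
proof -
  interpret P: bounded_linear P by fact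
  define \<Gamma> where "\<Gamma> = closure (span (range (\<lambda>i. (a i, b i))))"
  have \<Gamma>: "closed \<Gamma>" "subspace \<Gamma>"
    by (simp_all add: \<Gamma>_def subspace_closure)
  have gen: "(a i, b i) \<in> \<Gamma>" for i
    unfolding \<Gamma>_def by (rule subsetD[OF closure_subset]) (auto intro: span_base)
  have min: "\<Gamma> \<subseteq> T" if "closed T" "subspace T" "\<And>i. (a i, b i) \<in> T" for T
    unfolding \<Gamma>_def using that by (intro closure_minimal span_minimal) auto
  have 1: "fst z \<bullet> a i = snd z \<bullet> P (b i)" if "z \<in> \<Gamma>" for z i
  proof -
    have "\<Gamma> \<subseteq> {z. fst z \<bullet> a i = snd z \<bullet> P (b i)}"
      by (rule min) (auto simp: ab subspace_def inner_add_left intro!: closed_Collect_eq continuous_intros)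
    then show ?thesis using that by blast
  qed
  have 2: "fst z \<bullet> fst w = snd z \<bullet> P (snd w)" if "z \<in> \<Gamma>" "w \<in> \<Gamma>" for z w
  proof -
    have "\<Gamma> \<subseteq> {w. fst z \<bullet> fst w = snd z \<bullet> P (snd w)}"
    proof (rule min)
      show "closed {w. fst z \<bullet> fst w = snd z \<bullet> P (snd w)}"
        by (intro closed_Collect_eq continuous_intros P.continuous_on)
      show "subspace {w. fst z \<bullet> fst w = snd z \<bullet> P (snd w)}"
        by (auto simp: subspace_def P.zero P.add P.scaleR inner_add_right)
      show "(a i, b i) \<in> {w. fst z \<bullet> fst w = snd z \<bullet> P (snd w)}" for i
        using 1[OF that(1)] by simp
    qed
    then show ?thesis using that(2) by blast
  qed
  have G: "bounded_bilinear (\<lambda>z w::'h\<times>'h. fst z \<bullet> fst w)"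
    by (intro bounded_bilinear.comp[OF bounded_bilinear_inner] bounded_linear_fst)
  have Gsym: "fst z \<bullet> fst w = fst w \<bullet> fst z" for z w :: "'h\<times>'h" by (rule inner_commute)
  \<comment> \<open>\<open>c\<close> bounds the second component and 1 the first, both by the same
    quantity; adding the two estimates explains the half.\<close>
  have pos: "(min 1 c / 2) * (norm z)\<^sup>2 \<le> fst z \<bullet> fst z" if "z \<in> \<Gamma>" for z
  proof -
    have "min 1 c * (norm (fst z))\<^sup>2 \<le> 1 * (norm (fst z))\<^sup>2" "min 1 c * (norm (snd z))\<^sup>2 \<le> c * (norm (snd z))\<^sup>2"
      by (intro mult_right_mono; simp)+
    moreover have "c * (norm (snd z))\<^sup>2 \<le> fst z \<bullet> fst z" using P(3)[of "snd z"] 2[OF that that] by simp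
    moreover have "(norm z)\<^sup>2 = (norm (fst z))\<^sup>2 + (norm (snd z))\<^sup>2" by (simp add: norm_prod_def)
    ultimately show ?thesis by (simp add: power2_norm_eq_inner distrib_left)
  qed
  have \<Phi>: "bounded_bilinear (\<lambda>(x::'h) (w::'h\<times>'h). x \<bullet> fst w)"
    by (intro bounded_bilinear.comp[OF bounded_bilinear_inner] bounded_linear_fst bounded_linear_ident)
  have c2: "0 < min 1 c / 2" using P(2) by simp
  obtain j where j: "bounded_linear j" "range j \<subseteq> \<Gamma>" "\<And>x w. w \<in> \<Gamma> \<Longrightarrow> fst (j x) \<bullet> fst w = x \<bullet> fst w"
    using lax_milgram_operator[OF \<Gamma> G Gsym c2 pos \<Phi>] by auto
  have fst_j: "fst (j x) = x" for x
  proof -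
    have "fst (j x) - x = 0"
      by (rule total) (use j(3)[OF gen] in \<open>simp add: inner_diff_left\<close>)
    then show ?thesis by simp
  qed
  define J where "J = (\<lambda>x. snd (j x))"
  have iso: "x \<bullet> y = J x \<bullet> P (J y)" for x y
    using 2[of "j x" "j y"] j(2) by (simp add: fst_j J_def image_subset_iff)
  \<comment> \<open>\<Gamma> is a graph: an element with vanishing first component vanishes.\<close>
  have Ja: "J (a i) = b i" for i
  proof -
    have "j (a i) - (a i, b i) \<in> \<Gamma>" using j(2) gen \<Gamma>(2) by (auto intro: subspace_diff)
    then have "c * (norm (J (a i) - b i))\<^sup>2 \<le> 0"
      using 2[of "j (a i) - (a i, b i)" "j (a i) - (a i, b i)"] P(3)[of "J (a i) - b i"]
      by (simp add: fst_j J_def)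
    then show ?thesis using P(2) by (simp add: mult_le_0_iff)
  qed
  have "bounded_linear J"
    unfolding J_def using bounded_linear_compose[OF bounded_linear_snd j(1)] .
  then show ?thesis using Ja iso by (rule that)
qed

text \<open>\<open>Y\<close> is the square root of 1 + X minus 1, the fixed point of Y -> (X - Y^2)
  / 2, which contracts the ball of radius 1/2 with factor 1/2. Symmetry and commutation with
  everything that commutes with \<open>X\<close> are closed conditions preserved by the map, so they
  are built into the set \<open>T\<close> and inherited by the fixed point.\<close>

lemma square_root_perturbation:
  fixes X :: "'h::{real_inner,banach} \<Rightarrow> 'h"
  assumes X: "bounded_linear X" "\<And>x. norm (X x) \<le> norm x / 4" "\<And>x y. X x \<bullet> y = x \<bullet> X y"
  obtains Y where "bounded_linear Y" "\<And>x. norm (Y x) \<le> norm x / 2" "\<And>x y. Y x \<bullet> y = x \<bullet> Y y"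
    "\<And>x. 2 *\<^sub>R Y x + Y (Y x) = X x"
    "\<And>A x. bounded_linear A \<Longrightarrow> (\<And>y. A (X y) = X (A y)) \<Longrightarrow> A (Y x) = Y (A x)"
proof -
  define XX where "XX = Blinfun X"
  have XX: "blinfun_apply XX = X" by (simp add: XX_def X bounded_linear_Blinfun_apply)
  have nX: "norm XX \<le> 1 / 4"
    by (rule norm_blinfun_bound) (use X(2) in \<open>auto simp: XX\<close>)
  define T where "T = {Y :: 'h \<Rightarrow>\<^sub>L 'h. norm Y \<le> 1 / 2 \<and>
    (\<forall>x y. blinfun_apply Y x \<bullet> y = x \<bullet> blinfun_apply Y y) \<and>
    (\<forall>A x. bounded_linear A \<and> (\<forall>y. A (X y) = X (A y)) \<longrightarrow> A (blinfun_apply Y x) = blinfun_apply Y (A x))}"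
  define f where "f = (\<lambda>Y :: 'h \<Rightarrow>\<^sub>L 'h. (1 / 2) *\<^sub>R (XX - (Y o\<^sub>L Y)))"
  have "closed T"
  proof -
    have T: "T = {Y. norm Y \<le> 1 / 2} \<inter> (\<Inter>x. \<Inter>y. {Y :: 'h \<Rightarrow>\<^sub>L 'h. Y x \<bullet> y = x \<bullet> Y y}) \<inter>
      (\<Inter>A\<in>{A. bounded_linear A \<and> (\<forall>y. A (X y) = X (A y))}. \<Inter>x. {Y :: 'h \<Rightarrow>\<^sub>L 'h. A (blinfun_apply Y x) = blinfun_apply Y (A x)})"
      unfolding T_def by blast
    have ap: "continuous_on UNIV (\<lambda>Y :: 'h \<Rightarrow>\<^sub>L 'h. blinfun_apply Y x)" for x
      by (intro linear_continuous_on blinfun.bounded_linear_left)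
    have "closed {Y :: 'h \<Rightarrow>\<^sub>L 'h. A (blinfun_apply Y x) = blinfun_apply Y (A x)}" if "bounded_linear A" for A x
      by (intro closed_Collect_eq bounded_linear.continuous_on[OF that] ap)
    moreover have "closed {Y :: 'h \<Rightarrow>\<^sub>L 'h. blinfun_apply Y x \<bullet> y = x \<bullet> blinfun_apply Y y}" for x y
      by (intro closed_Collect_eq continuous_on_inner ap continuous_on_const)
    moreover have "closed {Y :: 'h \<Rightarrow>\<^sub>L 'h. norm Y \<le> 1 / 2}"
      by (intro closed_Collect_le continuous_on_norm continuous_on_id continuous_on_const)
    ultimately show ?thesis
      unfolding T by (intro closed_Int closed_INT ballI) (simp_all only: mem_Collect_eq)
  qed
  then have "complete T" by (simp add: complete_eq_closed)
  moreover have "T \<noteq> {}"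
  proof -
    have "0 \<in> T" by (auto simp: T_def linear_0 bounded_linear.linear)
    then show ?thesis by blast
  qed
  moreover have "f ` T \<subseteq> T"
  proof safe
    fix Y assume Y: "Y \<in> T"
    have "norm (Y o\<^sub>L Y) \<le> norm Y * norm Y" by (rule norm_blinfun_compose)
    also have "\<dots> \<le> (1 / 2) * (1 / 2)" using Y by (intro mult_mono) (auto simp: T_def)
    finally have "norm (XX - (Y o\<^sub>L Y)) \<le> 1"
      using nX norm_triangle_ineq4[of XX "Y o\<^sub>L Y"] by simp
    then have "norm (f Y) \<le> 1 / 2" by (simp add: f_def)
    moreover have "A (f Y x) = f Y (A x)" if "bounded_linear A" "\<forall>y. A (X y) = X (A y)" for A x
      using Y that by (simp add: f_def T_def XX blinfun.diff_left blinfun.scaleR_left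
          bounded_linear.linear linear_diff linear_scale)
    ultimately show "f Y \<in> T"
      using Y by (auto simp: T_def f_def XX blinfun.diff_left blinfun.scaleR_left inner_diff_left inner_diff_right X)
  qed
  moreover have "dist (f Y) (f Z) \<le> (1 / 2) * dist Y Z" if "Y \<in> T" "Z \<in> T" for Y Z
  proof -
    \<comment> \<open>Z^2 - Y^2 split without commuting the factors.\<close>
    have "f Y - f Z = (1 / 2) *\<^sub>R (((Z - Y) o\<^sub>L Z) + (Y o\<^sub>L (Z - Y)))"
      by (rule blinfun_eqI) (simp add: f_def blinfun.diff_left blinfun.add_left blinfun.scaleR_left
          blinfun.diff_right algebra_simps)
    then have "norm (f Y - f Z) = norm (((Z - Y) o\<^sub>L Z) + (Y o\<^sub>L (Z - Y))) / 2" by simp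
    also have "norm (((Z - Y) o\<^sub>L Z) + (Y o\<^sub>L (Z - Y))) \<le> norm ((Z - Y) o\<^sub>L Z) + norm (Y o\<^sub>L (Z - Y))"
      by (rule norm_triangle_ineq)
    also have "\<dots> \<le> norm (Z - Y) * norm Z + norm Y * norm (Z - Y)"
      by (intro add_mono norm_blinfun_compose)
    also have "\<dots> \<le> norm (Z - Y) * (1 / 2) + (1 / 2) * norm (Z - Y)"
      using that by (intro add_mono mult_left_mono mult_right_mono) (auto simp: T_def)
    finally show ?thesis by (simp add: dist_norm norm_minus_commute)
  qed
  ultimately obtain Y where Y: "Y \<in> T" "f Y = Y"
    using Banach_fix[of T "1 / 2" f] by auto
  have eq: "2 *\<^sub>R Y x + Y (Y x) = X x" for x
  proof -
    have "Y x = f Y x" using Y(2) by simp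
    also have "\<dots> = (1 / 2) *\<^sub>R (X x - Y (Y x))"
      by (simp add: f_def blinfun.scaleR_left blinfun.diff_left XX)
    finally have "2 *\<^sub>R Y x = 2 *\<^sub>R ((1 / 2) *\<^sub>R (X x - Y (Y x)))" by (rule arg_cong)
    then show ?thesis by simp
  qed
  have bound: "norm (Y x) \<le> norm x / 2" for x
  proof -
    have "norm (Y x) \<le> norm Y * norm x" by (rule norm_blinfun)
    also have "\<dots> \<le> (1 / 2) * norm x" using Y(1) by (intro mult_right_mono) (auto simp: T_def)
    finally show ?thesis by simp
  qed
  have sym: "blinfun_apply Y x \<bullet> y = x \<bullet> blinfun_apply Y y" for x y
    using Y(1) by (simp add: T_def)
  have comm: "A (blinfun_apply Y x) = blinfun_apply Y (A x)"
    if "bounded_linear A" "\<And>y. A (X y) = X (A y)" for A x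
    using Y(1) that by (simp add: T_def)
  show ?thesis
    by (rule that[OF blinfun.bounded_linear_right bound sym eq comm])
qed

text \<open>\<open>P\<close> is the positive square root of \<open>D \<circ> D\<close>, namely
  \<open>c\<close> times 1 + Y. The unitary part is P^-1 D; since \<open>D\<close> is self-adjoint
  and commutes with \<open>P\<close>, it is a self-adjoint involution.\<close>

lemma polar_decomposition:
  fixes D X :: "'h::{real_inner,banach} \<Rightarrow> 'h"
  assumes D: "bounded_linear D" "\<And>x y. D x \<bullet> y = x \<bullet> D y"
    and X: "bounded_linear X" "\<And>x. norm (X x) \<le> norm x / 4"
    and c: "0 < c" "\<And>x. D (D x) = (c * c) *\<^sub>R (x + X x)"
  obtains P \<theta> where "bounded_linear P" "bounded_linear \<theta>" "\<And>x y. P x \<bullet> y = x \<bullet> P y"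
    "\<And>x y. \<theta> x \<bullet> y = x \<bullet> \<theta> y" "\<And>x. (c / 2) * (norm x)\<^sup>2 \<le> x \<bullet> P x" "\<And>x. \<theta> (\<theta> x) = x"
    "\<And>x. P (\<theta> x) = D x" "\<And>x. \<theta> (P x) = D x"
    "\<And>A x. bounded_linear A \<Longrightarrow> (\<And>y. A (D (D y)) = D (D (A y))) \<Longrightarrow> A (P x) = P (A x)"
proof -
  interpret D: bounded_linear D by fact
  interpret X: bounded_linear X by fact
  \<comment> \<open>Expressing \<open>X\<close> through \<open>D\<close> shows that it is
    self-adjoint and commutes with whatever commutes with \<open>D \<circ> D\<close>.\<close>
  have X_eq: "X x = (1 / (c * c)) *\<^sub>R D (D x) - x" for x using c by simp
  have X_sym: "X x \<bullet> y = x \<bullet> X y" for x y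
    by (simp add: X_eq inner_diff_left inner_diff_right D(2))
  obtain Y where Y: "bounded_linear Y" "\<And>x. norm (Y x) \<le> norm x / 2" "\<And>x y. Y x \<bullet> y = x \<bullet> Y y"
    "\<And>x. 2 *\<^sub>R Y x + Y (Y x) = X x"
    "\<And>A x. bounded_linear A \<Longrightarrow> (\<And>y. A (X y) = X (A y)) \<Longrightarrow> A (Y x) = Y (A x)"
    using square_root_perturbation[OF X X_sym] by auto
  interpret Y: bounded_linear Y by fact
  define P where "P = (\<lambda>x. c *\<^sub>R (x + Y x))"
  have P: "bounded_linear P"
    unfolding P_def by (intro bounded_linear_const_scaleR bounded_linear_add bounded_linear_ident Y(1))
  interpret P: bounded_linear P by fact
  have P_sym: "P x \<bullet> y = x \<bullet> P y" for x y by (simp add: P_def inner_add_left inner_add_right Y(3))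
  have PP: "P (P x) = D (D x)" for x
    using Y(4)[of x] by (simp add: P_def c(2) Y.scaleR Y.add scaleR_2 add.assoc algebra_simps flip: Y(4))
  have P_pos: "(c / 2) * (norm x)\<^sup>2 \<le> x \<bullet> P x" for x
  proof -
    have "- (x \<bullet> Y x) \<le> norm x * norm (Y x)" using norm_cauchy_schwarz[of x "- Y x"] by simp
    also have "\<dots> \<le> norm x * (norm x / 2)" using Y(2) by (intro mult_left_mono) auto
    finally have "(norm x)\<^sup>2 / 2 \<le> x \<bullet> x + x \<bullet> Y x" by (simp add: power2_norm_eq_inner[symmetric] power2_eq_square)
    then have "c * ((norm x)\<^sup>2 / 2) \<le> c * (x \<bullet> x + x \<bullet> Y x)" using c(1) by (intro mult_left_mono) auto
    then show ?thesis by (simp add: P_def inner_add_right)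
  qed
  have P_comm: "A (P x) = P (A x)" if A: "bounded_linear A" "\<And>y. A (D (D y)) = D (D (A y))" for A x
  proof -
    interpret A: bounded_linear A by fact
    have "A (Y x) = Y (A x)"
      by (rule Y(5)[OF A(1)]) (simp add: X_eq A.diff A.scaleR A(2))
    then show ?thesis by (simp add: P_def A.scaleR A.add)
  qed
  have c2: "0 < c / 2" using c by simp
  have G: "bounded_bilinear (\<lambda>x y. x \<bullet> P y)"
    using bounded_bilinear.comp[OF bounded_bilinear_inner bounded_linear_ident P] .
  have Gsym: "x \<bullet> P y = y \<bullet> P x" for x y by (metis P_sym inner_commute)
  obtain Q where Q: "bounded_linear Q" "\<And>x w. Q x \<bullet> P w = x \<bullet> w"
    using lax_milgram_operator[OF closed_UNIV subspace_UNIV G Gsym c2 P_pos bounded_bilinear_inner] by auto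
  have PQ: "P (Q x) = x" for x
    by (rule inner_left_eqI) (simp add: P_sym Q)
  have P_inj: "x = y" if "P x = P y" for x y
  proof -
    have "(c / 2) * (norm (x - y))\<^sup>2 \<le> 0" using P_pos[of "x - y"] that by (simp add: P.diff)
    then show ?thesis using c by (simp add: mult_le_0_iff)
  qed
  have QP: "Q (P x) = x" for x by (rule P_inj) (rule PQ)
  have DP: "D (P x) = P (D x)" for x by (rule P_comm) (auto intro: D)
  have DQ: "D (Q x) = Q (D x)" for x by (rule P_inj) (simp add: PQ flip: DP)
  define \<theta> where "\<theta> = (\<lambda>x. Q (D x))"
  have Q_sym: "Q x \<bullet> y = x \<bullet> Q y" for x y by (metis PQ Q(2))
  have \<theta>: "bounded_linear \<theta>" unfolding \<theta>_def using bounded_linear_compose[OF Q(1) D(1)] .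
  have \<theta>_sym: "\<theta> x \<bullet> y = x \<bullet> \<theta> y" for x y by (simp add: \<theta>_def Q_sym D(2) DQ)
  have \<theta>\<theta>: "\<theta> (\<theta> x) = x" for x by (simp add: \<theta>_def DQ QP flip: PP)
  have P\<theta>: "P (\<theta> x) = D x" for x by (simp add: \<theta>_def PQ)
  have \<theta>P: "\<theta> (P x) = D x" for x by (simp add: \<theta>_def DP QP)
  show ?thesis by (rule that[OF P \<theta> P_sym \<theta>_sym P_pos \<theta>\<theta> P\<theta> \<theta>P P_comm])
qed

section \<open>Causal factorization in multiplicity one\<close>

text \<open>Spectrally \<open>e\<close> represents evaluation at the point i of the half plane on
  the Hardy space. The scalar product being real, cyclicity over the complex numbers has to mention
  \<open>I (U t e)\<close> as well, and the eigenvalue equation gives its complex form when applied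
  to \<open>I x\<close>.\<close>

locale multiplicity_one = complex_shift I U S
  for I :: "'h::{real_inner,banach} \<Rightarrow> 'h" and U :: "real \<Rightarrow> 'h \<Rightarrow> 'h" and S :: "'h set" +
  fixes e :: 'h
  assumes e_S: "e \<in> S" and e_norm: "norm e = 1"
    and e_eigen: "0 \<le> t \<Longrightarrow> x \<in> S \<Longrightarrow> U t x \<bullet> e = exp (- t) * (x \<bullet> e)"
    and e_cyclic: "(\<And>t. f \<bullet> U t e = 0) \<Longrightarrow> (\<And>t. f \<bullet> I (U t e) = 0) \<Longrightarrow> f = 0"
begin

section \<open>Joint eigenvectors relative to the scalar product given by \<open>P\<close>\<close>

context
  fixes P :: "'h \<Rightarrow> 'h" and v :: 'h
  assumes P_linear: "bounded_linear P" and P_sym: "\<And>x y. P x \<bullet> y = x \<bullet> P y"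
    and P_U: "\<And>t x. P (U t x) = U t (P x)" and P_I: "\<And>x. P (I x) = I (P x)"
    and v_S: "v \<in> S" and v_eigen: "\<And>x. x \<in> S \<Longrightarrow> x \<bullet> P v = x \<bullet> e"
begin

text \<open>For negative times the shift moves to \<open>f\<close>, which stays in \<open>S\<close>,
  and the eigenvalue equation reduces to time 0: P-orthogonality to the forward orbit implies
  P-orthogonality to the whole orbit. The case of the identity and \<open>v = e\<close> is used
  too.\<close>

lemma eigenvector_annihilator:
  assumes f: "f \<in> S" and orth: "f \<bullet> P v = 0" "f \<bullet> P (I v) = 0"
    "\<And>t. 0 \<le> t \<Longrightarrow> f \<bullet> P (U t v) = 0" "\<And>t. 0 \<le> t \<Longrightarrow> f \<bullet> P (I (U t v)) = 0"
  shows "f \<bullet> P (U t v) = 0" "f \<bullet> P (I (U t v)) = 0"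
proof -
  have "f \<bullet> P (U t v) = 0 \<and> f \<bullet> P (I (U t v)) = 0"
  proof (cases "0 \<le> t")
    case False
    then have r: "0 \<le> - t" by simp
    have I: "I f \<in> S" using f by (rule I_S)
    have "f \<bullet> P (U t v) = U (- t) f \<bullet> P v" by (simp add: P_U U_adjoint)
    also have "\<dots> = exp t * (f \<bullet> P v)" using e_eigen[OF r f] U_S[OF r f] f by (simp add: v_eigen)
    finally have 1: "f \<bullet> P (U t v) = 0" using orth by simp
    have "f \<bullet> P (I (U t v)) = - (U (- t) (I f) \<bullet> P v)" by (simp add: P_U P_I U_adjoint I_adjoint)
    also have "\<dots> = - exp t * (I f \<bullet> P v)" using e_eigen[OF r I] U_S[OF r I] I by (simp add: v_eigen)
    also have "\<dots> = 0" using orth by (simp add: I_adjoint P_I)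
    finally show ?thesis using 1 by simp
  qed (use orth in blast)
  then show "f \<bullet> P (U t v) = 0" "f \<bullet> P (I (U t v)) = 0" by simp_all
qed

text \<open>Up to the factor \<open>v \<bullet> P v\<close> this Gram matrix is the same for every
  \<open>P\<close>, so the orbits of \<open>e\<close> and \<open>v\<close> are related by an
  isometry. The product depends only on \<open>s - t\<close>, and symmetry reduces it to a
  nonnegative difference.\<close>

lemma eigenvector_gram:
  "U s v \<bullet> P (U t v) = exp (- \<bar>s - t\<bar>) * (v \<bullet> P v)" "U s v \<bullet> P (I (U t v)) = 0"
proof -
  have Iv: "I v \<in> S" using v_S by (rule I_S)
  have sym: "x \<bullet> P y = y \<bullet> P x" for x y by (metis P_sym inner_commute)
  have 0: "I v \<bullet> P v = 0"
    using I_adjoint[of v "P v"] sym[of v "I v"] by (simp add: P_I)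
  have *: "U r v \<bullet> P v = exp (- r) * (v \<bullet> P v) \<and> U r (I v) \<bullet> P v = 0" if "0 \<le> r" for r
    using e_eigen[OF that v_S] e_eigen[OF that Iv] U_S[OF that v_S] U_S[OF that Iv] 0 v_S Iv
    by (simp add: v_eigen)
  have shift: "U s x \<bullet> P (U t y) = U (s - t) x \<bullet> P y" for s t x y
    using U_adjoint[of "- t" "U s x" "P y"] by (simp add: P_U U_add[symmetric])
  show "U s v \<bullet> P (U t v) = exp (- \<bar>s - t\<bar>) * (v \<bullet> P v)"
  proof (cases "t \<le> s")
    case True
    then show ?thesis using *[of "s - t"] by (simp add: shift)
  next
    case False
    have "U s v \<bullet> P (U t v) = U t v \<bullet> P (U s v)" by (rule sym)
    then show ?thesis using *[of "t - s"] False by (simp add: shift)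
  qed
  show "U s v \<bullet> P (I (U t v)) = 0"
  proof (cases "t \<le> s")
    case True
    have "U s v \<bullet> P (I (U t v)) = - (U s (I v) \<bullet> P (U t v))" by (simp add: P_I I_adjoint U_I)
    then show ?thesis using *[of "s - t"] True by (simp add: shift)
  next
    case False
    have "U s v \<bullet> P (I (U t v)) = U t (I v) \<bullet> P (U s v)" by (simp add: sym[of "U s v"] U_I)
    then show ?thesis using *[of "t - s"] False by (simp add: shift)
  qed
qed

end

text \<open>The Boolean adds the multiples by \<open>I\<close>, turning a complex orbit into one
  indexed family for real linear arguments.\<close>

definition orbit :: "'h \<Rightarrow> real \<times> bool \<Rightarrow> 'h" where
  "orbit v i = (if snd i then I (U (fst i) v) else U (fst i) v)"

lemma orbit_total: "(\<And>i. f \<bullet> orbit e i = 0) \<Longrightarrow> f = 0"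
  using e_cyclic[of f] unfolding orbit_def by (metis fst_conv snd_conv)

lemma e_gram: "U s e \<bullet> U t e = exp (- \<bar>s - t\<bar>)" "U s e \<bullet> I (U t e) = 0"
  using eigenvector_gram[of "\<lambda>x. x" e s t] e_S e_norm
  by (simp_all add: bounded_linear_ident power2_norm_eq_inner[symmetric])

text \<open>The forward orbit of \<open>e\<close> is total in \<open>S\<close>: by the annihilator
  lemma a vector of \<open>S\<close> orthogonal to it is orthogonal to the whole orbit.\<close>

lemma causal_orbit_total:
  assumes "f \<in> S" "\<And>t. 0 \<le> t \<Longrightarrow> f \<bullet> U t e = 0" "\<And>t. 0 \<le> t \<Longrightarrow> f \<bullet> I (U t e) = 0"
  shows "f = 0"
proof (rule e_cyclic)
  show "f \<bullet> U t e = 0" "f \<bullet> I (U t e) = 0" for t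
    using eigenvector_annihilator[of "\<lambda>x. x" e f t] assms assms(2,3)[of 0] e_S
    by (auto simp: bounded_linear_ident U_0)
qed

text \<open>The Gram matrix of the orbit of \<open>e\<close> is real and even in the time
  difference, so reversing time and conjugating scalars preserves it. The resulting \<open>C\<close>
  is an antilinear isometric involution.\<close>

lemma conjugation_exists:
  obtains C where "bounded_linear C" "\<And>x. C (C x) = x" "\<And>x y. C x \<bullet> y = x \<bullet> C y"
    "\<And>t. C (U t e) = U (- t) e" "\<And>t. C (I (U t e)) = - I (U (- t) e)"
proof -
  define b where "b = (\<lambda>i. if snd i then - I (U (- fst i) e) else U (- fst i) e)"
  have pos: "1 * (norm x)\<^sup>2 \<le> x \<bullet> x" for x :: 'h by (simp add: power2_norm_eq_inner)
  have gram: "I (U s e) \<bullet> U t e = 0" for s t by (simp add: I_adjoint e_gram)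
  have "orbit e i \<bullet> orbit e j = b i \<bullet> b j" for i j
    by (auto simp: orbit_def b_def I_inner e_gram gram abs_minus_commute)
  then obtain C where C: "bounded_linear C" "\<And>i. C (orbit e i) = b i" "\<And>x y. x \<bullet> y = C x \<bullet> C y"
    using isometric_extension[OF bounded_linear_ident zero_less_one pos, of "orbit e" b] orbit_total by metis
  interpret C: bounded_linear C by fact
  have 1: "C (U t e) = U (- t) e" "C (I (U t e)) = - I (U (- t) e)" for t
    using C(2)[of "(t, False)"] C(2)[of "(t, True)"] by (simp_all add: orbit_def b_def)
  have CC: "C (C (orbit e i)) = orbit e i" for i
    by (simp add: orbit_def 1 C.neg)
  have CC': "C (C x) = x" for x
  proof -
    have "C (C x) - x = 0"
    proof (rule orbit_total)
      show "(C (C x) - x) \<bullet> orbit e i = 0" for i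
        using C(3)[of x "orbit e i"] C(3)[of "C x" "C (orbit e i)"] by (simp add: inner_diff_left CC)
    qed
    then show ?thesis by simp
  qed
  have "C x \<bullet> y = x \<bullet> C y" for x y using C(3)[of "C x" y] by (simp add: CC')
  then show ?thesis using that C(1) CC' 1 by blast
qed

text \<open>In the spectral picture \<open>C\<close> is pointwise complex conjugation, and the operators commuting with
  \<open>U\<close> and \<open>I\<close> are the multiplication operators.\<close>

lemma commutant_adjoint:
  assumes C: "bounded_linear C" "\<And>x. C (C x) = x" "\<And>x y. C x \<bullet> y = x \<bullet> C y"
    "\<And>t. C (U t e) = U (- t) e" "\<And>t. C (I (U t e)) = - I (U (- t) e)"
    and X: "bounded_linear X" "\<And>x y. X x \<bullet> y = x \<bullet> X' y"
    "\<And>t x. X (U t x) = U t (X x)" "\<And>x. X (I x) = I (X x)"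
  shows "X' w = C (X (C w))"
proof -
  interpret X: bounded_linear X by fact
  interpret I: bounded_linear I by (rule I_linear)
  \<comment> \<open>Exchanging the two times with opposite signs; for \<open>x = e\<close> and
    \<open>y = X e\<close> it moves \<open>X\<close> from one orbit vector to the other and produces
    \<open>C\<close>.\<close>
  have flip: "U s x \<bullet> U t y = U (- s) y \<bullet> U (- t) x" for s t x y
    using U_adjoint[of s x "U t y"] U_adjoint[of "- s" y "U (- t) x"]
    by (metis U_add U_adjoint U_minus(1) add.inverse_inverse add.commute inner_commute)
  have *: "orbit e i \<bullet> X (orbit e j) = X (C (orbit e i)) \<bullet> C (orbit e j)" for i j
    using flip[of "fst i" e "fst j" "X e"] flip[of "fst i" "I e" "fst j" "X e"]
      flip[of "fst i" e "fst j" "I (X e)"] flip[of "fst i" "I e" "fst j" "I (X e)"]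
    by (simp add: orbit_def C(4,5) X(3,4) U_I X.neg I.neg I_inner I_adjoint)
  \<comment> \<open>At first X = C X' C is known on orbit vectors only; pairing with them then gives
    X' = C X C on every vector.\<close>
  have 1: "X (orbit e j) = C (X' (C (orbit e j)))" for j
  proof -
    have "X (orbit e j) - C (X' (C (orbit e j))) = 0"
    proof (rule orbit_total)
      fix i
      have "orbit e i \<bullet> X (orbit e j) = orbit e i \<bullet> C (X' (C (orbit e j)))"
        by (simp add: * X(2) C(3))
      then show "(X (orbit e j) - C (X' (C (orbit e j)))) \<bullet> orbit e i = 0"
        by (simp add: inner_diff_right inner_commute[of _ "orbit e i"])
    qed
    then show ?thesis by simp
  qed
  have "X' w - C (X (C w)) = 0"
  proof (rule orbit_total)
    fix j
    have "X' w \<bullet> orbit e j = C (X' (C (orbit e j))) \<bullet> w"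
      using X(2)[of "orbit e j" w] by (simp add: 1 inner_commute)
    also have "\<dots> = X (C w) \<bullet> C (orbit e j)"
      using X(2)[of "C w" "C (orbit e j)"] C(3)[of "X' (C (orbit e j))" w] by (simp add: inner_commute)
    also have "\<dots> = C (X (C w)) \<bullet> orbit e j" by (simp add: C(3))
    finally show "(X' w - C (X (C w))) \<bullet> orbit e j = 0" by (simp add: inner_diff_left)
  qed
  then show ?thesis by simp
qed

text \<open>The inverse \<open>J\<close> of \<open>g\<close> is constructed first, because the orbit
  of \<open>e\<close> is known to be total and that of \<open>v\<close> is not. \<open>J\<close> is
  an isometry from the given product to the P-product, so \<open>A\<close>, the adjoint of
  \<open>J\<close> applied after \<open>P\<close>, is a left inverse; it becomes \<open>g\<close>
  once \<open>J\<close> is shown to be onto.\<close>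

theorem causal_factorization:
  assumes P: "bounded_linear P" "\<And>x y. P x \<bullet> y = x \<bullet> P y" "0 < c" "\<And>x. c * (norm x)\<^sup>2 \<le> x \<bullet> P x"
    "\<And>t x. P (U t x) = U t (P x)" "\<And>x. P (I x) = I (P x)"
  obtains g h where "bounded_linear g" "bounded_linear h" "\<And>x. g (h x) = x" "\<And>x. h (g x) = x"
    "\<And>t x. g (U t x) = U t (g x)" "\<And>x. g (I x) = I (g x)" "g ` S = S" "\<And>x y. g x \<bullet> g y = x \<bullet> P y"
proof -
  interpret P: bounded_linear P by fact
  interpret I: bounded_linear I by (rule I_linear)
  have G: "bounded_bilinear (\<lambda>x y. x \<bullet> P y)"
    using bounded_bilinear.comp[OF bounded_bilinear_inner bounded_linear_ident P(1)] .
  have Gsym: "x \<bullet> P y = y \<bullet> P x" for x y by (metis P(2) inner_commute)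
  have P_inj: "x = 0" if "x \<bullet> P x = 0" for x
    using P(3) P(4)[of x] that by (simp add: mult_le_0_iff)
  \<comment> \<open>\<open>v\<close> represents the functional of \<open>e\<close> on
    \<open>S\<close> in the P-product.\<close>
  obtain v where v: "v \<in> S" "\<And>x. x \<in> S \<Longrightarrow> v \<bullet> P x = e \<bullet> x"
    using lax_milgram_symmetric[OF S_closed S_subspace G Gsym P(3,4) bounded_linear_inner_right[of e]] by metis
  have v_eigen: "x \<bullet> P v = x \<bullet> e" if "x \<in> S" for x
    using v(2)[OF that] Gsym[of x v] by (simp add: inner_commute)
  note gram = eigenvector_gram[OF P(1,2,5,6) v(1) v_eigen]
  have "v \<bullet> P v \<noteq> 0"
  proof
    assume "v \<bullet> P v = 0"
    then have "v = 0" by (rule P_inj)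
    then have "e \<bullet> e = 0" using v_eigen[OF e_S] by (simp add: P.zero)
    then show False using e_norm by simp
  qed
  moreover have "0 \<le> v \<bullet> P v" using P(3) P(4)[of v] by (meson mult_nonneg_nonneg order_trans less_imp_le zero_le_power2)
  ultimately have q: "0 < v \<bullet> P v" by simp
  \<comment> \<open>Makes the P-length of \<open>r *\<^sub>R v\<close> equal to the length 1 of
    \<open>e\<close>.\<close>
  define r where "r = 1 / sqrt (v \<bullet> P v)"
  have r: "r * r * (v \<bullet> P v) = 1" "r \<noteq> 0" using q by (simp_all add: r_def)
  define b where "b = (\<lambda>i. r *\<^sub>R orbit v i)"
  have gram': "I (U s v) \<bullet> P (U t v) = 0" "I (U s v) \<bullet> P (I (U t v)) = U s v \<bullet> P (U t v)" for s t
    using gram(2)[of s t] by (simp_all add: I_adjoint P(6) I_I)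
  have gram_e: "I (U s e) \<bullet> U t e = 0" for s t by (simp add: I_adjoint e_gram)
  have "orbit e i \<bullet> orbit e j = b i \<bullet> P (b j)" for i j
    using r by (auto simp: orbit_def b_def I_inner e_gram gram_e gram gram' P.scaleR mult.assoc[symmetric]
        mult.commute[of _ "exp _"])
  then obtain J where J: "bounded_linear J" "\<And>i. J (orbit e i) = b i" "\<And>x y. x \<bullet> y = J x \<bullet> P (J y)"
    using isometric_extension[OF P(1,3,4), of "orbit e" b] orbit_total by metis
  interpret J: bounded_linear J by fact
  have orbit_U: "U t (orbit w i) = orbit w (t + fst i, snd i)" for t w i
    by (simp add: orbit_def U_add U_I)
  have orbit_I: "I (orbit w i) = (if snd i then - orbit w (fst i, False) else orbit w (fst i, True))" for w i
    by (simp add: orbit_def I_I)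
  have JU: "J (U t x) = U t (J x)" for t x
    by (rule bounded_linear_total_eqI[of "\<lambda>x. J (U t x)" "\<lambda>x. U t (J x)" "orbit e"])
      (auto simp: orbit_U J(2) b_def linear_scale[OF bounded_linear.linear[OF U_linear]] orbit_total
        intro: bounded_linear_compose[OF J(1) U_linear] bounded_linear_compose[OF U_linear J(1)])
  have JI: "J (I x) = I (J x)" for x
    by (rule bounded_linear_total_eqI[of "\<lambda>x. J (I x)" "\<lambda>x. I (J x)" "orbit e"])
      (auto simp: orbit_I J(2) J.neg b_def I.scaleR orbit_total
        intro: bounded_linear_compose[OF J(1) I_linear] bounded_linear_compose[OF I_linear J(1)])
  obtain J' where J': "bounded_linear J'" "\<And>x y. J x \<bullet> y = x \<bullet> J' y"
    using adjoint_exists[OF J(1)] by auto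
  define A where "A = (\<lambda>x. J' (P x))"
  have A: "bounded_linear A" unfolding A_def by (rule bounded_linear_compose[OF J'(1) P(1)])
  have AJ: "A (J x) = x" for x
  proof (rule inner_left_eqI)
    fix w
    show "A (J x) \<bullet> w = x \<bullet> w"
      using J'(2)[of w "P (J x)"] J(3)[of w x] by (simp add: A_def inner_commute)
  qed
  have J'U: "J' (U t x) = U t (J' x)" for t x
  proof (rule inner_left_eqI)
    fix w
    have "w \<bullet> J' (U t x) = J (U (- t) w) \<bullet> x"
      using U_adjoint[of "- t" "J w" x] by (simp add: JU flip: J'(2))
    also have "\<dots> = w \<bullet> U t (J' x)" using U_adjoint[of "- t" w "J' x"] by (simp add: J'(2))
    finally show "J' (U t x) \<bullet> w = U t (J' x) \<bullet> w" by (simp add: inner_commute)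
  qed
  have J'I: "J' (I x) = I (J' x)" for x
  proof (rule inner_left_eqI)
    fix w
    have "w \<bullet> J' (I x) = - (J (I w) \<bullet> x)" by (simp add: I_adjoint JI flip: J'(2))
    also have "\<dots> = w \<bullet> I (J' x)" by (simp add: J'(2) I_adjoint)
    finally show "J' (I x) \<bullet> w = I (J' x) \<bullet> w" by (simp add: inner_commute)
  qed
  have AU: "A (U t x) = U t (A x)" and AI: "A (I x) = I (A x)" for t x
    by (simp_all add: A_def P J'U J'I)
  have A_adj: "A x \<bullet> y = x \<bullet> P (J y)" for x y
    unfolding A_def by (metis J'(2) P(2) inner_commute)
  obtain C where C: "bounded_linear C" "\<And>x. C (C x) = x" "\<And>x y. C x \<bullet> y = x \<bullet> C y"
    "\<And>t. C (U t e) = U (- t) e" "\<And>t. C (I (U t e)) = - I (U (- t) e)"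
    using conjugation_exists by auto
  \<comment> \<open>The adjoint of \<open>A\<close> is P J. Hence P J J' = (C A C) (C J C) = C (A J)
    C, which is the identity; with injectivity of \<open>P\<close> this shows that \<open>J\<close>
    is onto.\<close>
  have "J' w = C (J (C w))" "P (J w) = C (A (C w))" for w
    using commutant_adjoint[OF C J(1) J'(2) JU JI] commutant_adjoint[OF C A A_adj AU AI] by auto
  then have "P (J (J' w)) = w" for w by (simp add: C AJ)
  then have JA: "J (A x) = x" for x
    using P_inj[of "J (A x) - x"] by (simp add: A_def P.diff)
  have "J ` S = A -` S" using AJ JA by (auto intro: image_eqI[of _ J "A _"])
  then have JS_closed: "closed (J ` S)"
    using continuous_closed_vimage[OF S_closed, of A] linear_continuous_at[OF A] by simp
  have JS_subspace: "subspace (J ` S)"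
    using S_subspace by (intro linear_subspace_image bounded_linear.linear[OF J(1)])
  have pos: "1 * (norm x)\<^sup>2 \<le> x \<bullet> x" for x :: 'h by (simp add: power2_norm_eq_inner)
  have orbit_S: "orbit w (t, k) \<in> S" if "w \<in> S" "0 \<le> t" for w t k
    using that by (simp add: orbit_def U_S I_S)
  have J_orbit: "J (U t e) = r *\<^sub>R U t v" "J (I (U t e)) = r *\<^sub>R I (U t v)" for t
    using J(2)[of "(t, False)"] J(2)[of "(t, True)"] by (simp_all add: orbit_def b_def)
  \<comment> \<open>The vectors of \<open>S\<close> that \<open>J\<close> maps into \<open>S\<close>
    form a closed subspace containing the forward orbit of \<open>e\<close>.\<close>
  have "S \<inter> J -` S = S"
  proof (rule closed_subspace_eqI[OF S_subspace _ _ _ bounded_linear_ident _ zero_less_one pos])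
    show "closed (S \<inter> J -` S)"
      using continuous_closed_vimage[OF S_closed, of J] linear_continuous_at[OF J(1)] S_closed by blast
    show "subspace (S \<inter> J -` S)"
      using S_subspace linear_subspace_vimage[OF bounded_linear.linear[OF J(1)]] by (intro subspace_inter)
    show "f = 0" if "f \<in> S" "\<And>w. w \<in> S \<inter> J -` S \<Longrightarrow> f \<bullet> w = 0" for f
      using that v(1) e_S S_subspace
      by (intro causal_orbit_total) (auto simp: J_orbit U_S I_S subspace_scale)
  qed auto
  then have JS_sub: "J ` S \<subseteq> S" by blast
  \<comment> \<open>A vector of \<open>S\<close> that is P-orthogonal to J S is P-orthogonal to the
    forward orbit of \<open>v\<close>, hence to the whole orbit; then \<open>A\<close> maps it to a
    vector orthogonal to the orbit of \<open>e\<close>.\<close>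
  have "J ` S = S"
  proof (rule closed_subspace_eqI[OF S_subspace JS_closed JS_subspace JS_sub P(1-4)])
    fix f assume f: "f \<in> S" "\<And>w. w \<in> J ` S \<Longrightarrow> f \<bullet> P w = 0"
    have "f \<bullet> P (J (U t e)) = 0 \<and> f \<bullet> P (J (I (U t e))) = 0" if "0 \<le> t" for t
      using that e_S by (auto intro!: f(2) U_S I_S)
    then have c: "f \<bullet> P (U t v) = 0" "f \<bullet> P (I (U t v)) = 0" if "0 \<le> t" for t
      using that r(2) by (auto simp: J_orbit P.scaleR)
    have "f \<bullet> P (U t v) = 0" "f \<bullet> P (I (U t v)) = 0" for t
      using eigenvector_annihilator[OF P(1,2,5,6) v(1) v_eigen f(1) _ _ c] c[of 0] by (simp_all add: U_0)
    then have "A f \<bullet> U t e = 0" "A f \<bullet> I (U t e) = 0" for t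
      by (simp_all add: A_adj P(2) J_orbit P.scaleR)
    then have "A f = 0" by (rule e_cyclic)
    then show "f = 0" using JA[of f] J.zero by simp
  qed
  then have "A ` S = A ` (J ` S)" by simp
  also have "\<dots> = S" by (simp add: image_image AJ)
  finally have AS: "A ` S = S" .
  have "A x \<bullet> A y = x \<bullet> P y" for x y using J(3)[of "A x" "A y"] by (simp add: JA)
  then show ?thesis by (rule that[OF A J(1) AJ JA AU AI AS])
qed

text \<open>The involution \<open>R\<close> reverses time like \<open>T\<close> and maps
  \<open>S\<close> into its orthogonal complement, so adding multiples of it changes neither the
  intertwining relation nor the form on \<open>S\<close>.\<close>

theorem hankel_reflection:
  fixes B :: "'h \<Rightarrow> 'h \<Rightarrow> real"
  assumes R: "bounded_linear R" "\<And>x y. R x \<bullet> y = x \<bullet> R y" "\<And>x. R (R x) = x" "\<And>x. R (I x) = I (R x)"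
    "\<And>t x. R (U t x) = U (- t) (R x)" "\<And>x y. x \<in> S \<Longrightarrow> y \<in> S \<Longrightarrow> x \<bullet> R y = 0"
    and B: "bounded_bilinear B" "\<And>x y. x \<in> S \<Longrightarrow> y \<in> S \<Longrightarrow> B x y = B y x"
    "\<And>t x y. 0 \<le> t \<Longrightarrow> x \<in> S \<Longrightarrow> y \<in> S \<Longrightarrow> B (U t x) y = B x (U t y)"
    "\<And>x y. x \<in> S \<Longrightarrow> y \<in> S \<Longrightarrow> B (I x) (I y) = B x y"
  obtains g h \<theta> where "bounded_linear g" "bounded_linear h" "\<And>x. g (h x) = x" "\<And>x. h (g x) = x"
    "\<And>t x. g (U t x) = U t (g x)" "\<And>x. g (I x) = I (g x)" "g ` S = S"
    "bounded_linear \<theta>" "\<And>x. \<theta> (\<theta> x) = x" "\<And>x y. \<theta> x \<bullet> \<theta> y = x \<bullet> y" "\<And>x. \<theta> (I x) = I (\<theta> x)"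
    "\<And>t x. \<theta> (U t x) = U (- t) (\<theta> x)" "\<And>x y. g (\<theta> x) \<bullet> g (\<theta> y) = g x \<bullet> g y"
    "\<And>x y. x \<in> S \<Longrightarrow> y \<in> S \<Longrightarrow> g x \<bullet> g (\<theta> y) = B x y"
proof -
  interpret R: bounded_linear R by fact
  obtain F where F: "bounded_bilinear F" "\<And>x y. x \<in> S \<Longrightarrow> y \<in> S \<Longrightarrow> F x y = B x y"
    "\<And>t x y. F (U t x) y = F x (U t y)" "\<And>x y. F (I x) (I y) = F x y"
    using hankel_extension[OF B(1,3,4)] by auto
  \<comment> \<open>The extension need not be symmetric, but its symmetrisation has the same
    properties because \<open>B\<close> is symmetric on \<open>S\<close>.\<close>
  have FF: "bounded_bilinear (\<lambda>x y. (1 / 2) * (F x y + F y x))"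
    by (intro bounded_bilinear_scale_form bounded_bilinear_add_form F(1) bounded_bilinear.flip[OF F(1)])
  have pos: "1 * (norm x)\<^sup>2 \<le> x \<bullet> x" for x :: 'h by (simp add: power2_norm_eq_inner)
  obtain T where T: "bounded_linear T" "\<And>x y. T x \<bullet> y = (1 / 2) * (F x y + F y x)"
    using lax_milgram_operator[OF closed_UNIV subspace_UNIV bounded_bilinear_inner inner_commute zero_less_one pos FF]
    by auto
  interpret T: bounded_linear T by fact
  have T_sym: "T x \<bullet> y = x \<bullet> T y" for x y
    using T(2)[of x y] T(2)[of y x] by (simp add: inner_commute)
  have TU: "T (U t x) = U (- t) (T x)" for t x
  proof (rule inner_left_eqI)
    fix w
    show "T (U t x) \<bullet> w = U (- t) (T x) \<bullet> w"
      using F(3)[of t w x] by (simp add: U_adjoint T(2) F(3))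
  qed
  have TI: "T (I x) = I (T x)" for x
  proof (rule inner_left_eqI)
    fix w
    have "w = I (- I w)" by (simp add: linear_neg[OF bounded_linear.linear[OF I_linear]] I_I)
    then have "T (I x) \<bullet> w = T x \<bullet> (- I w)" by (metis F(4) T(2))
    then show "T (I x) \<bullet> w = I (T x) \<bullet> w" by (simp add: I_adjoint)
  qed
  obtain K where K: "0 \<le> K" "\<And>x. norm (T x) \<le> norm x * K" using T.nonneg_bounded by blast
  \<comment> \<open>With c at least 10 K the two terms of \<open>X\<close> are bounded by 1/100 and
    2/10, within the 1/4 allowed for the square root; the summand 1 keeps c positive when K =
    0.\<close>
  define c where "c = 10 * K + 1"
  have c: "0 < c" "10 * K \<le> c" using K by (simp_all add: c_def)
  define D where "D = (\<lambda>x. T x + c *\<^sub>R R x)"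
  define X where "X = (\<lambda>x. (1 / (c * c)) *\<^sub>R T (T x) + (1 / c) *\<^sub>R (T (R x) + R (T x)))"
  have D: "bounded_linear D"
    unfolding D_def by (intro bounded_linear_add T(1) bounded_linear_const_scaleR R(1))
  interpret D: bounded_linear D by fact
  have D_sym: "D x \<bullet> y = x \<bullet> D y" for x y
    by (simp add: D_def inner_add_left inner_add_right T_sym R(2))
  have X: "bounded_linear X"
    unfolding X_def
    by (intro bounded_linear_add bounded_linear_const_scaleR bounded_linear_compose[OF T(1)] bounded_linear_compose[OF R(1)] T(1) R(1))
  have DD: "D (D x) = (c * c) *\<^sub>R (x + X x)" for x
    using c by (simp add: D_def X_def T.add T.scaleR R.add R.scaleR R(3) algebra_simps)
  have R_norm: "norm (R x) = norm x" for x
    by (simp add: norm_eq_sqrt_inner R(2,3))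
  have X_bound: "norm (X x) \<le> norm x / 4" for x
  proof -
    have K10: "norm (T y) \<le> (c / 10) * norm y" for y
    proof -
      have "norm y * K \<le> norm y * (c / 10)" using c by (intro mult_left_mono) auto
      then show ?thesis using K(2)[of y] by (simp add: mult.commute)
    qed
    have "norm (T (T x)) \<le> (c / 10) * ((c / 10) * norm x)"
      using K10[of "T x"] mult_left_mono[OF K10[of x], of "c / 10"] c by linarith
    then have 1: "norm ((1 / (c * c)) *\<^sub>R T (T x)) \<le> norm x / 100"
      using c by (simp add: field_simps)
    have "norm (T (R x) + R (T x)) \<le> (c / 10) * norm x + (c / 10) * norm x"
      using norm_triangle_ineq[of "T (R x)" "R (T x)"] K10[of "R x"] K10[of x] by (simp add: R_norm)
    then have 2: "norm ((1 / c) *\<^sub>R (T (R x) + R (T x))) \<le> norm x / 5"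
      using c by (simp only: norm_scaleR) (simp add: field_simps)
    have "norm (X x) \<le> norm ((1 / (c * c)) *\<^sub>R T (T x)) + norm ((1 / c) *\<^sub>R (T (R x) + R (T x)))"
      unfolding X_def by (rule norm_triangle_ineq)
    also have "\<dots> \<le> norm x / 100 + norm x / 5" using 1 2 by (rule add_mono)
    also have "\<dots> \<le> norm x / 4" using norm_ge_zero[of x] by simp
    finally show ?thesis .
  qed
  obtain P \<theta> where P1: "bounded_linear P" and \<theta>1: "bounded_linear \<theta>"
    and P2: "\<And>x y. P x \<bullet> y = x \<bullet> P y" and \<theta>2: "\<And>x y. \<theta> x \<bullet> y = x \<bullet> \<theta> y"
    and P3: "\<And>x. (c / 2) * (norm x)\<^sup>2 \<le> x \<bullet> P x" and \<theta>3: "\<And>x. \<theta> (\<theta> x) = x"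
    and P\<theta>: "\<And>x. P (\<theta> x) = D x" "\<And>x. \<theta> (P x) = D x"
    and P_comm: "\<And>A x. bounded_linear A \<Longrightarrow> (\<And>y. A (D (D y)) = D (D (A y))) \<Longrightarrow> A (P x) = P (A x)"
    by (fact polar_decomposition[OF D D_sym X X_bound c(1) DD])
  note P = P1 P2 P3 and \<theta> = \<theta>1 \<theta>2 \<theta>3
  interpret P: bounded_linear P by fact
  have DU: "D (U t x) = U (- t) (D x)" for t x
    by (simp add: D_def TU R(5) linear_add[OF bounded_linear.linear[OF U_linear]]
        linear_scale[OF bounded_linear.linear[OF U_linear]])
  have DI: "D (I x) = I (D x)" for x
    by (simp add: D_def TI R(4) linear_add[OF bounded_linear.linear[OF I_linear]]
        linear_scale[OF bounded_linear.linear[OF I_linear]])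
  \<comment> \<open>\<open>D\<close> reverses time, so \<open>D \<circ> D\<close> commutes with the
    group, and its square root inherits this.\<close>
  have PU: "P (U t x) = U t (P x)" for t x by (rule P_comm[symmetric]) (auto simp: U_linear DU)
  have PI: "P (I x) = I (P x)" for x by (rule P_comm[symmetric]) (auto simp: I_linear DI)
  have c2: "0 < c / 2" using c by simp
  have P_inj: "x = y" if "P x = P y" for x y
  proof -
    have "(c / 2) * (norm (x - y))\<^sup>2 \<le> 0" using P(3)[of "x - y"] that by (simp add: P.diff)
    then show ?thesis using c by (simp add: mult_le_0_iff)
  qed
  have \<theta>U: "\<theta> (U t x) = U (- t) (\<theta> x)" for t x by (rule P_inj) (simp add: P\<theta> PU DU)
  have \<theta>I: "\<theta> (I x) = I (\<theta> x)" for x by (rule P_inj) (simp add: P\<theta> PI DI)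
  have \<theta>_iso: "\<theta> x \<bullet> \<theta> y = x \<bullet> y" for x y by (simp add: \<theta>)
  obtain g h where g: "bounded_linear g" "bounded_linear h" "\<And>x. g (h x) = x" "\<And>x. h (g x) = x"
    "\<And>t x. g (U t x) = U t (g x)" "\<And>x. g (I x) = I (g x)" "g ` S = S" "\<And>x y. g x \<bullet> g y = x \<bullet> P y"
    by (fact causal_factorization[OF P(1,2) c2 P(3) PU PI])
  have g\<theta>: "g (\<theta> x) \<bullet> g (\<theta> y) = g x \<bullet> g y" for x y
    by (simp add: g(8) \<theta>(2) P\<theta>(1)) (simp add: \<theta>(3) flip: P\<theta>(2))
  have gB: "g x \<bullet> g (\<theta> y) = B x y" if "x \<in> S" "y \<in> S" for x y
  \<comment> \<open>Since \<open>P\<close> after \<theta> is \<open>D\<close>, the left side is the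
    form of \<open>D\<close>, and the summand from \<open>R\<close> vanishes on
    \<open>S\<close>.\<close>
  proof -
    have "g x \<bullet> g (\<theta> y) = T x \<bullet> y" using R(6)[OF that] by (simp add: g(8) P\<theta> D_def inner_add_right T_sym)
    then show ?thesis using that B(2)[OF that] by (simp add: T(2) F(2))
  qed
  show ?thesis by (rule that[OF g(1-7) \<theta>(1,3) \<theta>_iso \<theta>I \<theta>U g\<theta> gB])
qed

end

section \<open>The Hilbert space \<open>L\<^sup>2(\<real>)\<close>\<close>

lemma L2_cases:
  obtains f where "square_integrable f" "x = abs_L2 f"
  using Quotient3_rep_reflp[OF Quotient3_L2, of x] Quotient3_abs_rep[OF Quotient3_L2, of x]
  by metis

lemma abs_L2_eqI:
  "square_integrable f \<Longrightarrow> square_integrable g \<Longrightarrow> (AE x in lborel. f x = g x) \<Longrightarrow> abs_L2 f = abs_L2 g"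
  using Quotient3_rel[OF Quotient3_L2, of f g] by auto

lemma L2_abs_simps:
  assumes "square_integrable f" "square_integrable g"
  shows "abs_L2 f + abs_L2 g = abs_L2 (\<lambda>x. f x + g x)" "- abs_L2 f = abs_L2 (\<lambda>x. - f x)"
    "abs_L2 f - abs_L2 g = abs_L2 (\<lambda>x. f x - g x)"
    "L2_scale c (abs_L2 f) = abs_L2 (\<lambda>x. c * f x)" "L2_shift t (abs_L2 f) = abs_L2 (\<lambda>x. f (x - t))"
    "L2_ip (abs_L2 f) (abs_L2 g) = (LINT x|lborel. cnj (f x) * g x)"
    "vanishes_off_pos (abs_L2 f) \<longleftrightarrow> (AE x in lborel. x \<le> 0 \<longrightarrow> f x = 0)"
proof -
  have g: "square_integrable (\<lambda>x. - g x)"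
    using square_integrable_scale[OF assms(2), of "- 1"] by simp
  show "abs_L2 f + abs_L2 g = abs_L2 (\<lambda>x. f x + g x)" "- abs_L2 f = abs_L2 (\<lambda>x. - f x)"
    "abs_L2 f - abs_L2 g = abs_L2 (\<lambda>x. f x - g x)"
    "L2_scale c (abs_L2 f) = abs_L2 (\<lambda>x. c * f x)" "L2_shift t (abs_L2 f) = abs_L2 (\<lambda>x. f (x - t))"
    "L2_ip (abs_L2 f) (abs_L2 g) = (LINT x|lborel. cnj (f x) * g x)"
    "vanishes_off_pos (abs_L2 f) \<longleftrightarrow> (AE x in lborel. x \<le> 0 \<longrightarrow> f x = 0)"
    using assms g
    by (simp_all add: plus_L2.abs_eq uminus_L2.abs_eq minus_L2_def L2_scale.abs_eq L2_shift.abs_eq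
        L2_ip.abs_eq vanishes_off_pos.abs_eq not_less)
qed

lemma square_integrable_mult:
  assumes "square_integrable f" "square_integrable g"
  shows "integrable lborel (\<lambda>x. cnj (f x) * g x)"
proof -
  have [measurable]: "f \<in> borel_measurable lborel" "g \<in> borel_measurable lborel"
    using assms by (auto simp: square_integrable_def)
  have "cnj \<in> borel_measurable borel"
    by (intro borel_measurable_continuous_onI continuous_intros)
  note [measurable] = this
  have "integrable lborel (\<lambda>x. (cmod (f x))\<^sup>2 + (cmod (g x))\<^sup>2)"
    using assms by (auto simp: square_integrable_def)
  then show ?thesis
  proof (rule Bochner_Integration.integrable_bound)
    show "AE x in lborel. norm (cnj (f x) * g x) \<le> norm ((cmod (f x))\<^sup>2 + (cmod (g x))\<^sup>2)"
    proof (rule AE_I2)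
      fix x
      have "2 * (cmod (f x) * cmod (g x)) \<le> (cmod (f x))\<^sup>2 + (cmod (g x))\<^sup>2"
        using sum_squares_bound[of "cmod (f x)" "cmod (g x)"] by simp
      moreover have "0 \<le> cmod (f x) * cmod (g x)" by simp
      ultimately have "cmod (f x) * cmod (g x) \<le> (cmod (f x))\<^sup>2 + (cmod (g x))\<^sup>2" by linarith
      then show "norm (cnj (f x) * g x) \<le> norm ((cmod (f x))\<^sup>2 + (cmod (g x))\<^sup>2)"
        by (simp add: norm_mult)
    qed
  qed measurable
qed

lemma L2_ip_add_right: "L2_ip x (y + z) = L2_ip x y + L2_ip x z"
proof -
  obtain f g h where "square_integrable f" "x = abs_L2 f" "square_integrable g" "y = abs_L2 g"
    "square_integrable h" "z = abs_L2 h" by (metis L2_cases)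
  then show ?thesis
    by (simp add: L2_abs_simps square_integrable_add square_integrable_mult distrib_left)
qed

lemma L2_ip_scale_right: "L2_ip x (L2_scale c y) = c * L2_ip x y"
proof -
  obtain f g where "square_integrable f" "x = abs_L2 f" "square_integrable g" "y = abs_L2 g"
    by (metis L2_cases)
  then show ?thesis
    by (simp add: L2_abs_simps square_integrable_scale mult.left_commute)
qed

lemma L2_ip_commute: "L2_ip x y = cnj (L2_ip y x)"
proof -
  obtain f g where fg: "square_integrable f" "x = abs_L2 f" "square_integrable g" "y = abs_L2 g"
    by (metis L2_cases)
  have "cnj (LINT x|lborel. cnj (g x) * f x) = (LINT x|lborel. cnj (cnj (g x) * f x))"
    using square_integrable_mult[OF fg(3,1)]
    by (intro integral_bounded_linear[symmetric] bounded_linear_cnj)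
  then show ?thesis using fg by (simp add: L2_abs_simps mult.commute)
qed

lemma L2_ip_self:
  assumes "square_integrable f"
  shows "L2_ip (abs_L2 f) (abs_L2 f) = of_real (LINT x|lborel. (cmod (f x))\<^sup>2)"
proof -
  have "cnj z * z = of_real ((cmod z)\<^sup>2)" for z
    by (metis complex_norm_square mult.commute of_real_power)
  then show ?thesis using assms by (simp add: L2_abs_simps del: of_real_power)
qed

lemma L2_ip_definite:
  assumes "L2_ip x x = 0" shows "x = 0"
proof -
  obtain f where f: "square_integrable f" "x = abs_L2 f" by (rule L2_cases)
  then have "(LINT x|lborel. (cmod (f x))\<^sup>2) = 0" using assms by (simp add: L2_ip_self)
  then have "AE x in lborel. f x = 0"
    using f by (subst (asm) integral_nonneg_eq_0_iff_AE) (auto simp: square_integrable_def)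
  then have "abs_L2 f = abs_L2 (\<lambda>x. 0)"
    using f by (intro abs_L2_eqI square_integrable_zero)
  then show ?thesis using f by (simp add: zero_L2_def)
qed

section \<open>\<open>L2\<close> as a real Hilbert space\<close>

instantiation L2 :: real_vector
begin

definition "scaleR r x = L2_scale (complex_of_real r) x"

instance
proof
  interpret vector_space L2_scale by (rule vector_space_L2)
  fix x y z :: L2 and a b :: real
  show "a *\<^sub>R (x + y) = a *\<^sub>R x + a *\<^sub>R y" "(a + b) *\<^sub>R x = a *\<^sub>R x + b *\<^sub>R x" "a *\<^sub>R b *\<^sub>R x = (a * b) *\<^sub>R x"
    "1 *\<^sub>R x = x"
    by (simp_all add: scaleR_L2_def scale_right_distrib scale_left_distrib)
qed

end

instantiation L2 :: real_inner
begin

definition "inner x y = Re (L2_ip x y)"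
definition "norm (x :: L2) = sqrt (inner x x)"
definition "sgn (x :: L2) = x /\<^sub>R norm x"
definition "dist x y = norm (x - y :: L2)"
definition "uniformity = (INF e\<in>{0 <..}. principal {(x, y). dist (x :: L2) y < e})"
definition "open (U :: L2 set) \<longleftrightarrow> (\<forall>x\<in>U. eventually (\<lambda>(x', y). x' = x \<longrightarrow> y \<in> U) uniformity)"

instance
proof
  fix x y z :: L2 and a b :: real
  show "dist x y = norm (x - y)" by (rule dist_L2_def)
  show "sgn x = x /\<^sub>R norm x" by (rule sgn_L2_def)
  show "uniformity = (INF e\<in>{0 <..}. principal {(x, y). dist (x :: L2) y < e})" by (rule uniformity_L2_def)
  show "open U \<longleftrightarrow> (\<forall>x\<in>U. eventually (\<lambda>(x', y). x' = x \<longrightarrow> y \<in> U) uniformity)" for U :: "L2 set"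
    by (rule open_L2_def)
  show comm: "inner x y = inner y x" for x y :: L2
    using L2_ip_commute[of x y] by (simp add: inner_L2_def)
  show "inner (x + y) z = inner x z + inner y z"
    by (simp add: comm[of _ z]) (simp add: inner_L2_def L2_ip_add_right)
  show "inner (a *\<^sub>R x) y = a * inner x y"
    by (simp add: comm[of _ y]) (simp add: inner_L2_def scaleR_L2_def L2_ip_scale_right)
  have self: "\<exists>r\<ge>0. L2_ip x x = of_real r"
    by (rule L2_cases[of x]) (auto simp: L2_ip_self)
  show "0 \<le> inner x x" using self by (auto simp: inner_L2_def)
  show "inner x x = 0 \<longleftrightarrow> x = 0"
  proof
    assume "inner x x = 0"
    then show "x = 0" using self by (auto simp: inner_L2_def intro: L2_ip_definite)
  next
    assume "x = 0"
    then show "inner x x = 0" using L2_ip_add_right[of 0 0 0] by (simp add: inner_L2_def)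
  qed
  show "norm x = sqrt (inner x x)" by (rule norm_L2_def)
qed

end

lemma norm_abs_L2: "square_integrable f \<Longrightarrow> (norm (abs_L2 f))\<^sup>2 = (LINT x|lborel. (cmod (f x))\<^sup>2)"
  by (simp add: norm_L2_def inner_L2_def L2_ip_self)

lemma square_integrable_diff: "square_integrable f \<Longrightarrow> square_integrable g \<Longrightarrow> square_integrable (\<lambda>x. f x - g x)"
  using square_integrable_add[OF _ square_integrable_scale[of g "-1"], of f] by simp

lemma nn_integral_L2:
  "square_integrable f \<Longrightarrow> (\<integral>\<^sup>+x. ennreal ((cmod (f x))\<^sup>2) \<partial>lborel) = ennreal ((norm (abs_L2 f))\<^sup>2)"
  by (subst nn_integral_eq_integral) (auto simp: square_integrable_def norm_abs_L2[unfolded square_integrable_def])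

text \<open>Riesz-Fischer: rapid decay of the increments gives convergence almost everywhere, and
  Fatou's lemma identifies the pointwise limit as the limit in norm.\<close>

lemma L2_fast_Cauchy_convergent:
  fixes f :: "nat \<Rightarrow> real \<Rightarrow> complex"
  assumes f: "\<And>n. square_integrable (f n)"
    and fast: "\<And>m n. n \<le> m \<Longrightarrow> norm (abs_L2 (f m) - abs_L2 (f n)) \<le> (1 / 2) ^ n"
  shows "\<exists>g. square_integrable g \<and> (\<lambda>n. abs_L2 (f n)) \<longlonglongrightarrow> abs_L2 g"
proof -
  have m [measurable]: "f n \<in> borel_measurable lborel" for n using f by (simp add: square_integrable_def)
  have sq: "square_integrable (\<lambda>x. f m x - f n x)" for m n
    using f f by (rule square_integrable_diff)
  have dist_eq: "(\<integral>\<^sup>+x. ennreal ((cmod (f m x - f n x))\<^sup>2) \<partial>lborel) = ennreal ((norm (abs_L2 (f m) - abs_L2 (f n)))\<^sup>2)" for m n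
    using nn_integral_L2[OF sq[of m n]] f by (simp add: L2_abs_simps)
  have bound: "(\<integral>\<^sup>+x. ennreal ((cmod (f m x - f n x))\<^sup>2) \<partial>lborel) \<le> ennreal ((1 / 4) ^ n)" if "n \<le> m" for m n
  proof -
    have "(norm (abs_L2 (f m) - abs_L2 (f n)))\<^sup>2 \<le> ((1 / 2) ^ n)\<^sup>2"
      using fast[OF that] by (intro power_mono) auto
    then show ?thesis unfolding dist_eq by (simp add: power2_eq_square flip: power_mult_distrib)
  qed
  \<comment> \<open>With the weight 2^n the integrals are at most 2^n / 4^n and still summable,
    while boundedness of \<open>d n x\<close> in \<open>n\<close> makes the increments at
    \<open>x\<close> decay geometrically.\<close>
  define d where "d = (\<lambda>n x. 2 ^ n * (cmod (f (Suc n) x - f n x))\<^sup>2)"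
  have [measurable]: "d n \<in> borel_measurable lborel" for n unfolding d_def by measurable
  have "(\<integral>\<^sup>+x. (\<Sum>n. ennreal (d n x)) \<partial>lborel) = (\<Sum>n. \<integral>\<^sup>+x. ennreal (d n x) \<partial>lborel)"
    by (intro nn_integral_suminf) measurable
  also have "\<dots> \<le> (\<Sum>n. ennreal ((1 / 2) ^ n))"
  proof (intro suminf_le summableI)
    fix n
    have "(\<integral>\<^sup>+x. ennreal (d n x) \<partial>lborel) = ennreal (2 ^ n) * (\<integral>\<^sup>+x. ennreal ((cmod (f (Suc n) x - f n x))\<^sup>2) \<partial>lborel)"
      unfolding d_def by (subst nn_integral_cmult[symmetric]) (auto simp: ennreal_mult)
    also have "\<dots> \<le> ennreal (2 ^ n) * ennreal ((1 / 4) ^ n)"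
      by (intro mult_left_mono bound) auto
    also have "\<dots> = ennreal ((1 / 2) ^ n)"
      by (simp add: ennreal_mult[symmetric] power_mult_distrib[symmetric])
    finally show "(\<integral>\<^sup>+x. ennreal (d n x) \<partial>lborel) \<le> ennreal ((1 / 2) ^ n)" .
  qed
  also have "\<dots> = ennreal (\<Sum>n. (1 / 2) ^ n)"
    by (intro suminf_ennreal2 summable_geometric) auto
  also have "\<dots> < \<infinity>" by simp
  finally have "AE x in lborel. (\<Sum>n. ennreal (d n x)) \<noteq> \<infinity>"
    by (intro nn_integral_PInf_AE) auto
  then have conv: "AE x in lborel. convergent (\<lambda>n. f n x)"
  proof (rule eventually_mono)
    fix x assume "(\<Sum>n. ennreal (d n x)) \<noteq> \<infinity>"
    then have "summable (\<lambda>n. d n x)"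
      by (intro summable_suminf_not_top) (auto simp: d_def)
    then have "(\<lambda>n. d n x) \<longlonglongrightarrow> 0" by (rule summable_LIMSEQ_zero)
    then have "Bseq (\<lambda>n. d n x)" using convergentI convergent_imp_Bseq by blast
    then obtain C where C: "C > 0" "\<And>n. norm (d n x) \<le> C" by (auto elim: BseqE)
    have le: "norm (f (Suc n) x - f n x) \<le> sqrt C * (1 / sqrt 2) ^ n" for n
    proof (rule power2_le_imp_le)
      have "2 ^ n * (cmod (f (Suc n) x - f n x))\<^sup>2 \<le> C" using C(2)[of n] by (simp add: d_def abs_le_iff)
      then have "(cmod (f (Suc n) x - f n x))\<^sup>2 \<le> C / 2 ^ n" by (simp add: field_simps)
      also have "\<dots> = (sqrt C * (1 / sqrt 2) ^ n)\<^sup>2"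
        using C(1) by (simp add: power_mult_distrib power_divide power_mult[symmetric] mult.commute[of n])
          (simp add: power_mult)
      finally show "(norm (f (Suc n) x - f n x))\<^sup>2 \<le> (sqrt C * (1 / sqrt 2) ^ n)\<^sup>2" .
    qed (use C in auto)
    have "summable (\<lambda>n. sqrt C * (1 / sqrt 2) ^ n)"
      by (intro summable_mult summable_geometric) auto
    then have "summable (\<lambda>n. f (Suc n) x - f n x)"
      by (rule summable_comparison_test'[of _ 0]) (rule le)
    then have "convergent (\<lambda>n. \<Sum>k<n. f (Suc k) x - f k x)" by (simp add: summable_iff_convergent)
    then have "convergent (\<lambda>n. f n x - f 0 x)" by (simp add: sum_lessThan_telescope[of "\<lambda>k. f k x"])
    then show "convergent (\<lambda>n. f n x)" by (simp add: convergent_diff_const_right_iff)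
  qed
  define g where "g = (\<lambda>x. lim (\<lambda>n. f n x))"
  have [measurable]: "g \<in> borel_measurable lborel"
    unfolding g_def by measurable
  have lim: "AE x in lborel. (\<lambda>n. f n x) \<longlonglongrightarrow> g x"
    using conv by eventually_elim (simp add: g_def convergent_LIMSEQ_iff)
  have Fatou: "(\<integral>\<^sup>+x. ennreal ((cmod (g x - f n x))\<^sup>2) \<partial>lborel) \<le> ennreal ((1 / 4) ^ n)" for n
  proof -
    have "(\<integral>\<^sup>+x. ennreal ((cmod (g x - f n x))\<^sup>2) \<partial>lborel) =
        (\<integral>\<^sup>+x. liminf (\<lambda>m. ennreal ((cmod (f m x - f n x))\<^sup>2)) \<partial>lborel)"
    proof (rule nn_integral_cong_AE)
      show "AE x in lborel. ennreal ((cmod (g x - f n x))\<^sup>2) = liminf (\<lambda>m. ennreal ((cmod (f m x - f n x))\<^sup>2))"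
        using lim
      proof eventually_elim
        case (elim x)
        then have "(\<lambda>m. ennreal ((cmod (f m x - f n x))\<^sup>2)) \<longlonglongrightarrow> ennreal ((cmod (g x - f n x))\<^sup>2)"
          by (intro tendsto_intros tendsto_ennrealI)
        then show ?case by (intro lim_imp_Liminf[symmetric]) auto
      qed
    qed
    also have "\<dots> \<le> liminf (\<lambda>m. \<integral>\<^sup>+x. ennreal ((cmod (f m x - f n x))\<^sup>2) \<partial>lborel)"
      by (intro nn_integral_liminf) measurable
    also have "\<dots> \<le> liminf (\<lambda>m. ennreal ((1 / 4) ^ n))"
      by (intro Liminf_mono) (auto simp: eventually_sequentially intro!: exI[of _ n] bound)
    also have "\<dots> = ennreal ((1 / 4) ^ n)" by (intro lim_imp_Liminf) auto
    finally show ?thesis .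
  qed
  have sqg: "square_integrable (\<lambda>x. g x - f n x)" for n
    using Fatou[of n] by (auto simp: square_integrable_def integrable_iff_bounded intro: le_less_trans)
  have "square_integrable (\<lambda>x. (g x - f 0 x) + f 0 x)" by (rule square_integrable_add[OF sqg f])
  then have g: "square_integrable g" by simp
  have "norm (abs_L2 (f n) - abs_L2 g) \<le> (1 / 2) ^ n" for n
  proof (rule power2_le_imp_le)
    have "ennreal ((norm (abs_L2 (\<lambda>x. g x - f n x)))\<^sup>2) \<le> ennreal ((1 / 4) ^ n)"
      using Fatou[of n] by (simp add: nn_integral_L2[OF sqg])
    then have "(norm (abs_L2 g - abs_L2 (f n)))\<^sup>2 \<le> (1 / 4) ^ n"
      using g f by (simp add: L2_abs_simps)
    then show "(norm (abs_L2 (f n) - abs_L2 g))\<^sup>2 \<le> ((1 / 2) ^ n)\<^sup>2"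
      by (simp add: norm_minus_commute power2_eq_square flip: power_mult_distrib)
  qed auto
  then have "(\<lambda>n. abs_L2 (f n) - abs_L2 g) \<longlonglongrightarrow> 0"
    by (intro Lim_null_comparison[OF _ LIMSEQ_power_zero[of "1 / 2 :: real"]]) auto
  then show ?thesis using g LIM_zero_iff by blast
qed

instance L2 :: banach
proof
  fix X :: "nat \<Rightarrow> L2" assume X: "Cauchy X"
  have "\<exists>N. \<forall>m\<ge>N. \<forall>n\<ge>N. norm (X m - X n) < (1 / 2) ^ k" for k
    using CauchyD[OF X, of "(1 / 2) ^ k"] by simp
  then obtain N where N: "\<And>k m n. N k \<le> m \<Longrightarrow> N k \<le> n \<Longrightarrow> norm (X m - X n) < (1 / 2) ^ k" by metis
  \<comment> \<open>The sum makes \<open>r k\<close> exceed all thresholds up to \<open>k\<close>;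
    the summand \<open>k\<close> makes it strictly increasing.\<close>
  define r where "r = (\<lambda>k. k + (\<Sum>i\<le>k. N i))"
  have r: "strict_mono r" by (rule strict_mono_Suc_iff[THEN iffD2]) (simp add: r_def)
  have rN: "N k \<le> r m" if "k \<le> m" for k m
  proof -
    have "N k \<le> (\<Sum>i\<le>m. N i)" using that by (intro member_le_sum) auto
    then show ?thesis by (simp add: r_def)
  qed
  have "\<exists>f. square_integrable f \<and> X n = abs_L2 f" for n by (metis L2_cases)
  then obtain f where f: "\<And>n. square_integrable (f n)" "\<And>n. X n = abs_L2 (f n)" by metis
  have "norm (abs_L2 (f (r m)) - abs_L2 (f (r n))) \<le> (1 / 2) ^ n" if "n \<le> m" for m n
    using N[of n "r m" "r n"] rN that by (simp flip: f(2))
  then obtain g where "(\<lambda>n. abs_L2 (f (r n))) \<longlonglongrightarrow> abs_L2 g"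
    using L2_fast_Cauchy_convergent[of "\<lambda>n. f (r n)"] f(1) by blast
  then have "(X \<circ> r) \<longlonglongrightarrow> abs_L2 g" by (simp add: comp_def f(2))
  then have "X \<longlonglongrightarrow> abs_L2 g" using Cauchy_converges_subseq[OF X r] by blast
  then show "convergent X" by (rule convergentI)
qed

text \<open>\<open>ennreal\<close> cuts off negative values, so the two densities are the positive
  and the negative part of \<open>h\<close>. The measures agree and are finite on half-lines, hence
  coincide, and densities are unique almost everywhere; but a number whose positive and negative
  parts agree is 0.\<close>

lemma AE_zero_halflines:
  fixes h :: "real \<Rightarrow> real"
  assumes [measurable]: "h \<in> borel_measurable lborel"
    and int: "\<And>t. integrable lborel (\<lambda>x. indicator {t<..} x * h x)"
    and zero: "\<And>t. (LINT x|lborel. indicator {t<..} x * h x) = 0"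
  shows "AE x in lborel. h x = 0"
proof -
  let ?M = "density lborel (\<lambda>x. ennreal (h x))" and ?N = "density lborel (\<lambda>x. ennreal (- h x))"
  have pos: "emeasure ?M {t<..} = (\<integral>\<^sup>+x. ennreal (indicator {t<..} x * h x) \<partial>lborel)" for t
    by (auto simp: emeasure_density intro!: nn_integral_cong split: split_indicator)
  have neg: "emeasure ?N {t<..} = (\<integral>\<^sup>+x. ennreal (- (indicator {t<..} x * h x)) \<partial>lborel)" for t
    by (auto simp: emeasure_density intro!: nn_integral_cong split: split_indicator)
  have fin: "emeasure ?M {t<..} < \<infinity>" "emeasure ?N {t<..} < \<infinity>" for t
    using int[of t] unfolding pos neg by (auto simp: real_integrable_def top.not_eq_extremum)
  have "enn2real (emeasure ?M {t<..}) = enn2real (emeasure ?N {t<..})" for t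
    using zero[of t] real_lebesgue_integral_def[OF int[of t]] by (simp add: pos neg)
  then have "emeasure ?M {t<..} = emeasure ?N {t<..}" for t
    using fin[of t] by (metis ennreal_enn2real infinity_ennreal_def)
  then have "?M = ?N"
    using fin by (intro measure_eqI_lessThan) auto
  then have "AE x in lborel. ennreal (h x) = ennreal (- h x)"
    by (intro sigma_finite_measure.density_unique[OF lborel.sigma_finite_measure_axioms]) auto
  then show ?thesis
    by eventually_elim (metis ennreal_neg ennreal_eq_0_iff le_minus_iff linorder_linear minus_zero neg_le_0_iff_le order_antisym)
qed

section \<open>Reflection, translations and multiplication by \<i> on \<open>L2\<close>\<close>

lemma square_integrable_flip:
  assumes "square_integrable f" shows "square_integrable (\<lambda>x. f (- x))"
proof -
  have [measurable]: "f \<in> borel_measurable lborel"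
    using assms by (auto simp: square_integrable_def)
  have "integrable lborel (\<lambda>x. (cmod (f (0 + (- 1) * x)))\<^sup>2)"
    using assms by (intro lborel_integrable_real_affine) (auto simp: square_integrable_def)
  then show ?thesis by (simp add: square_integrable_def)
qed

lemma AE_lborel_flip:
  assumes "AE x::real in lborel. P x" shows "AE x in lborel. P (- x)"
proof -
  obtain N where N: "N \<in> null_sets lborel" "{x. \<not> P x} \<subseteq> N"
  proof -
    obtain N where "\<And>x. x \<in> space lborel - N \<Longrightarrow> P x" "N \<in> null_sets lborel"
      using AE_E3[OF assms] by auto
    then show ?thesis using that[of N] by auto
  qed
  have "AE x in distr lborel borel uminus. x \<notin> N"
    using AE_not_in[OF N(1)] by (simp only: lborel_distr_uminus)
  then have "AE x in lborel. - x \<notin> N"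
    by (rule AE_distrD[rotated]) simp
  then show ?thesis using N(2) by (auto elim!: eventually_mono)
qed

lift_definition L2_flip :: "L2 \<Rightarrow> L2" is "\<lambda>f x. f (- x)"
  using square_integrable_flip AE_lborel_flip by blast

abbreviation L2_i :: "L2 \<Rightarrow> L2" where "L2_i \<equiv> L2_scale \<i>"

lemma L2_flip_abs: "square_integrable f \<Longrightarrow> L2_flip (abs_L2 f) = abs_L2 (\<lambda>x. f (- x))"
  by (simp add: L2_flip.abs_eq)

lemma L2_ip_scale_left: "L2_ip (L2_scale c x) y = cnj c * L2_ip x y"
  using L2_ip_commute[of "L2_scale c x" y] L2_ip_commute[of x y] by (simp add: L2_ip_scale_right)

text \<open>Antilinearity in the first argument makes Re <ix, y> the imaginary part of <x, y>. Real
  identities for operators commuting with \<open>L2_i\<close> thereby become complex ones.\<close>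

lemma L2_ip_inner: "L2_ip x y = Complex (x \<bullet> y) (L2_i x \<bullet> y)"
  by (simp add: inner_L2_def L2_ip_scale_left complex_eq_iff)

lemma L2_inner_abs:
  "square_integrable f \<Longrightarrow> square_integrable g \<Longrightarrow> abs_L2 f \<bullet> abs_L2 g = Re (LINT x|lborel. cnj (f x) * g x)"
  by (simp add: inner_L2_def L2_abs_simps)

lemma L2_scale_eq: "L2_scale c x = Re c *\<^sub>R x + Im c *\<^sub>R L2_i x"
proof -
  interpret vector_space L2_scale by (rule vector_space_L2)
  show ?thesis
    by (simp add: scaleR_L2_def scale_left_distrib[symmetric]) (simp add: complex_eq mult.commute)
qed

lemma L2_norm_linear_isometry:
  assumes "\<And>x y. A (x + y) = A x + A y" "\<And>c x. A (L2_scale c x) = L2_scale c (A x)"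
    "\<And>x y. L2_ip (A x) (A y) = L2_ip x y"
  shows "bounded_linear A" "A x \<bullet> A y = x \<bullet> y"
proof -
  show *: "A x \<bullet> A y = x \<bullet> y" for x y using assms(3) by (simp add: inner_L2_def)
  show "bounded_linear A"
    by (rule bounded_linear_intro[of _ 1]) (auto simp: assms scaleR_L2_def norm_eq_sqrt_inner *)
qed

lemma L2_i_isometry: "bounded_linear L2_i" "L2_i x \<bullet> L2_i y = x \<bullet> y" "L2_i (L2_i x) = - x"
proof -
  interpret vector_space L2_scale by (rule vector_space_L2)
  show "bounded_linear L2_i" "L2_i x \<bullet> L2_i y = x \<bullet> y"
    by (rule L2_norm_linear_isometry;
        simp add: scale_right_distrib L2_ip_scale_left L2_ip_scale_right mult.commute)+
  show "L2_i (L2_i x) = - x" by simp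
qed

lemma L2_shift_add: "L2_shift t (x + y) = L2_shift t x + L2_shift t y"
  by (rule L2_cases[of x], rule L2_cases[of y])
    (simp add: L2_abs_simps square_integrable_add square_integrable_shift)

lemma L2_shift_scale: "L2_shift t (L2_scale c x) = L2_scale c (L2_shift t x)"
  by (rule L2_cases[of x]) (simp add: L2_abs_simps square_integrable_scale square_integrable_shift)

lemma L2_shift_ip: "L2_ip (L2_shift t x) (L2_shift t y) = L2_ip x y"
proof (rule L2_cases[of x], rule L2_cases[of y])
  fix f g assume fg: "square_integrable f" "x = abs_L2 f" "square_integrable g" "y = abs_L2 g"
  have "(LINT x|lborel. cnj (f x) * g x) = (LINT x|lborel. cnj (f (- t + 1 * x)) * g (- t + 1 * x))"
    by (subst lborel_integral_real_affine[of 1 _ "- t"]) auto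
  then show ?thesis using fg by (simp add: L2_abs_simps square_integrable_shift)
qed

lemma L2_shift_zero: "L2_shift 0 x = x"
  by (rule L2_cases[of x]) (simp add: L2_abs_simps)

lemma L2_shift_shift: "L2_shift (s + t) x = L2_shift s (L2_shift t x)"
  by (rule L2_cases[of x]) (simp add: L2_abs_simps square_integrable_shift algebra_simps)

lemma L2_shift_isometry: "bounded_linear (L2_shift t)" "L2_shift t x \<bullet> L2_shift t y = x \<bullet> y"
  by (rule L2_norm_linear_isometry; simp add: L2_shift_add L2_shift_scale L2_shift_ip)+

lemma L2_plus_abs: "square_integrable f \<Longrightarrow> abs_L2 f \<in> L2_plus \<longleftrightarrow> (AE x in lborel. x \<le> 0 \<longrightarrow> f x = 0)"
  by (simp add: L2_plus_def L2_abs_simps)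

lemma L2_plus_subspace: "subspace L2_plus" "x \<in> L2_plus \<Longrightarrow> L2_scale c x \<in> L2_plus"
proof -
  have scale: "L2_scale c x \<in> L2_plus" if "x \<in> L2_plus" for c x
    by (rule L2_cases[of x]) (use that in \<open>auto simp: L2_abs_simps L2_plus_abs square_integrable_scale elim: eventually_mono\<close>)
  moreover have "x + y \<in> L2_plus" if "x \<in> L2_plus" "y \<in> L2_plus" for x y
  proof (rule L2_cases[of x], rule L2_cases[of y])
    fix f g assume fg: "square_integrable f" "x = abs_L2 f" "square_integrable g" "y = abs_L2 g"
    then have "AE x in lborel. x \<le> 0 \<longrightarrow> f x = 0" "AE x in lborel. x \<le> 0 \<longrightarrow> g x = 0"
      using that by (simp_all add: L2_plus_abs)
    then have "AE x in lborel. x \<le> 0 \<longrightarrow> f x + g x = 0" by eventually_elim simp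
    then show ?thesis using fg by (simp add: L2_abs_simps L2_plus_abs square_integrable_add)
  qed
  moreover have "0 \<in> L2_plus" by (simp add: zero_L2_def L2_plus_abs square_integrable_zero)
  ultimately show "subspace L2_plus" "x \<in> L2_plus \<Longrightarrow> L2_scale c x \<in> L2_plus"
    by (auto simp: subspace_def scaleR_L2_def)
qed

lemma L2_plus_shift: "x \<in> L2_plus \<Longrightarrow> 0 \<le> t \<Longrightarrow> L2_shift t x \<in> L2_plus"
proof (rule L2_cases[of x])
  fix f assume f: "x \<in> L2_plus" "0 \<le> t" "square_integrable f" "x = abs_L2 f"
  then have "AE x in lborel. x - t \<le> 0 \<longrightarrow> f (x - t) = 0"
    by (intro AE_lborel_shift) (simp add: L2_plus_abs)
  then have "AE x in lborel. x \<le> 0 \<longrightarrow> f (x - t) = 0" using f(2) by (auto elim!: eventually_mono)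
  then show ?thesis using f by (simp add: L2_abs_simps L2_plus_abs square_integrable_shift)
qed

lemma L2_flip_linear:
  "L2_flip (x + y) = L2_flip x + L2_flip y" "L2_flip (L2_scale c x) = L2_scale c (L2_flip x)"
  "L2_flip (L2_flip x) = x" "L2_flip (L2_shift t x) = L2_shift (- t) (L2_flip x)"
proof -
  obtain f g where "square_integrable f" "x = abs_L2 f" "square_integrable g" "y = abs_L2 g" by (metis L2_cases)
  then show "L2_flip (x + y) = L2_flip x + L2_flip y" "L2_flip (L2_scale c x) = L2_scale c (L2_flip x)"
    "L2_flip (L2_flip x) = x" "L2_flip (L2_shift t x) = L2_shift (- t) (L2_flip x)"
    by (simp_all add: L2_abs_simps L2_flip_abs square_integrable_flip square_integrable_add square_integrable_scale
        square_integrable_shift square_integrable_flip[OF square_integrable_shift] square_integrable_shift[of "\<lambda>x. f (- x)" "- t"] minus_diff_commute[of t])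
qed

lemma L2_flip_ip: "L2_ip (L2_flip x) y = L2_ip x (L2_flip y)"
proof (rule L2_cases[of x], rule L2_cases[of y])
  fix f g assume fg: "square_integrable f" "x = abs_L2 f" "square_integrable g" "y = abs_L2 g"
  have "(LINT x|lborel. cnj (f x) * g (- x)) = (LINT x|lborel. cnj (f (0 + (- 1) * x)) * g (- (0 + (- 1) * x)))"
    by (subst lborel_integral_real_affine[of "- 1" _ 0]) auto
  then show ?thesis using fg by (simp add: L2_abs_simps L2_flip_abs square_integrable_flip)
qed

lemma L2_flip_isometry: "bounded_linear L2_flip" "L2_flip x \<bullet> y = x \<bullet> L2_flip y"
proof -
  show "bounded_linear L2_flip"
    by (rule L2_norm_linear_isometry) (simp_all add: L2_flip_linear L2_flip_ip)
  show "L2_flip x \<bullet> y = x \<bullet> L2_flip y" by (simp add: inner_L2_def L2_flip_ip)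
qed

lemma L2_flip_orthogonal: "x \<in> L2_plus \<Longrightarrow> y \<in> L2_plus \<Longrightarrow> x \<bullet> L2_flip y = 0"
proof (rule L2_cases[of x], rule L2_cases[of y])
  fix f g assume fg: "x \<in> L2_plus" "y \<in> L2_plus" "square_integrable f" "x = abs_L2 f" "square_integrable g" "y = abs_L2 g"
  have "AE x in lborel. - x \<le> 0 \<longrightarrow> g (- x) = 0"
    using fg by (intro AE_lborel_flip) (simp add: L2_plus_abs)
  moreover have "AE x in lborel. x \<le> 0 \<longrightarrow> f x = 0" using fg by (simp add: L2_plus_abs)
  ultimately have "AE x in lborel. cnj (f x) * g (- x) = 0" by eventually_elim auto
  then have "(LINT x|lborel. cnj (f x) * g (- x)) = 0" by (rule integral_eq_zero_AE)
  then show ?thesis using fg by (simp add: L2_flip_abs L2_inner_abs square_integrable_flip)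
qed

section \<open>The exponential vector: norm, eigenvalue equation, cyclicity\<close>

definition exp_fun :: "real \<Rightarrow> complex" where
  "exp_fun x = complex_of_real (indicator {0<..} x * (sqrt 2 * exp (- x)))"

lemma exp_fun_measurable [measurable]: "exp_fun \<in> borel_measurable lborel"
  unfolding exp_fun_def by measurable

lemma exp_fun_integral: "has_bochner_integral lborel (\<lambda>x. (cmod (exp_fun x))\<^sup>2) 1"
proof (rule has_bochner_integral_nn_integral)
  have "filterlim (\<lambda>x::real. - 2 * x) at_bot at_top"
    by (rule filterlim_tendsto_neg_mult_at_bot[OF tendsto_const _ filterlim_ident]) simp
  then have "((\<lambda>x::real. exp (- 2 * x)) \<longlongrightarrow> 0) at_top"
    by (rule filterlim_compose[OF exp_at_bot])
  then have lim: "((\<lambda>x::real. - exp (- 2 * x)) \<longlongrightarrow> 0) at_top"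
    using tendsto_minus by fastforce
  have "(\<integral>\<^sup>+x. ennreal ((cmod (exp_fun x))\<^sup>2) \<partial>lborel) = (\<integral>\<^sup>+x. ennreal (2 * exp (- 2 * x)) * indicator {0..} x \<partial>lborel)"
  proof (rule nn_integral_cong_AE)
    have "AE x in lborel. x \<noteq> (0::real)" by (rule AE_lborel_singleton)
    then show "AE x in lborel. ennreal ((cmod (exp_fun x))\<^sup>2) = ennreal (2 * exp (- 2 * x)) * indicator {0..} x"
    proof eventually_elim
      case (elim x)
      have "(sqrt 2 * exp (- x))\<^sup>2 = 2 * exp (- 2 * x)"
        by (simp add: power_mult_distrib exp_double[symmetric])
      then show ?case using elim
        by (auto simp: exp_fun_def norm_mult power_mult_distrib split: split_indicator)
    qed
  qed
  also have "\<dots> = ennreal (0 - (- exp (- 2 * 0)))"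
    by (rule nn_integral_FTC_atLeast[OF _ _ _ lim]) (auto intro!: derivative_eq_intros)
  finally show "(\<integral>\<^sup>+x. ennreal ((cmod (exp_fun x))\<^sup>2) \<partial>lborel) = ennreal 1" by simp
qed auto

lemma exp_fun_square_integrable: "square_integrable exp_fun"
  using exp_fun_integral by (auto simp: square_integrable_def has_bochner_integral_iff)

definition L2_exp :: L2 where "L2_exp = abs_L2 exp_fun"

lemma L2_exp_norm: "norm L2_exp = 1"
  using norm_abs_L2[OF exp_fun_square_integrable] exp_fun_integral norm_ge_zero[of "abs_L2 exp_fun"]
  by (simp add: L2_exp_def has_bochner_integral_iff power2_eq_1_iff del: norm_ge_zero)

lemma L2_exp_plus: "L2_exp \<in> L2_plus"
  by (simp add: L2_exp_def L2_plus_abs exp_fun_square_integrable exp_fun_def)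

text \<open>The translation moves to the exponential, and \<open>exp_fun (x + t)\<close> equals
  \<open>exp (- t) * exp_fun x\<close> for positive \<open>x\<close>, which is where the other
  factor lives.\<close>

lemma L2_exp_eigen:
  assumes "0 \<le> t" "x \<in> L2_plus"
  shows "L2_shift t x \<bullet> L2_exp = exp (- t) * (x \<bullet> L2_exp)"
proof (rule L2_cases[of x])
  fix f assume f: "square_integrable f" "x = abs_L2 f"
  have [measurable]: "f \<in> borel_measurable lborel" using f by (simp add: square_integrable_def)
  have "cnj \<in> borel_measurable borel"
    by (intro borel_measurable_continuous_onI continuous_intros)
  note [measurable] = this
  have "L2_shift t x \<bullet> L2_exp = x \<bullet> L2_shift (- t) L2_exp"
    using L2_shift_isometry(2)[of "- t" "L2_shift t x" L2_exp] by (simp add: L2_shift_zero flip: L2_shift_shift)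
  also have "\<dots> = Re (LINT x|lborel. cnj (f x) * exp_fun (x + t))"
    using f square_integrable_shift[OF exp_fun_square_integrable, of "- t"]
    by (simp add: L2_exp_def L2_abs_simps exp_fun_square_integrable L2_inner_abs)
  also have "(LINT x|lborel. cnj (f x) * exp_fun (x + t)) = (LINT x|lborel. exp (- t) * (cnj (f x) * exp_fun x))"
  proof (rule integral_cong_AE)
    have "AE x in lborel. x \<le> 0 \<longrightarrow> f x = 0" using f assms(2) by (simp add: L2_plus_abs)
    then show "AE x in lborel. cnj (f x) * exp_fun (x + t) = exp (- t) * (cnj (f x) * exp_fun x)"
    proof eventually_elim
      case (elim x)
      have "exp (- (x + t)) = exp (- t) * exp (- x)" by (simp flip: exp_add)
      then show ?case using elim assms(1)
        by (cases "x \<le> 0") (auto simp: exp_fun_def simp del: minus_add_distrib)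
    qed
  qed measurable
  also have "Re \<dots> = exp (- t) * (x \<bullet> L2_exp)"
    using f by (simp add: L2_exp_def L2_inner_abs exp_fun_square_integrable)
  finally show ?thesis .
qed

text \<open>Orthogonality to all translates says that exp (-x) times the conjugate of
  \<open>f\<close> has integral 0 over every half-line.\<close>

lemma L2_exp_cyclic:
  assumes "\<And>t. x \<bullet> L2_shift t L2_exp = 0" "\<And>t. x \<bullet> L2_i (L2_shift t L2_exp) = 0"
  shows "x = 0"
proof (rule L2_cases[of x])
  fix f assume f: "square_integrable f" "x = abs_L2 f"
  have [measurable]: "f \<in> borel_measurable lborel" using f by (simp add: square_integrable_def)
  have ip: "L2_ip x (L2_shift t L2_exp) = 0" for t
    using assms(1)[of t] assms(2)[of t] by (simp add: inner_L2_def L2_ip_scale_right complex_eq_iff)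
  have sh: "square_integrable (\<lambda>x. exp_fun (x - t))" for t
    using exp_fun_square_integrable by (rule square_integrable_shift)
  have int: "integrable lborel (\<lambda>x. cnj (f x) * exp_fun (x - t))" for t
    by (rule square_integrable_mult[OF f(1) sh])
  have zero: "(LINT x|lborel. cnj (f x) * exp_fun (x - t)) = 0" for t
    using ip[of t] f by (simp add: L2_exp_def L2_abs_simps exp_fun_square_integrable sh)
  \<comment> \<open>Cancels the factor sqrt 2 exp t of the translate, so that \<open>t\<close>
    remains only in the indicator function.\<close>
  define k where "k = (\<lambda>t. complex_of_real (exp (- t) / sqrt 2))"
  have k: "k t * (cnj (f x) * exp_fun (x - t)) = indicator {t<..} x * (complex_of_real (exp (- x)) * cnj (f x))" for t x
  proof -
    have "exp (- t) / sqrt 2 * (sqrt 2 * exp (- (x - t))) = exp (- x)" by (simp flip: exp_add)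
    then have "k t * complex_of_real (sqrt 2 * exp (- (x - t))) = complex_of_real (exp (- x))"
      unfolding k_def of_real_mult[symmetric] by simp
    moreover have "exp_fun (x - t) = indicator {t<..} x * complex_of_real (sqrt 2 * exp (- (x - t)))"
      by (simp add: exp_fun_def indicator_def)
    ultimately show ?thesis by (cases "t < x") (simp_all add: mult.left_commute[of _ "cnj (f x)"] mult.commute[of _ "cnj (f x)"])
  qed
  have int': "integrable lborel (\<lambda>x. indicator {t<..} x * (complex_of_real (exp (- x)) * cnj (f x)))" for t
    using integrable_mult_right[OF int[of t], of "k t"] by (simp add: k)
  have zero': "(LINT x|lborel. indicator {t<..} x * (complex_of_real (exp (- x)) * cnj (f x))) = 0" for t
    using integral_mult_right_zero[of lborel "k t" "\<lambda>x. cnj (f x) * exp_fun (x - t)"] zero[of t] by (simp add: k)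
  have parts: "Re (indicator {t<..} x * (complex_of_real (exp (- x)) * cnj (f x))) = indicator {t<..} x * (exp (- x) * Re (f x))"
    "Im (indicator {t<..} x * (complex_of_real (exp (- x)) * cnj (f x))) = indicator {t<..} x * (exp (- x) * - Im (f x))" for t x
    by (simp_all split: split_indicator)
  have "AE x in lborel. exp (- x) * Re (f x) = 0"
  proof (rule AE_zero_halflines)
    show "integrable lborel (\<lambda>x. indicator {t<..} x * (exp (- x) * Re (f x)))" for t
      using integrable_Re[OF int'[of t]] by (simp only: parts)
    show "(LINT x|lborel. indicator {t<..} x * (exp (- x) * Re (f x))) = 0" for t
      using integral_Re[OF int'[of t]] unfolding parts zero' by simp
  qed measurable
  moreover have "AE x in lborel. exp (- x) * - Im (f x) = 0"
  proof (rule AE_zero_halflines)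
    show "integrable lborel (\<lambda>x. indicator {t<..} x * (exp (- x) * - Im (f x)))" for t
      using integrable_Im[OF int'[of t]] by (simp only: parts)
    show "(LINT x|lborel. indicator {t<..} x * (exp (- x) * - Im (f x))) = 0" for t
      using integral_Im[OF int'[of t]] unfolding parts zero' by simp
  qed measurable
  ultimately have "AE x in lborel. f x = 0" by eventually_elim (simp add: complex_eq_iff)
  then show ?thesis
    using f abs_L2_eqI[OF f(1) square_integrable_zero] by (simp add: zero_L2_def)
qed

section \<open>Transfer to the abstract representation\<close>

text \<open>The union of the translates contains the orbit of the exponential vector, so its
  orthogonal complement is trivial. It is a subspace because any two translates lie in the one for
  the smaller time.\<close>

lemma L2_shifts_dense: "closure (\<Union>t. L2_shift t ` L2_plus) = UNIV"
proof -
  let ?D = "\<Union>t. L2_shift t ` L2_plus"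
  have add: "L2_shift s x + L2_shift t y \<in> ?D" if "x \<in> L2_plus" "y \<in> L2_plus" for s t x y
  proof -
    have "L2_shift (s - min s t) x + L2_shift (t - min s t) y \<in> L2_plus"
      using that L2_plus_shift by (intro subspace_add L2_plus_subspace) auto
    moreover have "L2_shift s x + L2_shift t y =
        L2_shift (min s t) (L2_shift (s - min s t) x + L2_shift (t - min s t) y)"
      by (simp add: L2_shift_add flip: L2_shift_shift)
    ultimately show ?thesis by blast
  qed
  have scale: "L2_scale c (L2_shift t x) \<in> ?D" if "x \<in> L2_plus" for c t x
    using L2_plus_subspace(2)[OF that, of c] by (auto simp flip: L2_shift_scale)
  have "subspace ?D"
  proof (rule subspaceI)
    show "0 \<in> ?D"
      using subspace_0[OF L2_plus_subspace(1)] L2_shift_zero[of 0] by (metis UN_I UNIV_I imageI)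
    show "x + y \<in> ?D" if "x \<in> ?D" "y \<in> ?D" for x y using that add by auto
    show "c *\<^sub>R x \<in> ?D" if "x \<in> ?D" for c x using that scale by (auto simp: scaleR_L2_def)
  qed
  then have sub: "subspace (closure ?D)" by (rule subspace_closure)
  have pos: "1 * (norm x)\<^sup>2 \<le> x \<bullet> x" for x :: L2 by (simp add: power2_norm_eq_inner)
  show ?thesis
  proof (rule closed_subspace_eqI[where P = "\<lambda>x. x" and c = 1])
    fix f assume *: "\<And>w. w \<in> closure ?D \<Longrightarrow> f \<bullet> w = 0"
    have D: "f \<bullet> w = 0" if "w \<in> ?D" for w
      by (rule *) (rule subsetD[OF closure_subset that])
    show "f = 0"
    proof (rule L2_exp_cyclic)
      show "f \<bullet> L2_shift t L2_exp = 0" for t by (rule D) (use L2_exp_plus in blast)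
      show "f \<bullet> L2_i (L2_shift t L2_exp) = 0" for t by (rule D) (rule scale[OF L2_exp_plus])
    qed
  qed (use sub pos in \<open>auto simp: bounded_linear_ident\<close>)
qed

text \<open>Closedness of \<open>L2_plus\<close> and strong continuity are assumptions, since they
  are carried over from the given representation by its unitary equivalence.\<close>

lemma L2_multiplicity_one:
  assumes "closed L2_plus" "\<And>x. continuous_on UNIV (\<lambda>t. L2_shift t x)"
  shows "multiplicity_one L2_i L2_shift L2_plus L2_exp"
proof (rule multiplicity_one.intro[OF complex_shift.intro multiplicity_one_axioms.intro])
  show "L2_shift t x \<in> L2_plus" if "0 \<le> t" "x \<in> L2_plus" for t x using that by (simp add: L2_plus_shift)
qed (fact L2_i_isometry L2_shift_isometry L2_shift_zero L2_shift_shift L2_shift_scale assms L2_plus_subspace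
    L2_shifts_dense L2_exp_plus L2_exp_norm L2_exp_eigen L2_exp_cyclic)+

text \<open>The scalar product is a parameter since the locale is used twice: for the given product
  with the unitary equivalence \<open>V\<close>, and for the twisted product with \<open>V\<close>
  followed by the model of g. The second use yields the Hilbert space and representation properties
  of the twisted product.\<close>

locale L2_model =
  fixes smul :: "complex \<Rightarrow> 'a::ab_group_add \<Rightarrow> 'a" and ip :: "'a \<Rightarrow> 'a \<Rightarrow> complex" and V :: "'a \<Rightarrow> L2"
  assumes lin: "Vector_Spaces.linear smul L2_scale V" and bij: "bij V"
    and ip: "ip x y = L2_ip (V x) (V y)"
begin

lemma vs: "vector_space smul" and V_add: "V (x + y) = V x + V y" and V_scale: "V (smul c x) = L2_scale c (V x)"
  using lin unfolding Vector_Spaces.linear_iff by auto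

lemma V_diff: "V (x - y) = V x - V y"
  using V_add[of "x - y" y] by simp

lemma V_inv: "V (inv V y) = y" "inv V (V x) = x"
  using bij by (simp_all add: bij_is_surj surj_f_inv_f bij_is_inj inv_f_f)

lemma V_inj: "V x = V y \<longleftrightarrow> x = y"
  using bij by (auto simp: bij_def inj_eq)

lemma ip_norm_V: "ip_norm ip x = norm (V x)"
  by (simp add: ip norm_L2_def inner_L2_def)

lemma dist_V: "ip_dist ip x y = dist (V x) (V y)"
  by (simp add: ip_dist_def ip_norm_V dist_norm V_diff)

lemma metric: "Metric_space UNIV (ip_dist ip)"
  by (rule Metric_space.intro) (auto simp: dist_V V_inj dist_commute dist_triangle)

lemma openin_V: "openin (ip_topology ip) A \<longleftrightarrow> open (V ` A)"
proof -
  interpret Metric_space UNIV "ip_dist ip" by (rule metric)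
  have ball: "V ` mball x r = ball (V x) r" for x r
  proof -
    have "y \<in> V ` mball x r \<longleftrightarrow> dist (V x) y < r" for y
      by (metis (mono_tags, lifting) V_inv(1) dist_V image_iff in_mball UNIV_I)
    then show ?thesis unfolding set_eq_iff mem_ball by blast
  qed
  have "mball x r \<subseteq> A \<longleftrightarrow> ball (V x) r \<subseteq> V ` A" for x r
    using bij by (simp add: ball[symmetric] bij_is_inj inj_image_subset_iff)
  then show ?thesis
    unfolding openin_mtopology open_contains_ball by auto
qed

lemma closedin_V: "closedin (ip_topology ip) A \<longleftrightarrow> closed (V ` A)"
proof -
  have "topspace (ip_topology ip) = UNIV" using Metric_space.topspace_mtopology[OF metric] .
  then have "closedin (ip_topology ip) A \<longleftrightarrow> open (V ` (- A))"
    by (simp add: closedin_def openin_V Compl_eq_Diff_UNIV)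
  then show ?thesis using bij by (simp add: bij_image_Compl_eq closed_def)
qed

lemma continuous_V: "continuous_map euclideanreal (ip_topology ip) f \<longleftrightarrow> continuous_on UNIV (\<lambda>t. V (f t))"
proof -
  have "topspace (ip_topology ip) = UNIV" using Metric_space.topspace_mtopology[OF metric] .
  then have "continuous_map euclideanreal (ip_topology ip) f \<longleftrightarrow> (\<forall>A. open (V ` A) \<longrightarrow> open (f -` A))"
    by (simp add: continuous_map_def openin_V vimage_def)
  also have "\<dots> \<longleftrightarrow> (\<forall>B. open B \<longrightarrow> open ((\<lambda>t. V (f t)) -` B))"
  proof (intro iffI allI impI)
    fix B :: "L2 set" assume "\<forall>A. open (V ` A) \<longrightarrow> open (f -` A)" "open B"
    moreover have "V ` (V -` B) = B" using bij by (simp add: bij_is_surj)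
    ultimately have "open (f -` (V -` B))" by metis
    then show "open ((\<lambda>t. V (f t)) -` B)" by (simp add: vimage_def)
  next
    fix A assume *: "\<forall>B. open B \<longrightarrow> open ((\<lambda>t. V (f t)) -` B)" "open (V ` A)"
    have "(\<lambda>t. V (f t)) -` (V ` A) = f -` A" by (auto simp: V_inj)
    then show "open (f -` A)" using * by metis
  qed
  also have "\<dots> \<longleftrightarrow> continuous_on UNIV (\<lambda>t. V (f t))"
    by (simp add: continuous_on_open_vimage)
  finally show ?thesis .
qed

lemma hilbert: "complex_hilbert_space smul ip"
proof (rule complex_hilbert_space.intro[OF vs], rule complex_hilbert_space_axioms.intro)
  interpret Metric_space UNIV "ip_dist ip" by (rule metric)
  show "mcomplete"
    unfolding mcomplete_def
  proof (intro allI impI)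
    fix \<sigma> assume \<sigma>: "MCauchy \<sigma>"
    have "Cauchy (\<lambda>n. V (\<sigma> n))"
      using \<sigma> by (simp add: MCauchy_def Cauchy_def dist_V[symmetric])
    then obtain y where "(\<lambda>n. V (\<sigma> n)) \<longlonglongrightarrow> y" using Cauchy_convergent[THEN convergent_LIMSEQ_iff[THEN iffD1]] by auto
    then have "\<forall>\<epsilon>>0. \<forall>\<^sub>F n in sequentially. dist (V (\<sigma> n)) (V (inv V y)) < \<epsilon>"
      by (simp add: V_inv tendsto_iff)
    then have "limitin mtopology \<sigma> (inv V y) sequentially"
      unfolding limit_metric_sequentially by (simp add: dist_V eventually_sequentially)
    then show "\<exists>x. limitin mtopology \<sigma> x sequentially" by blast
  qed
  show "ip x x \<in> \<real>\<^sub>\<ge>\<^sub>0" for x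
    by (rule L2_cases[of "V x"]) (simp add: ip L2_ip_self)
  show "ip x x = 0 \<Longrightarrow> x = 0" for x
    using L2_ip_definite[of "V x"] V_inj[of x 0] V_diff[of 0 0] by (simp add: ip)
  show "ip x y = cnj (ip y x)" for x y unfolding ip by (rule L2_ip_commute)
qed (simp_all add: ip V_add V_scale L2_ip_add_right L2_ip_scale_right)

lemma linear_transfer:
  assumes "bounded_linear A" "\<And>x. A (L2_i x) = L2_i (A x)" "\<And>x. V (F x) = A (V x)"
  shows "F (x + y) = F x + F y" "F (smul c x) = smul c (F x)"
    "F \<in> bounded_operators_on smul ip UNIV" "Vector_Spaces.linear smul smul F"
proof -
  interpret A: bounded_linear A by fact
  have "A (L2_scale c x) = L2_scale c (A x)" for c x
    by (simp add: L2_scale_eq[of c] A.add A.scaleR assms(2))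
  then show *: "F (x + y) = F x + F y" "F (smul c x) = smul c (F x)" for x y c
    by (simp_all add: V_inj[symmetric] V_add V_scale assms(3) A.add)
  obtain K where "\<And>x. norm (A x) \<le> norm x * K" using A.bounded by blast
  then have "ip_norm ip (F x) \<le> K * ip_norm ip x" for x
    unfolding ip_norm_V by (simp add: assms(3) mult.commute)
  then show "F \<in> bounded_operators_on smul ip UNIV"
    unfolding bounded_operators_on_def using * by auto
  show "Vector_Spaces.linear smul smul F"
    unfolding Vector_Spaces.linear_iff using * vs by blast
qed

lemma GL_transfer:
  assumes "bounded_linear A" "bounded_linear B" "\<And>x. A (L2_i x) = L2_i (A x)"
    "\<And>x. A (B x) = x" "\<And>x. B (A x) = x" "\<And>x. V (F x) = A (V x)"
  shows "F \<in> GL smul ip" "bij F"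
proof -
  have BI: "B (L2_i x) = L2_i (B x)" for x by (metis assms(3,4,5))
  define E where "E = (\<lambda>x. inv V (B (V x)))"
  have E: "V (E x) = B (V x)" for x by (simp add: E_def V_inv)
  have FE: "F (E x) = x" "E (F x) = x" for x
    by (simp_all add: V_inj[symmetric] E assms)
  then show "bij F" by (metis bijI')
  moreover have "inv F = E" using FE by (intro inv_unique_comp) auto
  ultimately show "F \<in> GL smul ip"
    unfolding GL_def using linear_transfer(3)[OF assms(1,3,6)] linear_transfer(3)[OF assms(2) BI E] by auto
qed

lemma unitary_transfer:
  assumes "bounded_linear A" "\<And>x. A (L2_i x) = L2_i (A x)" "\<And>x y. A x \<bullet> A y = x \<bullet> y"
    "bij F" "\<And>x. V (F x) = A (V x)"
  shows "unitary_operator smul ip F"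
proof -
  have "L2_ip (A x) (A y) = L2_ip x y" for x y
    by (simp add: L2_ip_inner assms(3) flip: assms(2))
  then show ?thesis
    unfolding unitary_map_def using assms(4,5) linear_transfer(4)[OF assms(1,2,5)] by (simp add: ip)
qed

lemma pair_representation_transfer:
  assumes U: "\<And>t x. V (U t x) = L2_shift t (V x)" and Ep: "V ` Ep = L2_plus"
    and "closed L2_plus" "\<And>x. continuous_on UNIV (\<lambda>t. L2_shift t x)"
  shows "pair_representation smul ip Ep U"
proof -
  have mem: "x \<in> Ep \<longleftrightarrow> V x \<in> L2_plus" for x using Ep V_inj by (metis image_iff)
  have U_add: "U (s + t) x = U s (U t x)" and U_0: "U 0 x = x" for s t x
    by (simp_all add: V_inj[symmetric] U L2_shift_shift L2_shift_zero)
  then have "bij (U t)" for t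
    by (intro o_bij[of "U (- t)"]) (auto simp: fun_eq_iff simp flip: U_add)
  then have "unitary_operator smul ip (U t)" for t
    by (intro unitary_transfer[OF L2_shift_isometry(1) L2_shift_scale L2_shift_isometry(2) _ U])
  moreover have "module.subspace smul Ep"
  proof -
    interpret vector_space smul by (rule vs)
    show ?thesis
      using L2_plus_subspace V_diff[of 0 0]
      by (auto simp: subspace_def mem V_add V_scale intro: Real_Vector_Spaces.subspace_0 Real_Vector_Spaces.subspace_add)
  qed
  ultimately show ?thesis
    unfolding pair_representation_def unitary_one_parameter_group_def
    using hilbert assms(3,4) U_add U_0 L2_plus_shift
    by (auto simp: continuous_V closedin_V U Ep fun_eq_iff mem)
qed

end

theorem theorem4p5:
  fixes smul :: "complex \<Rightarrow> 'a::ab_group_add \<Rightarrow> 'a"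
    and ip :: "'a \<Rightarrow> 'a \<Rightarrow> complex"
    and Ep :: "'a set"
    and U :: "real \<Rightarrow> 'a \<Rightarrow> 'a"
    and H :: "'a \<Rightarrow> 'a"
  assumes "hankel_positive_representation smul ip Ep U H"
    and "regular_representation smul ip Ep U"
    and "multiplicity_free smul ip Ep U"
  shows "\<exists>g \<theta>.
      g \<in> GL smul ip \<and> g ` Ep = Ep \<and> (\<forall>t. g \<circ> U t = U t \<circ> g) \<and>
      \<theta> \<in> GL smul ip \<and> unitary_involution smul ip \<theta> \<and>
      (\<forall>t. \<theta> \<circ> U t \<circ> \<theta> = U (- t)) \<and>
      unitary_operator smul (twisted_ip ip g) \<theta> \<and>
      reflection_positive_representation smul (twisted_ip ip g) Ep \<theta> U \<and>
      (\<forall>\<xi>\<in>Ep. \<forall>\<eta>\<in>Ep.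
         ip \<xi> (H \<eta>) = twisted_ip ip g \<xi> (\<theta> \<eta>) \<and>
         twisted_ip ip g \<xi> (\<theta> \<eta>) = ip (g \<xi>) (g (\<theta> \<eta>)))"
proof -
  obtain V where V: "unitary_map smul ip L2_scale L2_ip V" and VEp: "V ` Ep = L2_plus"
    and VU': "\<And>t. V \<circ> U t = L2_shift t \<circ> V"
    using assms(3) by (auto simp: multiplicity_free_def unitarily_equivalent_def)
  interpret M: L2_model smul ip V
    using V by (intro L2_model.intro) (auto simp: unitary_map_def)
  have VU: "V (U t x) = L2_shift t (V x)" for t x using VU'[of t] by (auto simp: fun_eq_iff)
  have mem: "x \<in> Ep \<longleftrightarrow> V x \<in> L2_plus" for x using VEp M.V_inj by (metis image_iff)
  have rep: "pair_representation smul ip Ep U" and H: "H \<in> bounded_operators_on smul ip Ep"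
    "\<And>x. x \<in> Ep \<Longrightarrow> ip x (H x) \<in> \<real>\<^sub>\<ge>\<^sub>0"
    "\<And>t x. 0 < t \<Longrightarrow> x \<in> Ep \<Longrightarrow> H (U t x) = adjoint_on ip Ep (U t) (H x)"
    using assms(1) by (auto simp: hankel_positive_representation_def positive_operator_on_def)
  have closed: "closed L2_plus" using rep by (simp add: pair_representation_def M.closedin_V VEp)
  have cont: "continuous_on UNIV (\<lambda>t. L2_shift t x)" for x
  proof -
    have "continuous_map euclideanreal (ip_topology ip) (\<lambda>t. U t (inv V x))"
      using rep by (simp add: pair_representation_def unitary_one_parameter_group_def)
    then show ?thesis by (simp add: M.continuous_V VU M.V_inv)
  qed
  interpret multiplicity_one L2_i L2_shift L2_plus L2_exp
    using closed cont by (rule L2_multiplicity_one)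
  obtain p where p: "bounded_linear p" "range p \<subseteq> L2_plus" "\<And>x. x \<in> L2_plus \<Longrightarrow> p x = x"
    "\<And>x w. w \<in> L2_plus \<Longrightarrow> p x \<bullet> w = x \<bullet> w" "\<And>x. p (L2_i x) = L2_i (p x)" "\<And>x. norm (p x) \<le> norm x"
    using orthogonal_projection by auto
  interpret p: bounded_linear p by fact
  \<comment> \<open>The model of \<open>H\<close>, made a bounded operator on all of
    \<open>L2\<close> by projecting to \<open>L2_plus\<close> first.\<close>
  define K where "K = (\<lambda>x. V (H (inv V (p x))))"
  have pEp: "inv V (p x) \<in> Ep" for x using p(2) by (auto simp: mem M.V_inv)
  have H_mem: "H x \<in> Ep" if "x \<in> Ep" for x using H(1) that by (auto simp: bounded_operators_on_def)
  have H_add: "H (x + y) = H x + H y" and H_scale: "H (smul c x) = smul c (H x)" if "x \<in> Ep" "y \<in> Ep" for x y c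
    using H(1) that by (auto simp: bounded_operators_on_def)
  have inv_add: "inv V (x + y) = inv V x + inv V y" and inv_scale: "inv V (L2_scale c x) = smul c (inv V x)" for x y c
    by (simp_all add: M.V_inj[symmetric] M.V_inv M.V_add M.V_scale)
  have K: "bounded_linear K"
  proof -
    obtain C where C: "\<forall>x\<in>Ep. ip_norm ip (H x) \<le> C * ip_norm ip x"
      using H(1) unfolding bounded_operators_on_def mem_Collect_eq by blast
    show ?thesis
    proof (rule bounded_linear_intro)
      show "K (x + y) = K x + K y" for x y
        by (simp add: K_def p.add inv_add H_add pEp M.V_add)
      show "K (r *\<^sub>R x) = r *\<^sub>R K x" for r x
        by (simp add: K_def p.scaleR) (simp add: scaleR_L2_def inv_scale H_scale[OF pEp pEp] M.V_scale)
      show "norm (K x) \<le> norm x * \<bar>C\<bar>" for x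
      proof -
        have "norm (K x) \<le> C * norm (p x)"
          using bspec[OF C pEp[of x]] unfolding M.ip_norm_V by (simp add: K_def M.V_inv)
        also have "\<dots> \<le> \<bar>C\<bar> * norm x" using p(6) by (intro mult_mono) auto
        finally show ?thesis by (simp add: mult.commute)
      qed
    qed
  qed
  have KI: "K (L2_i x) = L2_i (K x)" for x
    by (simp add: K_def p(5) inv_scale H_scale[OF pEp pEp] M.V_scale)
  have KH: "K (V x) = V (H x)" if "x \<in> Ep" for x
    using that by (simp add: K_def p(3) mem M.V_inv)
  have ipH: "ip x (H y) = Complex (V x \<bullet> K (V y)) (L2_i (V x) \<bullet> K (V y))" if "y \<in> Ep" for x y
    using that by (simp add: M.ip KH L2_ip_inner)
  define B where "B = (\<lambda>x y. x \<bullet> K y)"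
  have B: "bounded_bilinear B"
    unfolding B_def by (rule bounded_bilinear.comp[OF bounded_bilinear_inner bounded_linear_ident K])
  interpret B: bounded_bilinear B by fact
  \<comment> \<open>Nonnegativity in the complex order includes that <x, H x> is real; this is the
    second equation.\<close>
  have B_pos: "0 \<le> B x x" "B (L2_i x) x = 0" if "x \<in> L2_plus" for x
    using H(2)[of "inv V x"] ipH[of "inv V x" "inv V x"] that
    by (auto simp: B_def mem M.V_inv complex_nonneg_Reals_iff)
  have BI: "B (L2_i x) (L2_i y) = B x y" if "x \<in> L2_plus" "y \<in> L2_plus" for x y
    by (simp add: B_def KI L2_i_isometry)
  have B_sym: "B x y = B y x" if xy: "x \<in> L2_plus" "y \<in> L2_plus" for x y
  proof -
    have Ix: "L2_i x \<in> L2_plus" using xy(1) by (rule I_S)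
    \<comment> \<open>Polarisation: realness at \<open>L2_i x + y\<close>, at \<open>L2_i x\<close>
      and at \<open>y\<close> leaves exactly the symmetry of \<open>B\<close>.\<close>
    have "L2_i x + y \<in> L2_plus" using Ix xy S_subspace by (simp add: subspace_add)
    then have "B (L2_i (L2_i x + y)) (L2_i x + y) = 0" by (rule B_pos)
    then have "B (- x) y + B (L2_i y) (L2_i x) = 0"
      using B_pos(2)[OF Ix] B_pos(2)[OF xy(2)]
      by (simp add: bounded_linear.linear[OF I_linear] linear_add B.add_left B.add_right B.diff_left B.minus_left I_I)
    then show ?thesis by (simp add: B.minus_left BI xy)
  qed
  have B_hankel: "B (L2_shift t x) y = B x (L2_shift t y)" if t: "0 \<le> t" and xy: "x \<in> L2_plus" "y \<in> L2_plus" for t x y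
  proof (cases "t = 0")
    case False
    define \<eta> where "\<eta> = inv V y"
    have \<eta>: "\<eta> \<in> Ep" "V \<eta> = y" using xy by (simp_all add: \<eta>_def mem M.V_inv)
    \<comment> \<open>The adjoint of the compressed translation is the inverse translation followed
      by the projection. The definite description in \<open>adjoint_on\<close> also requires its
      uniqueness.\<close>
    define z where "z = inv V (p (L2_shift (- t) (V (H \<eta>))))"
    have z: "z \<in> Ep \<and> (\<forall>x\<in>Ep. ip (U t x) (H \<eta>) = ip x z)"
    proof
      show "z \<in> Ep" unfolding z_def by (rule pEp)
      show "\<forall>x\<in>Ep. ip (U t x) (H \<eta>) = ip x z"
      proof
        fix x assume "x \<in> Ep"
        then have "V x \<in> L2_plus" "L2_i (V x) \<in> L2_plus" by (auto simp: mem I_S)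
        then have "ip x z = L2_ip (V x) (L2_shift (- t) (V (H \<eta>)))"
          by (simp add: M.ip z_def M.V_inv L2_ip_inner inner_commute[of _ "p _"] p(4)) (simp add: inner_commute)
        also have "\<dots> = ip (U t x) (H \<eta>)"
          using L2_shift_ip[of t "V x" "L2_shift (- t) (V (H \<eta>))"] by (simp add: M.ip VU U_minus)
        finally show "ip (U t x) (H \<eta>) = ip x z" ..
      qed
    qed
    have "adjoint_on ip Ep (U t) (H \<eta>) = z"
      unfolding adjoint_on_def
    proof (rule the_equality[of _ z])
      show "z \<in> Ep \<and> (\<forall>x\<in>Ep. ip (U t x) (H \<eta>) = ip x z)" by (rule z)
      fix w assume w: "w \<in> Ep \<and> (\<forall>x\<in>Ep. ip (U t x) (H \<eta>) = ip x w)"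
      have "V (w - z) \<in> L2_plus" using w z S_subspace by (simp add: M.V_diff mem subspace_diff)
      then have "ip (w - z) w = ip (w - z) z" using w z by (auto simp: mem)
      then have "V (w - z) \<bullet> V (w - z) = 0"
        by (simp add: M.ip L2_ip_inner M.V_diff inner_diff_right)
      then show "w = z" by (simp add: M.V_diff M.V_inj)
    qed
    then have "H (U t \<eta>) = z" using H(3)[of t \<eta>] t False \<eta> by simp
    moreover have "U t \<eta> \<in> Ep" using \<eta> t by (simp add: mem VU U_S xy)
    ultimately have "ip (U t (inv V x)) (H \<eta>) = ip (inv V x) (H (U t \<eta>))" "U t \<eta> \<in> Ep"
      using z xy by (auto simp: mem M.V_inv)
    then show ?thesis using \<eta> ipH by (simp add: M.V_inv VU B_def)
  qed (simp add: L2_shift_zero)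
  show ?thesis
  proof (rule hankel_reflection[where R = L2_flip and B = B])
    fix g0 h0 \<theta>0 :: "L2 \<Rightarrow> L2"
    assume g: "bounded_linear g0" "bounded_linear h0" "\<And>x. g0 (h0 x) = x" "\<And>x. h0 (g0 x) = x"
    "\<And>t x. g0 (L2_shift t x) = L2_shift t (g0 x)" "\<And>x. g0 (L2_i x) = L2_i (g0 x)" "g0 ` L2_plus = L2_plus"
    and \<theta>: "bounded_linear \<theta>0" "\<And>x. \<theta>0 (\<theta>0 x) = x" "\<And>x y. \<theta>0 x \<bullet> \<theta>0 y = x \<bullet> y"
    "\<And>x. \<theta>0 (L2_i x) = L2_i (\<theta>0 x)"
    "\<And>t x. \<theta>0 (L2_shift t x) = L2_shift (- t) (\<theta>0 x)" "\<And>x y. g0 (\<theta>0 x) \<bullet> g0 (\<theta>0 y) = g0 x \<bullet> g0 y"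
    and gB: "\<And>x y. x \<in> L2_plus \<Longrightarrow> y \<in> L2_plus \<Longrightarrow> g0 x \<bullet> g0 (\<theta>0 y) = B x y"
    define g where "g = (\<lambda>x. inv V (g0 (V x)))"
    define \<theta> where "\<theta> = (\<lambda>x. inv V (\<theta>0 (V x)))"
    have Vg: "V (g x) = g0 (V x)" and V\<theta>: "V (\<theta> x) = \<theta>0 (V x)" for x
      by (simp_all add: g_def \<theta>_def M.V_inv)
    have tw: "twisted_ip ip g x y = L2_ip (g0 (V x)) (g0 (V y))" for x y
      by (simp add: twisted_ip_def M.ip Vg)
    have g0_scale: "g0 (L2_scale c x) = L2_scale c (g0 x)" for c x
      by (simp add: L2_scale_eq[of c] linear_add linear_scale bounded_linear.linear[OF g(1)] g(6))
    \<comment> \<open>The twisted product is the product of \<open>L2\<close> pulled back along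
      \<open>g0\<close> after \<open>V\<close>; as \<open>g0\<close> commutes with translations and
      preserves \<open>L2_plus\<close>, this map is again an equivalence with the model.\<close>
    interpret N: L2_model smul "twisted_ip ip g" "\<lambda>x. g0 (V x)"
    proof (rule L2_model.intro)
      show "Vector_Spaces.linear smul L2_scale (\<lambda>x. g0 (V x))"
        unfolding Vector_Spaces.linear_iff
        using M.vs vector_space_L2 by (simp add: M.V_add M.V_scale g0_scale linear_add bounded_linear.linear[OF g(1)])
      have "bij g0" by (rule o_bij[of h0]) (auto simp: fun_eq_iff g)
      then show "bij (\<lambda>x. g0 (V x))" using bij_comp[OF M.bij] by (simp add: comp_def)
    qed (rule tw)
    have gGL: "g \<in> GL smul ip" "bij g" using M.GL_transfer[OF g(1,2,6,3,4) Vg] by auto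
    have \<theta>GL: "\<theta> \<in> GL smul ip" "bij \<theta>" using M.GL_transfer[OF \<theta>(1,1,4,2,2) V\<theta>] by auto
    have gEp: "g ` Ep = Ep"
    proof -
      have "V ` (g ` Ep) = V ` Ep" using g(7) by (simp add: image_image Vg flip: VEp)
      then show ?thesis using M.bij by (simp add: bij_is_inj inj_image_eq_iff)
    qed
    have gU: "g \<circ> U t = U t \<circ> g" for t
      by (simp add: fun_eq_iff M.V_inj[symmetric] Vg VU g(5))
    have \<theta>\<theta>: "\<theta> \<circ> \<theta> = id"
      by (simp add: fun_eq_iff M.V_inj[symmetric] V\<theta> \<theta>(2))
    have \<theta>U: "\<theta> \<circ> U t \<circ> \<theta> = U (- t)" for t
      by (simp add: fun_eq_iff M.V_inj[symmetric] V\<theta> VU \<theta>(5,2))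
    have \<theta>_unitary: "unitary_operator smul ip \<theta>"
      by (rule M.unitary_transfer[OF \<theta>(1,4,3) \<theta>GL(2) V\<theta>])
    have \<theta>_unitary': "unitary_operator smul (twisted_ip ip g) \<theta>"
    proof -
      have "L2_ip (g0 (\<theta>0 x)) (g0 (\<theta>0 y)) = L2_ip (g0 x) (g0 y)" for x y
        by (simp add: L2_ip_inner \<theta>(6) flip: g(6) \<theta>(4))
      then show ?thesis
        using \<theta>_unitary by (simp add: unitary_map_def tw V\<theta>)
    qed
    \<comment> \<open>The real identity \<open>gB\<close> at \<open>V x\<close> gives the real part,
      and at \<open>L2_i (V x)\<close> the imaginary part.\<close>
    have ip_eq: "ip x (H y) = twisted_ip ip g x (\<theta> y)" if "x \<in> Ep" "y \<in> Ep" for x y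
      using that gB[of "V x" "V y"] gB[of "L2_i (V x)" "V y"] ipH[OF that(2), of x] I_S
      by (simp add: tw V\<theta> L2_ip_inner mem B_def flip: g(6))
    have "pair_representation smul (twisted_ip ip g) Ep U"
    proof (rule N.pair_representation_transfer[OF _ _ closed cont])
      show "g0 (V (U t x)) = L2_shift t (g0 (V x))" for t x by (simp add: VU g(5))
      show "(\<lambda>x. g0 (V x)) ` Ep = L2_plus" using g(7) by (simp add: image_image flip: VEp)
    qed
    then have "reflection_positive_representation smul (twisted_ip ip g) Ep \<theta> U"
      using \<theta>_unitary' \<theta>\<theta> \<theta>U H(2) ip_eq
      by (auto simp: reflection_positive_representation_def unitary_involution_def)
    then show ?thesis
      using gGL gEp gU \<theta>GL \<theta>_unitary \<theta>_unitary' \<theta>\<theta> \<theta>U ip_eq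
      by (intro exI[of _ g] exI[of _ \<theta>]) (auto simp: unitary_involution_def twisted_ip_def)
  qed (fact L2_flip_isometry L2_flip_linear L2_flip_orthogonal B B_sym B_hankel BI)+
qed

end
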